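(* Let $m_1,m_2\ge 2$ be integers with $2m_2\ge m_1\ge m_2$. Then $$N_u(m_1,m_2)=\begin{cases}3 & \text{if } m_1=m_2,\\ 2 & \text{if } m_1=m_2+1,\\ 3 & \text{otherwise,}\end{cases}$$ and $$N_e(m_1,m_2)=N_b(m_1,m_2)=\begin{cases}1 & \text{if } m_1=m_2,\\ 2 & \text{if } m_1>m_2 \text{ and } (m_1-m_2)\mid m_2,\\ 3 & \text{otherwise.}\end{cases}$$
   Context: Let $\mathit{PD}(m)$ be the cone of real symmetric positive definite $m\times m$ matrices. For $\Sigma_1\in\mathit{PD}(m_1)$, $\Sigma_2\in\mathit{PD}(m_2)$, a random matrix $Y\in\mathbb{R}^{m_1\times m_2}$ has the (regular, mean-zero) matrix normal distribution $\mathcal N(0,\Sigma_2\otimes\Sigma_1)$ if $Y\stackrel{d}{=}AZB^T$ where $Z$ is $m_1\times m_2$ with i.i.d. standard normal entries, $\Sigma_1=AA^T$, $\Sigma_2=BB^T$; equivalently, the vectorization of $Y$ is centered Gaussian with covariance $\Sigma_2\otimes\Sigma_1$. Let $Y_1,\dots,Y_n$ be i.i.d. from such a distribution. Up to an additive constant, twice the log-likelihood as a function of the precision matrices $\Psi_j=\Sigma_j^{-1}$ is $$\ell(\Psi_1,\Psi_2)=nm_2\log\det(\Psi_1)+nm_1\log\det(\Psi_2)-\operatorname{tr}\Big(\Psi_1\sum_{i=1}^nY_i\Psi_2Y_i^T\Big),\quad (\Psi_1,\Psi_2)\in\mathit{PD}(m_1)\times\mathit{PD}(m_2).$$ The Kronecker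 MLE exists if $\ell$ achieves its maximum over $\mathit{PD}(m_1)\times\mathit{PD}(m_2)$. It exists uniquely if in addition all local maxima of $\ell$ have the same Kronecker product $\Psi_2\otimes\Psi_1$. The existence threshold $N_e(m_1,m_2)$, uniqueness threshold $N_u(m_1,m_2)$ and boundedness threshold $N_b(m_1,m_2)$ are the positive integers such that: the Kronecker MLE exists almost surely if and only if $n\ge N_e(m_1,m_2)$; the Kronecker MLE exists uniquely almost surely if and only if $n\ge N_u(m_1,m_2)$; $\ell$ is bounded above almost surely if and only if $n\ge N_b(m_1,m_2)$. *)

theory Defs
  imports "HOL-Probability.Probability"
begin

definition PD :: "(real^'m^'m) set" where
  "PD = {S. transpose S = S \<and> (\<forall>x. x \<noteq> 0 \<longrightarrow> 0 < x \<bullet> (S *v x))}"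

definition kronecker_product ::
    "real^'b^'a \<Rightarrow> real^'d^'c \<Rightarrow> real^('b \<times> 'd)^('a \<times> 'c)" where
  "kronecker_product S T = (\<chi> p q. S $ fst p $ fst q * T $ snd p $ snd q)"

definition std_normal_matrix :: "(real^'m2^'m1) measure" where
  "std_normal_matrix =
     distr (PiM (UNIV :: ('m1 \<times> 'm2) set) (\<lambda>_. std_normal_distribution)) borel
       (\<lambda>z. \<chi> i j. z (i, j))"

text \<open>
  The law \<open>D\<close> of \<open>A Z B\<^sup>T\<close> depends on \<open>A\<close> and \<open>B\<close> only through \<open>A A\<^sup>T\<close> and \<open>B B\<^sup>T\<close>, so \<open>D\<close> is
  uniquely determined by \<open>S1\<close> and \<open>S2\<close>. A relation avoids choosing particular factors.
\<close>

definition is_matrix_normal ::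
    "real^'m1^'m1 \<Rightarrow> real^'m2^'m2 \<Rightarrow> (real^'m2^'m1) measure \<Rightarrow> bool" where
  "is_matrix_normal S1 S2 D \<longleftrightarrow>
     (\<exists>(A :: real^'m1^'m1) (B :: real^'m2^'m2). S1 = A ** transpose A \<and> S2 = B ** transpose B \<and>
        D = distr std_normal_matrix borel (\<lambda>Z. A ** Z ** transpose B))"

text \<open>Twice the log-likelihood of the sample \<open>Y 0, \<dots>, Y (n - 1)\<close>, up to an additive constant.\<close>

definition loglik ::
    "nat \<Rightarrow> (nat \<Rightarrow> real^'m2^'m1) \<Rightarrow> (real^'m1^'m1) \<times> (real^'m2^'m2) \<Rightarrow> real" where
  "loglik n Y = (\<lambda>(P1, P2).
     real n * real CARD('m2) * ln (det P1) + real n * real CARD('m1) * ln (det P2)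
     - trace (P1 ** (\<Sum>i<n. Y i ** P2 ** transpose (Y i))))"

definition loglik_bounded :: "nat \<Rightarrow> (nat \<Rightarrow> real^'m2^'m1) \<Rightarrow> bool" where
  "loglik_bounded n Y \<longleftrightarrow> bdd_above (loglik n Y ` (PD \<times> PD))"

definition mle_exists :: "nat \<Rightarrow> (nat \<Rightarrow> real^'m2^'m1) \<Rightarrow> bool" where
  "mle_exists n Y \<longleftrightarrow> (\<exists>P \<in> PD \<times> PD. \<forall>Q \<in> PD \<times> PD. loglik n Y Q \<le> loglik n Y P)"

definition is_local_max ::
    "nat \<Rightarrow> (nat \<Rightarrow> real^'m2^'m1) \<Rightarrow> (real^'m1^'m1) \<times> (real^'m2^'m2) \<Rightarrow> bool" where
  "is_local_max n Y P \<longleftrightarrow>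
     P \<in> PD \<times> PD \<and> (\<forall>\<^sub>F Q in at P within PD \<times> PD. loglik n Y Q \<le> loglik n Y P)"

definition mle_exists_uniquely :: "nat \<Rightarrow> (nat \<Rightarrow> real^'m2^'m1) \<Rightarrow> bool" where
  "mle_exists_uniquely n Y \<longleftrightarrow> mle_exists n Y \<and>
     (\<forall>P1 P2 Q1 Q2. is_local_max n Y (P1, P2) \<longrightarrow> is_local_max n Y (Q1, Q2) \<longrightarrow>
        kronecker_product P2 P1 = kronecker_product Q2 Q1)"

text \<open>
  \<open>N\<close> is the positive integer such that, for an i.i.d. matrix normal sample of size \<open>n\<close>,
  the property \<open>\<Phi>\<close> holds almost surely iff \<open>n \<ge> N\<close>. The joint law of the sample is the product
  measure. The dimensions \<open>m1 = CARD('m1)\<close> and \<open>m2 = CARD('m2)\<close> come from the type of \<open>\<Phi>\<close>.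
  Sample sizes are positive: for \<open>n = 0\<close> the function \<^const>\<open>loglik\<close> is constantly zero.
\<close>

definition is_threshold :: "(nat \<Rightarrow> (nat \<Rightarrow> real^'m2^'m1) \<Rightarrow> bool) \<Rightarrow> nat \<Rightarrow> bool" where
  "is_threshold \<Phi> N \<longleftrightarrow> N > 0 \<and>
     (\<forall>S1 \<in> PD. \<forall>S2 \<in> PD. \<forall>D. is_matrix_normal S1 S2 D \<longrightarrow>
        (\<forall>n > 0. (AE Y in PiM {..<n} (\<lambda>_. D). \<Phi> n Y) \<longleftrightarrow> n \<ge> N))"

abbreviation is_existence_threshold :: "'m1::finite itself \<Rightarrow> 'm2::finite itself \<Rightarrow> nat \<Rightarrow> bool" where
  "is_existence_threshold _ _ \<equiv> is_threshold (mle_exists :: nat \<Rightarrow> (nat \<Rightarrow> real^'m2^'m1) \<Rightarrow> bool)"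

abbreviation is_uniqueness_threshold :: "'m1::finite itself \<Rightarrow> 'm2::finite itself \<Rightarrow> nat \<Rightarrow> bool" where
  "is_uniqueness_threshold _ _ \<equiv>
     is_threshold (mle_exists_uniquely :: nat \<Rightarrow> (nat \<Rightarrow> real^'m2^'m1) \<Rightarrow> bool)"

abbreviation is_boundedness_threshold :: "'m1::finite itself \<Rightarrow> 'm2::finite itself \<Rightarrow> nat \<Rightarrow> bool" where
  "is_boundedness_threshold _ _ \<equiv>
     is_threshold (loglik_bounded :: nat \<Rightarrow> (nat \<Rightarrow> real^'m2^'m1) \<Rightarrow> bool)"

end

theory Submission
  imports Defs "HOL-Computational_Algebra.Fundamental_Theorem_Algebra" "HOL-Library.Numeral_Type"
begin

text \<open>
  Write \<open>k = m1 - m2\<close>. Congruence diagonalises two positive definite matrices simultaneously. In the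
  resulting coordinates the log-likelihood is a linear function of the logarithms \<open>m\<^sub>a\<close>, \<open>v\<^sub>b\<close> of the eigenvalues minus a
  nonnegative combination of the exponentials \<open>exp (m\<^sub>a + v\<^sub>b)\<close> (\<open>loglik_frame\<close>). From \<open>exp x \<ge> 1 + x\<close>, with
  equality only at \<open>0\<close>, every local maximum is global, and two of them differ by a symmetry of the sample
  (\<open>two_local_maxima\<close>). Invertible changes of coordinates shift the log-likelihood by a constant, so the three
  properties depend only on the orbit of the sample under left and right multiplication, that is, on a
  representation of a Kronecker quiver.

  If all \<open>Y\<^sub>i\<^sup>T\<close> map a subspace \<open>W\<close> into a subspace \<open>V\<close> with \<open>dim V / m2 < dim W / m1\<close>, then \<open>P\<^sub>1\<close> and \<open>P\<^sub>2\<close> can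
  be stretched along these subspaces so that the log-likelihood tends to infinity (\<open>unbounded_if_destabilised\<close>). If
  the reverse strict inequality holds for all proper pairs of subspaces, the sample is stable, a maximum exists because the
  log-likelihood is coercive up to scaling (\<open>stable_mle_exists\<close>), and it is unique (\<open>stable_exists_unique\<close>). A
  sample with \<open>\<Sum> Y\<^sub>i Y\<^sub>i\<^sup>T\<close> and \<open>\<Sum> Y\<^sub>i\<^sup>T Y\<^sub>i\<close> scalar and suitably normalised, called balanced, has a maximum at the
  identity, whether or not it is stable (\<open>balanced_mle\<close>).

  The distribution enters only through its null sets, which are those of Lebesgue measure (\<open>AE_matrix_normal_sample\<close>).
  The samples that have an invariant pair of subspaces of given dimensions are the image of a space of parameters. When
  that space has too small a dimension they are negligible (\<open>negligible_invariant_subspaces\<close>). For \<open>n \<ge> 3\<close>, and for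
  \<open>n = 2\<close> and \<open>k = 1\<close>, this count makes almost every sample stable. The other cases are these.

  \<^item> \<open>n = 1\<close>. For \<open>k > 0\<close> the kernel of \<open>Y\<^sub>1\<^sup>T\<close> destabilises. For \<open>k = 0\<close> an invertible \<open>Y\<^sub>1\<close> is balanced after a change
    of coordinates, and every invertible matrix gives a symmetry.

  \<^item> \<open>n = 2\<close>, \<open>k > 0\<close>. The pencil \<open>Y\<^sub>1\<^sup>T - t Y\<^sub>2\<^sup>T\<close> annihilates a nonzero polynomial vector of degree at most \<open>m2 div k\<close>.
    If \<open>k\<close> does not divide \<open>m2\<close>, its coefficients always span a destabilising subspace (\<open>two_samples_unbounded\<close>). If \<open>k\<close>
    divides \<open>m2\<close>, almost every pair is equivalent to a direct sum of \<open>k\<close> copies of one Kronecker block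
    (\<open>two_samples_normal_form\<close>). Binomial weights make this sum balanced, and for \<open>k \<ge> 2\<close> the copies can be scaled
    independently.

  \<^item> \<open>n = 2\<close>, \<open>k = 0\<close>. Almost every pair amounts to a matrix with simple eigenvalues. Such a matrix is normal for a
    suitable inner product, so the pair is balanced in suitable coordinates. With positive probability the
    matrix has two different real eigenvalues, and then a polynomial in it is a symmetry that spoils uniqueness.
\<close>

section \<open>Matrix algebra\<close>

definition diagm :: "('n \<Rightarrow> 'a::zero) \<Rightarrow> 'a^'n^'n" where
  "diagm d = (\<chi> i j. if i = j then d i else 0)"

lemma diagm_nth [simp]: "diagm d $ i $ j = (if i = j then d i else 0)"
  by (simp add: diagm_def)

lemma diagm_mult_nth [simp]:
  fixes A :: "'a::semiring_1^'n^'m"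
  shows "(diagm d ** A) $ i $ j = d i * A $ i $ j"
  by (simp add: matrix_matrix_mult_def if_distrib if_distribR sum.delta' cong: if_cong)

lemma mult_diagm_nth [simp]:
  fixes A :: "'a::comm_semiring_1^'n^'m"
  shows "(A ** diagm d) $ i $ j = d j * A $ i $ j"
  by (simp add: matrix_matrix_mult_def if_distrib if_distribR sum.delta mult.commute cong: if_cong)

lemma transpose_diagm [simp]: "transpose (diagm d) = diagm d"
  by (simp add: transpose_def vec_eq_iff)

lemma det_diagm [simp]: "det (diagm d :: 'a::comm_ring_1^'n^'n) = (\<Prod>i\<in>UNIV. d i)"
  by (subst det_diagonal) auto

lemma diagm_mult_diagm: "diagm d ** diagm e = (diagm (\<lambda>i. d i * e i) :: 'a::semiring_1^'n^'n)"
  by (simp add: vec_eq_iff)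

lemma diagm_one [simp]: "diagm (\<lambda>i. 1) = mat 1"
  by (simp add: vec_eq_iff mat_def)

lemma diagm_vector_nth [simp]: "(diagm d *v x) $ i = (d i * x $ i :: 'a::semiring_1)"
  by (simp add: matrix_vector_mult_def if_distrib if_distribR sum.delta' cong: if_cong)

lemma dot_matrix_vector_transpose:
  fixes A :: "real^'n^'m"
  shows "x \<bullet> (A *v y) = (transpose A *v x) \<bullet> y"
  by (simp add: dot_lmul_matrix transpose_matrix_vector)

lemma trace_sum: "trace (\<Sum>i\<in>I. f i :: real^'n^'n) = (\<Sum>i\<in>I. trace (f i))"
  by (induction I rule: infinite_finite_induct) (auto simp: trace_add, simp_all add: trace_def)

lemma matrix_mult_sum_right:
  fixes A :: "real^'n^'m" and f :: "'i \<Rightarrow> real^'k^'n"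
  shows "A ** (\<Sum>i\<in>I. f i) = (\<Sum>i\<in>I. A ** f i)"
  by (induction I rule: infinite_finite_induct) (auto simp: matrix_add_ldistrib)

lemma matrix_mult_sum_left:
  fixes A :: "real^'n^'m" and f :: "'i \<Rightarrow> real^'m^'k"
  shows "(\<Sum>i\<in>I. f i) ** A = (\<Sum>i\<in>I. f i ** A)"
  by (simp add: vec_eq_iff matrix_matrix_mult_def sum_distrib_right) (intro allI sum.swap)

lemma matrix_mult_scaleR: "(A::real^'n^'m) ** (c *\<^sub>R (B::real^'k^'n)) = c *\<^sub>R (A ** B)"
  and scaleR_matrix_mult: "(c *\<^sub>R A) ** B = c *\<^sub>R (A ** B)"
  by (simp_all add: vec_eq_iff matrix_matrix_mult_def sum_distrib_left mult_ac)

lemma matrix_add_rdistrib: "((A::real^'n^'m) + B) ** (C::real^'k^'n) = A ** C + B ** C"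
  by (simp add: vec_eq_iff matrix_matrix_mult_def distrib_right sum.distrib)

lemma matrix_diff_ldistrib: "(A::real^'n^'m) ** ((B::real^'k^'n) - C) = A ** B - A ** C"
  by (simp add: vec_eq_iff matrix_matrix_mult_def right_diff_distrib sum_subtractf)

lemma transpose_scaleR: "transpose (c *\<^sub>R A) = c *\<^sub>R transpose (A::real^'n^'m)"
  by (simp add: transpose_def vec_eq_iff)

lemma mat_eq_diagm: "mat c = diagm (\<lambda>_. c)"
  by (simp add: vec_eq_iff mat_def)

lemma mat_mult_vector: "mat c *v x = c *\<^sub>R (x::real^'n)"
  by (simp add: mat_eq_diagm vec_eq_iff)

lemma mat_mult_commute: "mat c ** K = K ** (mat c :: real^'n^'n)"
  by (simp add: mat_eq_diagm vec_eq_iff)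

lemma mult_mat_mult_nth:
  fixes A :: "real^'n^'m" and C :: "real^'k^'n"
  shows "(A ** mat c ** C) $ i $ j = c * (A ** C) $ i $ j"
proof -
  have "A ** mat c = (\<chi> i j. c * A $ i $ j)"
    using mult_diagm_nth[of A "\<lambda>_. c"] by (simp add: vec_eq_iff mat_def diagm_def)
  then show ?thesis by (simp add: matrix_matrix_mult_def sum_distrib_left mult.assoc)
qed

lemma det_scaleR_matrix:
  fixes A :: "real^'n^'n"
  shows "det (c *\<^sub>R A) = c ^ CARD('n) * det A"
proof -
  have "c *\<^sub>R A = diagm (\<lambda>_. c) ** A" by (simp add: vec_eq_iff)
  then show ?thesis by (simp add: det_mul)
qed

lemma transpose_inverse: "A ** A' = mat 1 \<Longrightarrow> transpose A' ** transpose A = (mat 1 :: real^'n^'n)"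
  by (simp flip: matrix_transpose_mul)

lemma invertible_transpose: "invertible (A::real^'n^'n) \<Longrightarrow> invertible (transpose A)"
  by (simp add: invertible_det_nz)

lemma invertible_mult_cancel:
  fixes A :: "real^'n^'n"
  assumes "invertible A" "A *v x = 0" shows "x = 0"
  using assms by (metis invertible_left_inverse matrix_left_invertible_ker)

section \<open>Symmetric and positive definite matrices\<close>

text \<open>At a maximiser of the Rayleigh quotient on the unit sphere of \<open>V\<close>, the quadratic form
  \<open>l \<parallel>x\<parallel>\<^sup>2 - x \<bullet> S x\<close> is nonnegative on \<open>V\<close> and vanishes at \<open>x\<close>, so the linear form \<open>l x - S x\<close> vanishes on \<open>V\<close>, in
  which it lies.\<close>

lemma symmetric_eigenvector_in_subspace:
  fixes S :: "real^'n^'n"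
  assumes S: "transpose S = S" and V: "subspace V" "V \<noteq> {0}" and inv: "\<And>x. x \<in> V \<Longrightarrow> S *v x \<in> V"
  obtains x l where "x \<in> V" "norm x = 1" "S *v x = l *\<^sub>R x"
proof -
  obtain v where v: "v \<in> V" "v \<noteq> 0" using V subspace_0 by blast
  have comp: "compact (sphere 0 1 \<inter> V)"
    using closed_subspace[OF V(1)] by (intro compact_Int_closed) auto
  have ne: "sphere 0 1 \<inter> V \<noteq> {}"
  proof -
    have "(1 / norm v) *\<^sub>R v \<in> sphere 0 1 \<inter> V" using v subspace_scale[OF V(1), of v] by simp
    then show ?thesis by blast
  qed
  have cont: "continuous_on (sphere 0 1 \<inter> V) (\<lambda>x. x \<bullet> (S *v x))"
    by (intro continuous_intros matrix_vector_mult_linear_continuous_on)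
  obtain x where x: "x \<in> V" "norm x = 1"
    and max: "\<And>y. y \<in> V \<Longrightarrow> norm y = 1 \<Longrightarrow> y \<bullet> (S *v y) \<le> x \<bullet> (S *v x)"
    using continuous_attains_sup[OF comp ne cont] by auto
  define l where "l = x \<bullet> (S *v x)"
  define q where "q = (\<lambda>y. l * (y \<bullet> y) - y \<bullet> (S *v y))"
  have q_nonneg: "q y \<ge> 0" if "y \<in> V" for y
  proof (cases "y = 0")
    case False
    have "(1 / norm y) *\<^sub>R y \<in> V" using that V(1) by (simp add: subspace_scale)
    from max[OF this] False
    have "(1 / norm y)\<^sup>2 * (y \<bullet> (S *v y)) \<le> l"
      by (simp add: l_def power2_eq_square matrix_vector_mult_scaleR inner_scaleR_left)
    then have "y \<bullet> (S *v y) \<le> l * (norm y)\<^sup>2"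
      using False by (simp add: field_simps power2_eq_square)
    then show ?thesis by (simp add: q_def power2_norm_eq_inner)
  qed (simp add: q_def)
  define w where "w = l *\<^sub>R x - S *v x"
  have wV: "w \<in> V" unfolding w_def using V(1) inv x by (intro subspace_diff subspace_scale) auto
  have xx: "x \<bullet> x = 1" using x(2) by (simp add: norm_eq_1)
  have sym: "w \<bullet> (S *v x) = x \<bullet> (S *v w)"
    using dot_matrix_vector_transpose[of x S w] S by (simp add: inner_commute)
  have ww: "w \<bullet> w = l * (x \<bullet> w) - x \<bullet> (S *v w)"
    using sym by (subst (2) w_def) (simp add: inner_diff_right inner_commute)
  have quad: "0 \<le> 2 * t * (w \<bullet> w) + t\<^sup>2 * q w" for t
  proof -
    have "x + t *\<^sub>R w \<in> V" using x wV V(1) by (simp add: subspace_add subspace_scale)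
    from q_nonneg[OF this] have "0 \<le> q (x + t *\<^sub>R w)" .
    also have "q (x + t *\<^sub>R w) = q x + 2 * t * (w \<bullet> w) + t\<^sup>2 * q w"
      using sym unfolding ww
      by (simp add: q_def matrix_vector_right_distrib matrix_vector_mult_scaleR inner_add_left
        inner_add_right inner_commute algebra_simps power2_eq_square)
    also have "q x = 0" by (simp add: q_def l_def xx)
    finally show ?thesis by simp
  qed
  have "w \<bullet> w = 0"
  proof (rule ccontr)
    assume "w \<bullet> w \<noteq> 0"
    then have pos: "w \<bullet> w > 0" using inner_ge_zero[of w] by linarith
    have qw: "q w \<ge> 0" using q_nonneg wV by blast
    define t where "t = - (w \<bullet> w) / (q w + 1)"
    have "t < 0" using pos qw by (simp add: t_def divide_neg_pos)
    have tq: "t * q w \<ge> - (w \<bullet> w)"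
      using pos qw by (simp add: t_def field_simps)
    have "2 * t * (w \<bullet> w) + t\<^sup>2 * q w = t * (2 * (w \<bullet> w) + t * q w)"
      by (simp add: algebra_simps power2_eq_square)
    moreover have "\<dots> < 0" using \<open>t < 0\<close> tq pos inner_ge_zero[of w]
      by (intro mult_neg_pos) linarith+
    ultimately show False using quad[of t] by linarith
  qed
  then have "S *v x = l *\<^sub>R x" by (simp add: w_def)
  with that x show ?thesis by blast
qed

lemma orthonormal_set_card:
  fixes B :: "(real^'n) set"
  assumes "pairwise orthogonal B" "\<And>b. b \<in> B \<Longrightarrow> norm b = 1"
  shows "independent B" "finite B" "card B \<le> CARD('n)"
proof -
  have "0 \<notin> B" using assms(2) by force
  then show "independent B" using assms(1) pairwise_orthogonal_independent by blast
  then show "finite B" "card B \<le> CARD('n)" using independent_bound[of B] by auto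
qed

text \<open>A maximal orthonormal set of eigenvectors spans, because its orthogonal complement is invariant
  and would otherwise contain another eigenvector.\<close>

theorem symmetric_matrix_diagonalization:
  fixes S :: "real^'n^'n"
  assumes S: "transpose S = S"
  obtains Q :: "real^'n^'n" and d where "orthogonal_matrix Q" "S = transpose Q ** diagm d ** Q"
proof -
  define ok where "ok = (\<lambda>B. pairwise orthogonal B \<and> (\<forall>b\<in>B. norm b = 1 \<and> (\<exists>l. S *v b = l *\<^sub>R b)))"
  have ok0: "ok {}" by (simp add: ok_def)
  have bound: "card B \<le> CARD('n)" if "ok B" for B
    using that orthonormal_set_card(3)[of B] by (auto simp: ok_def)
  obtain B where B: "ok B" and Bmax: "\<And>C. ok C \<Longrightarrow> card C \<le> card B"
  proof -
    have "\<exists>B. ok B \<and> (\<forall>C. ok C \<longrightarrow> card C \<le> card B)"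
      using ok0 bound
      by (intro ex_has_greatest_nat[of ok "{}" card "Suc CARD('n)"]) (auto simp: less_Suc_eq_le)
    then show ?thesis using that by blast
  qed
  have finB: "finite B" and indB: "independent B"
    using orthonormal_set_card[of B] B by (auto simp: ok_def)
  define V where "V = {x. \<forall>b\<in>B. b \<bullet> x = 0}"
  have subV: "subspace V" unfolding V_def subspace_def by (auto simp: inner_add_right)
  have "V = {0}"
  proof (rule ccontr)
    assume ne: "V \<noteq> {0}"
    have "S *v x \<in> V" if x: "x \<in> V" for x
    proof -
      have "b \<bullet> (S *v x) = 0" if b: "b \<in> B" for b
      proof -
        obtain l where "S *v b = l *\<^sub>R b" using B b by (auto simp: ok_def)
        then show ?thesis using dot_matrix_vector_transpose[of b S x] S x b by (simp add: V_def)
      qed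
      then show ?thesis by (simp add: V_def)
    qed
    then obtain x l where x: "x \<in> V" "norm x = 1" "S *v x = l *\<^sub>R x"
      using symmetric_eigenvector_in_subspace[OF S subV ne] by blast
    have "x \<notin> B" using x by (force simp: V_def)
    moreover have "ok (insert x B)" using B x
      by (auto simp: ok_def pairwise_insert V_def orthogonal_def inner_commute)
    ultimately show False using Bmax[of "insert x B"] finB by simp
  qed
  have "span B = UNIV"
  proof (rule ccontr)
    assume "span B \<noteq> UNIV"
    then obtain x where "x \<noteq> 0" "\<And>y. y \<in> span B \<Longrightarrow> orthogonal x y"
      using span_not_UNIV_orthogonal[of B] by (auto simp: orthogonal_def)
    then have "x \<in> V" by (auto simp: V_def orthogonal_def inner_commute span_base)
    with \<open>V = {0}\<close> \<open>x \<noteq> 0\<close> show False by blast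
  qed
  then have "card B = CARD('n)"
    using indB dim_eq_card_independent[of B] dim_span[of B] by (simp add: )
  then obtain f where f: "bij_betw f (UNIV::'n set) B"
    using finB finite_same_card_bij[of "UNIV::'n set" B] by auto
  have fB: "f i \<in> B" for i using f by (auto simp: bij_betw_def)
  have f_inj: "i \<noteq> j \<Longrightarrow> f i \<noteq> f j" for i j using f by (auto simp: bij_betw_def inj_on_def)
  have "\<forall>i. \<exists>l. S *v f i = l *\<^sub>R f i" using B fB by (auto simp: ok_def)
  then obtain d where d: "\<And>i. S *v f i = d i *\<^sub>R f i" by metis
  define Q :: "real^'n^'n" where "Q = (\<chi> i. f i)"
  have row: "row i Q = f i" for i by (simp add: row_def Q_def vec_eq_iff)
  have Q: "orthogonal_matrix Q"
    using B fB f_inj by (simp add: orthogonal_matrix_orthonormal_rows row ok_def pairwise_def)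
  have "S ** transpose Q = transpose Q ** diagm d"
  proof -
    have "(S ** transpose Q) $ i $ j = (S *v f j) $ i" for i j
      by (simp add: matrix_matrix_mult_def matrix_vector_mult_def transpose_def Q_def)
    then show ?thesis by (simp add: vec_eq_iff d Q_def transpose_def)
  qed
  then have "S ** (transpose Q ** Q) = transpose Q ** diagm d ** Q"
    by (metis matrix_mul_assoc)
  then have "S = transpose Q ** diagm d ** Q"
    using Q by (simp add: orthogonal_matrix)
  with Q show ?thesis by (rule that)
qed

lemma PD_symmetric: "P \<in> PD \<Longrightarrow> transpose P = P" and PD_positive: "P \<in> PD \<Longrightarrow> x \<noteq> 0 \<Longrightarrow> 0 < x \<bullet> (P *v x)"
  by (auto simp: PD_def)

lemma congruence_in_PD:
  fixes A P :: "real^'n^'n"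
  assumes "invertible A" "P \<in> PD"
  shows "transpose A ** P ** A \<in> PD"
  unfolding PD_def
proof (intro CollectI conjI allI impI)
  show "transpose (transpose A ** P ** A) = transpose A ** P ** A"
    using PD_symmetric[OF assms(2)] by (simp add: matrix_transpose_mul matrix_mul_assoc)
  fix x :: "real^'n" assume "x \<noteq> 0"
  then have "A *v x \<noteq> 0" using assms(1) invertible_mult_cancel by blast
  then have "0 < (A *v x) \<bullet> (P *v (A *v x))" using assms(2) PD_positive by blast
  also have "\<dots> = x \<bullet> ((transpose A ** P ** A) *v x)"
    using dot_matrix_vector_transpose[of x "transpose A" "P *v (A *v x)"]
    by (simp add: matrix_vector_mul_assoc matrix_mul_assoc)
  finally show "0 < x \<bullet> ((transpose A ** P ** A) *v x)" .
qed

lemma diagm_in_PD: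
  assumes "\<And>i. d i > 0"
  shows "(diagm d :: real^'n^'n) \<in> PD"
  unfolding PD_def
proof (intro CollectI conjI allI impI)
  fix x :: "real^'n" assume "x \<noteq> 0"
  then obtain i where "x $ i \<noteq> 0" by (auto simp: vec_eq_iff)
  then have "0 < d i * (x $ i)\<^sup>2" using assms by simp
  also have "\<dots> \<le> (\<Sum>i\<in>UNIV. d i * (x $ i)\<^sup>2)"
    using assms by (intro member_le_sum) (auto simp: less_imp_le)
  finally show "0 < x \<bullet> (diagm d *v x)"
    by (simp add: inner_vec_def power2_eq_square mult.left_commute)
qed simp

lemma exp_congruence_in_PD:
  "invertible (A::real^'n^'n) \<Longrightarrow> transpose A ** diagm (\<lambda>i. exp (m i)) ** A \<in> PD"
  by (intro congruence_in_PD diagm_in_PD) auto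

lemma PD_spectral:
  fixes P :: "real^'n^'n"
  assumes "P \<in> PD"
  obtains Q :: "real^'n^'n" and m where "orthogonal_matrix Q" "P = transpose Q ** diagm (\<lambda>i. exp (m i)) ** Q"
proof -
  obtain Q d where Q: "orthogonal_matrix Q" and P: "P = transpose Q ** diagm d ** Q"
    using symmetric_matrix_diagonalization PD_symmetric[OF assms] by blast
  have QQ: "Q ** transpose Q = mat 1" "transpose Q ** Q = mat 1"
    using Q by (auto simp: orthogonal_matrix_def)
  have "d i > 0" for i
  proof -
    define x where "x = transpose Q *v axis i 1"
    have "Q *v x = (Q ** transpose Q) *v axis i 1"
      unfolding x_def by (rule matrix_vector_mul_assoc)
    then have Qx: "Q *v x = axis i 1" by (simp add: QQ)
    then have "x \<noteq> 0" by (metis axis_eq_0_iff matrix_vector_mult_0_right zero_neq_one)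
    then have "0 < x \<bullet> (P *v x)" using assms PD_positive by blast
    also have "x \<bullet> (P *v x) = (Q *v x) \<bullet> (diagm d *v (Q *v x))"
      unfolding P
      using dot_matrix_vector_transpose[of x "transpose Q" "diagm d *v (Q *v x)"]
      by (simp add: matrix_vector_mul_assoc matrix_mul_assoc)
    also have "\<dots> = d i" unfolding Qx by (simp add: inner_axis')
    finally show ?thesis .
  qed
  then have "diagm d = (diagm (\<lambda>i. exp (ln (d i))) :: real^'n^'n)" by (simp add: vec_eq_iff)
  with P have "P = transpose Q ** diagm (\<lambda>i. exp (ln (d i))) ** Q" by simp
  with Q show ?thesis by (rule that)
qed

lemma orthogonal_matrix_invertible: "orthogonal_matrix (Q::real^'n^'n) \<Longrightarrow> invertible Q"
  unfolding orthogonal_matrix_def invertible_def by blast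

lemma PD_factorization:
  fixes P :: "real^'n^'n"
  assumes "P \<in> PD"
  obtains A :: "real^'n^'n" where "invertible A" "P = transpose A ** A"
proof -
  obtain Q m where Q: "orthogonal_matrix Q" and P: "P = transpose Q ** diagm (\<lambda>i. exp (m i)) ** Q"
    using PD_spectral[OF assms] by blast
  define A where "A = diagm (\<lambda>i. exp (m i / 2)) ** Q"
  have "invertible (diagm (\<lambda>i. exp (m i / 2)) :: real^'n^'n)" by (simp add: invertible_det_nz)
  then have "invertible A" unfolding A_def using Q orthogonal_matrix_invertible invertible_mult by blast
  have "transpose A ** A
      = transpose Q ** (diagm (\<lambda>i. exp (m i / 2)) ** diagm (\<lambda>i. exp (m i / 2))) ** Q"
    by (simp add: A_def matrix_transpose_mul matrix_mul_assoc)
  moreover have "(\<lambda>i. exp (m i / 2) * exp (m i / 2)) = (\<lambda>i. exp (m i))"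
    by (simp flip: exp_add)
  ultimately have "P = transpose A ** A" by (simp only: P diagm_mult_diagm)
  with \<open>invertible A\<close> show ?thesis using that by blast
qed

text \<open>After the congruence that takes \<open>P\<close> to the identity, an orthogonal matrix diagonalises \<open>Q\<close>. The curve
  \<open>A\<^sup>T exp (t m) A\<close> then joins \<open>P\<close> to \<open>Q\<close>.\<close>

lemma PD_simultaneous_diagonalization:
  fixes P Q :: "real^'n^'n"
  assumes "P \<in> PD" "Q \<in> PD"
  obtains A :: "real^'n^'n" and m where "invertible A" "P = transpose A ** A"
    "Q = transpose A ** diagm (\<lambda>i. exp (m i)) ** A"
proof -
  obtain C :: "real^'n^'n" where C: "invertible C" "P = transpose C ** C"
    using PD_factorization assms(1) by metis
  obtain D where D: "C ** D = mat 1" "D ** C = mat 1" using C(1) invertible_def by blast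
  have Di: "invertible D" using D invertible_def by blast
  obtain O' :: "real^'n^'n" and m where O: "orthogonal_matrix O'"
    and eq: "transpose D ** Q ** D = transpose O' ** diagm (\<lambda>i. exp (m i)) ** O'"
    using PD_spectral[OF congruence_in_PD[OF Di assms(2)]] by metis
  have TD: "transpose C ** transpose D = mat 1" by (rule transpose_inverse[OF D(2)])
  have "Q = (transpose C ** transpose D) ** Q ** (D ** C)"
    by (simp only: TD D matrix_mul_lid matrix_mul_rid)
  also have "\<dots> = transpose C ** (transpose D ** Q ** D) ** C" by (simp only: matrix_mul_assoc)
  also have "\<dots> = transpose (O' ** C) ** diagm (\<lambda>i. exp (m i)) ** (O' ** C)"
    unfolding eq by (simp only: matrix_transpose_mul matrix_mul_assoc)
  finally have 1: "Q = transpose (O' ** C) ** diagm (\<lambda>i. exp (m i)) ** (O' ** C)" .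
  have "transpose (O' ** C) ** (O' ** C) = transpose C ** (transpose O' ** O') ** C"
    by (simp only: matrix_transpose_mul matrix_mul_assoc)
  also have "\<dots> = transpose C ** C"
    using O by (simp only: orthogonal_matrix matrix_mul_rid)
  finally have 2: "P = transpose (O' ** C) ** (O' ** C)" using C by simp
  have "invertible (O' ** C)" using O C orthogonal_matrix_invertible invertible_mult by blast
  from this 2 1 show ?thesis by (rule that)
qed

section \<open>The log-likelihood in diagonalising frames\<close>

text \<open>These are the coefficients of the exponentials in the fit term when both precision matrices are
  diagonalised by congruence.\<close>

definition frame_mass ::
  "nat \<Rightarrow> (nat \<Rightarrow> real^'m2^'m1) \<Rightarrow> real^'m1^'m1 \<Rightarrow> real^'m2^'m2 \<Rightarrow> 'm1 \<Rightarrow> 'm2 \<Rightarrow> real" where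
  "frame_mass n Y A B a b = (\<Sum>i<n. ((A ** Y i ** transpose B) $ a $ b)\<^sup>2)"

lemma frame_mass_nonneg [simp]: "frame_mass n Y A B a b \<ge> 0"
  by (simp add: frame_mass_def sum_nonneg)

lemma frame_mass_eq_0_iff: "frame_mass n Y A B a b = 0 \<longleftrightarrow> (\<forall>i<n. (A ** Y i ** transpose B) $ a $ b = 0)"
  by (auto simp: frame_mass_def sum_nonneg_eq_0_iff)

lemma trace_diagm_congruence:
  fixes G :: "real^'m2^'m1"
  shows "trace (diagm d ** G ** diagm e ** transpose G) = (\<Sum>a\<in>UNIV. \<Sum>b\<in>UNIV. d a * e b * (G $ a $ b)\<^sup>2)"
proof -
  have "(diagm d ** G ** diagm e ** transpose G) $ a $ a = (\<Sum>b\<in>UNIV. d a * e b * (G $ a $ b)\<^sup>2)" for a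
    by (subst matrix_matrix_mult_def) (simp add: transpose_def power2_eq_square mult_ac)
  then show ?thesis by (simp add: trace_def)
qed

definition fit_term ::
  "nat \<Rightarrow> (nat \<Rightarrow> real^'m2^'m1) \<Rightarrow> real^'m1^'m1 \<Rightarrow> real^'m2^'m2 \<Rightarrow> real" where
  "fit_term n Y P1 P2 = trace (P1 ** (\<Sum>i<n. Y i ** P2 ** transpose (Y i)))"

lemma loglik_eq:
  fixes Y :: "nat \<Rightarrow> real^'m2^'m1"
  shows "loglik n Y (P1, P2) = real n * real CARD('m2) * ln (det P1) + real n * real CARD('m1) * ln (det P2)
    - fit_term n Y P1 P2"
  by (simp add: loglik_def fit_term_def)

lemma det_exp_congruence:
  fixes C :: "real^'k^'k"
  shows "det (transpose C ** diagm (\<lambda>a. exp (u a)) ** C) = exp (\<Sum>a\<in>UNIV. u a) * (det C)\<^sup>2"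
  by (simp add: det_mul exp_sum power2_eq_square)

lemma fit_term_frame:
  fixes A :: "real^'m1^'m1" and B :: "real^'m2^'m2" and Y :: "nat \<Rightarrow> real^'m2^'m1"
  shows "fit_term n Y (transpose A ** diagm (\<lambda>a. exp (m a)) ** A) (transpose B ** diagm (\<lambda>b. exp (v b)) ** B)
    = (\<Sum>a\<in>UNIV. \<Sum>b\<in>UNIV. exp (m a + v b) * frame_mass n Y A B a b)"
proof -
  define P1 where "P1 = transpose A ** diagm (\<lambda>a. exp (m a)) ** A"
  define P2 where "P2 = transpose B ** diagm (\<lambda>b. exp (v b)) ** B"
  have "trace (P1 ** (\<Sum>i<n. Y i ** P2 ** transpose (Y i))) = (\<Sum>i<n. trace (P1 ** (Y i ** P2 ** transpose (Y i))))"
    by (simp add: matrix_mult_sum_right trace_sum)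
  also have "\<dots> = (\<Sum>i<n. \<Sum>a\<in>UNIV. \<Sum>b\<in>UNIV. exp (m a) * exp (v b) * ((A ** Y i ** transpose B) $ a $ b)\<^sup>2)"
  proof (rule sum.cong[OF refl])
    fix i
    define G where "G = A ** Y i ** transpose B"
    have "trace (P1 ** (Y i ** P2 ** transpose (Y i)))
        = trace (transpose A ** (diagm (\<lambda>a. exp (m a)) ** A ** Y i ** P2 ** transpose (Y i)))"
      by (simp add: P1_def matrix_mul_assoc)
    also have "\<dots> = trace (diagm (\<lambda>a. exp (m a)) ** A ** Y i ** P2 ** transpose (Y i) ** transpose A)"
      by (rule trace_mul_sym)
    also have "diagm (\<lambda>a. exp (m a)) ** A ** Y i ** P2 ** transpose (Y i) ** transpose A
        = diagm (\<lambda>a. exp (m a)) ** G ** diagm (\<lambda>b. exp (v b)) ** transpose G"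
      by (simp add: P2_def G_def matrix_mul_assoc matrix_transpose_mul)
    finally show "trace (P1 ** (Y i ** P2 ** transpose (Y i)))
        = (\<Sum>a\<in>UNIV. \<Sum>b\<in>UNIV. exp (m a) * exp (v b) * ((A ** Y i ** transpose B) $ a $ b)\<^sup>2)"
      unfolding trace_diagm_congruence G_def by simp
  qed
  also have "\<dots> = (\<Sum>a\<in>UNIV. \<Sum>b\<in>UNIV. exp (m a + v b) * frame_mass n Y A B a b)"
  proof -
    have "(\<Sum>i<n. \<Sum>a\<in>UNIV. \<Sum>b\<in>UNIV. exp (m a) * exp (v b) * ((A ** Y i ** transpose B) $ a $ b)\<^sup>2)
        = (\<Sum>a\<in>UNIV. \<Sum>i<n. \<Sum>b\<in>UNIV. exp (m a) * exp (v b) * ((A ** Y i ** transpose B) $ a $ b)\<^sup>2)"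
      by (rule sum.swap)
    also have "\<dots> = (\<Sum>a\<in>UNIV. \<Sum>b\<in>UNIV. \<Sum>i<n. exp (m a) * exp (v b) * ((A ** Y i ** transpose B) $ a $ b)\<^sup>2)"
      by (intro sum.cong refl sum.swap)
    also have "\<dots> = (\<Sum>a\<in>UNIV. \<Sum>b\<in>UNIV. exp (m a + v b) * frame_mass n Y A B a b)"
      by (simp add: frame_mass_def exp_add sum_distrib_left)
    finally show ?thesis .
  qed
  finally show ?thesis by (simp add: fit_term_def P1_def P2_def)
qed

text \<open>In a fixed pair of frames the log-determinants are linear in the logarithms \<open>m\<close>, \<open>v\<close> of the diagonal
  entries, and the fit term is a nonnegative combination of exponentials of linear functions.\<close>

lemma loglik_frame:
  fixes A :: "real^'m1^'m1" and B :: "real^'m2^'m2" and Y :: "nat \<Rightarrow> real^'m2^'m1"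
  assumes "invertible A" "invertible B"
  shows "loglik n Y (transpose A ** diagm (\<lambda>a. exp (m a)) ** A, transpose B ** diagm (\<lambda>b. exp (v b)) ** B)
    = real n * real CARD('m2) * ((\<Sum>a\<in>UNIV. m a) + ln ((det A)\<^sup>2))
    + real n * real CARD('m1) * ((\<Sum>b\<in>UNIV. v b) + ln ((det B)\<^sup>2))
    - (\<Sum>a\<in>UNIV. \<Sum>b\<in>UNIV. exp (m a + v b) * frame_mass n Y A B a b)"
  using assms by (simp add: loglik_eq fit_term_frame det_exp_congruence ln_mult invertible_det_nz)

section \<open>Continuity of matrix operations\<close>

lemma continuous_on_matrix_mult [continuous_intros]:
  fixes f :: "'t::topological_space \<Rightarrow> real^'n^'m" and g :: "'t \<Rightarrow> real^'k^'n"
  assumes "continuous_on S f" "continuous_on S g"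
  shows "continuous_on S (\<lambda>x. f x ** g x)"
  unfolding matrix_matrix_mult_def using assms by (intro continuous_intros)

lemma continuous_on_transpose [continuous_intros]:
  fixes f :: "'t::topological_space \<Rightarrow> real^'n^'m"
  assumes "continuous_on S f"
  shows "continuous_on S (\<lambda>x. transpose (f x))"
  unfolding transpose_def using assms by (intro continuous_intros)

lemma continuous_on_det [continuous_intros]:
  fixes f :: "'t::topological_space \<Rightarrow> real^'n^'n"
  assumes "continuous_on S f"
  shows "continuous_on S (\<lambda>x. det (f x))"
  unfolding det_def using assms by (intro continuous_intros)

lemma continuous_on_trace [continuous_intros]:
  fixes f :: "'t::topological_space \<Rightarrow> real^'n^'n"
  assumes "continuous_on S f"
  shows "continuous_on S (\<lambda>x. trace (f x))"
  unfolding trace_def using assms by (intro continuous_intros)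

lemma continuous_on_diagm [continuous_intros]:
  fixes f :: "'t::topological_space \<Rightarrow> 'n::finite \<Rightarrow> real"
  assumes "\<And>i. continuous_on S (\<lambda>x. f x i)"
  shows "continuous_on S (\<lambda>x. diagm (f x))"
  unfolding diagm_def
proof (intro continuous_intros)
  fix i j show "continuous_on S (\<lambda>x. if i = j then f x i else 0)"
    using assms by (cases "i = j") auto
qed

section \<open>Comparison of local maxima\<close>

lemma exp_gt_add_one:
  fixes x :: real assumes "x \<noteq> 0" shows "1 + x < exp x"
proof (cases "1 + x / 2 \<ge> 0")
  case True
  have "1 + x < (1 + x / 2)\<^sup>2" using assms
    by (simp add: power2_sum power_divide)
  also have "\<dots> \<le> (exp (x / 2))\<^sup>2" using True exp_ge_add_one_self by (intro power_mono) auto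
  also have "\<dots> = exp x" by (simp add: power2_eq_square flip: exp_add)
  finally show ?thesis .
next
  case False
  then show ?thesis using exp_gt_zero[of x] by linarith
qed

text \<open>The hypothesis says that the derivative in the direction \<open>(m, v)\<close> vanishes at the identity of the two
  frames. It cancels the linear terms and leaves the remainders \<open>exp x - 1 - x\<close>.\<close>

lemma loglik_gap:
  fixes A :: "real^'m1^'m1" and B :: "real^'m2^'m2" and Y :: "nat \<Rightarrow> real^'m2^'m1"
  assumes "invertible A" "invertible B"
    and crit: "real n * real CARD('m2) * (\<Sum>a\<in>UNIV. m a) + real n * real CARD('m1) * (\<Sum>b\<in>UNIV. v b)
      = (\<Sum>a\<in>UNIV. \<Sum>b\<in>UNIV. (m a + v b) * frame_mass n Y A B a b)"
  shows "loglik n Y (transpose A ** A, transpose B ** B)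
      - loglik n Y (transpose A ** diagm (\<lambda>a. exp (m a)) ** A, transpose B ** diagm (\<lambda>b. exp (v b)) ** B)
    = (\<Sum>a\<in>UNIV. \<Sum>b\<in>UNIV. (exp (m a + v b) - 1 - (m a + v b)) * frame_mass n Y A B a b)"
proof -
  have "(\<Sum>a\<in>UNIV. \<Sum>b\<in>UNIV. (exp (m a + v b) - 1 - (m a + v b)) * frame_mass n Y A B a b)
    = (\<Sum>a\<in>UNIV. \<Sum>b\<in>UNIV. exp (m a + v b) * frame_mass n Y A B a b)
    - (\<Sum>a\<in>UNIV. \<Sum>b\<in>UNIV. frame_mass n Y A B a b)
    - (\<Sum>a\<in>UNIV. \<Sum>b\<in>UNIV. (m a + v b) * frame_mass n Y A B a b)"
    by (simp only: left_diff_distrib sum_subtractf mult_1_left)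
  then show ?thesis
    using loglik_frame[OF assms(1,2), of n Y "\<lambda>_. 0" "\<lambda>_. 0"] loglik_frame[OF assms(1,2), of n Y m v] crit
    by (simp add: ring_distribs)
qed

lemma loglik_gap_nonneg:
  fixes A :: "real^'m1^'m1" and B :: "real^'m2^'m2" and Y :: "nat \<Rightarrow> real^'m2^'m1"
  assumes "invertible A" "invertible B"
    and crit: "real n * real CARD('m2) * (\<Sum>a\<in>UNIV. m a) + real n * real CARD('m1) * (\<Sum>b\<in>UNIV. v b)
      = (\<Sum>a\<in>UNIV. \<Sum>b\<in>UNIV. (m a + v b) * frame_mass n Y A B a b)"
  shows "loglik n Y (transpose A ** diagm (\<lambda>a. exp (m a)) ** A, transpose B ** diagm (\<lambda>b. exp (v b)) ** B)
      \<le> loglik n Y (transpose A ** A, transpose B ** B)" (is "?Q \<le> ?P")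
    and "loglik n Y (transpose A ** diagm (\<lambda>a. exp (m a)) ** A, transpose B ** diagm (\<lambda>b. exp (v b)) ** B)
      = loglik n Y (transpose A ** A, transpose B ** B) \<Longrightarrow> frame_mass n Y A B a b \<noteq> 0 \<Longrightarrow> m a + v b = 0"
proof -
  have nn: "0 \<le> (exp (m a + v b) - 1 - (m a + v b)) * frame_mass n Y A B a b" for a b
    using exp_ge_add_one_self[of "m a + v b"]
    by (intro mult_nonneg_nonneg) (simp_all add: algebra_simps del: exp_ge_add_one_self)
  show "?Q \<le> ?P" using loglik_gap[OF assms] nn by (smt (verit) sum_nonneg)
  assume eq: "?Q = ?P" and nz: "frame_mass n Y A B a b \<noteq> 0"
  have "(\<Sum>a\<in>UNIV. \<Sum>b\<in>UNIV. (exp (m a + v b) - 1 - (m a + v b)) * frame_mass n Y A B a b) = 0"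
    using loglik_gap[OF assms] eq by simp
  then have "(exp (m a + v b) - 1 - (m a + v b)) * frame_mass n Y A B a b = 0"
    using nn by (simp add: sum_nonneg_eq_0_iff sum_nonneg)
  with nz have "exp (m a + v b) = 1 + (m a + v b)" by simp
  then show "m a + v b = 0" using exp_gt_add_one[of "m a + v b"] by fastforce
qed

text \<open>Along the curve \<open>(A\<^sup>T exp (t m) A, B\<^sup>T exp (t v) B)\<close> the log-likelihood is a linear function of \<open>t\<close>
  minus a nonnegative combination of exponentials. A local maximum at \<open>t = 0\<close> fixes the linear part.\<close>

lemma local_max_critical:
  fixes A :: "real^'m1^'m1" and B :: "real^'m2^'m2" and Y :: "nat \<Rightarrow> real^'m2^'m1"
  assumes A: "invertible A" and B: "invertible B"
    and max: "is_local_max n Y (transpose A ** A, transpose B ** B)"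
  shows "real n * real CARD('m2) * (\<Sum>a\<in>UNIV. m a) + real n * real CARD('m1) * (\<Sum>b\<in>UNIV. v b)
      = (\<Sum>a\<in>UNIV. \<Sum>b\<in>UNIV. (m a + v b) * frame_mass n Y A B a b)"
proof -
  define p where "p = (\<lambda>t. (transpose A ** diagm (\<lambda>a. exp (t * m a)) ** A,
                            transpose B ** diagm (\<lambda>b. exp (t * v b)) ** B))"
  define f where "f = (\<lambda>t. loglik n Y (p t))"
  have p0: "p 0 = (transpose A ** A, transpose B ** B)" by (simp add: p_def)
  have pPD: "p t \<in> PD \<times> PD" for t
    unfolding p_def by (intro SigmaI exp_congruence_in_PD A B)
  have "continuous_on UNIV p" unfolding p_def by (intro continuous_intros)
  then have cont: "isCont p 0" by (simp add: continuous_on_eq_continuous_at)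
  obtain d where d: "d > 0" "\<And>Q. Q \<in> PD \<times> PD \<Longrightarrow> dist Q (p 0) < d \<Longrightarrow> loglik n Y Q \<le> loglik n Y (p 0)"
    using max unfolding is_local_max_def p0 eventually_at by (metis order_refl)
  obtain e where e: "e > 0" "\<And>t. \<bar>t\<bar> < e \<Longrightarrow> dist (p t) (p 0) < d"
    using cont d(1) unfolding continuous_at_eps_delta dist_real_def by (metis diff_zero)
  have fmax: "\<forall>t. \<bar>0 - t\<bar> < e \<longrightarrow> f t \<le> f 0" using d(2) e(2) pPD by (auto simp: f_def)
  have f_eq: "f = (\<lambda>t. real n * real CARD('m2) * ((\<Sum>a\<in>UNIV. t * m a) + ln ((det A)\<^sup>2))
    + real n * real CARD('m1) * ((\<Sum>b\<in>UNIV. t * v b) + ln ((det B)\<^sup>2))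
    - (\<Sum>a\<in>UNIV. \<Sum>b\<in>UNIV. exp (t * m a + t * v b) * frame_mass n Y A B a b))"
    unfolding f_def p_def by (rule ext, rule loglik_frame[OF A B])
  have "(f has_real_derivative real n * real CARD('m2) * (\<Sum>a\<in>UNIV. m a)
      + real n * real CARD('m1) * (\<Sum>b\<in>UNIV. v b)
      - (\<Sum>a\<in>UNIV. \<Sum>b\<in>UNIV. (m a + v b) * frame_mass n Y A B a b)) (at 0)"
    unfolding f_eq by (auto intro!: derivative_eq_intros)
  from DERIV_local_max[OF this e(1) fmax] show ?thesis by simp
qed

lemma mle_is_local_max:
  assumes "P \<in> PD \<times> PD" "\<forall>Q \<in> PD \<times> PD. loglik n Y Q \<le> loglik n Y P"
  shows "is_local_max n Y P"
  using assms by (auto simp: is_local_max_def eventually_at intro: exI[of _ 1])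

text \<open>Any two local maxima are joined by such a curve, so each dominates the other. Hence the gap
  between them is zero, and \<open>exp x = 1 + x\<close> wherever the mass is positive.\<close>

lemma two_local_maxima:
  fixes Y :: "nat \<Rightarrow> real^'m2^'m1"
  assumes P: "is_local_max n Y (P1, P2)" and Q: "is_local_max n Y (Q1, Q2)"
  obtains A :: "real^'m1^'m1" and B :: "real^'m2^'m2" and m v where
    "invertible A" "invertible B" "P1 = transpose A ** A" "P2 = transpose B ** B"
    "Q1 = transpose A ** diagm (\<lambda>a. exp (m a)) ** A" "Q2 = transpose B ** diagm (\<lambda>b. exp (v b)) ** B"
    "\<And>a b. frame_mass n Y A B a b \<noteq> 0 \<Longrightarrow> m a + v b = 0"
proof -
  have dom: "loglik n Y (S1, S2) \<le> loglik n Y (R1, R2)"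
    if R: "is_local_max n Y (R1, R2)" and S: "S1 \<in> PD" "S2 \<in> PD" for R1 R2 S1 S2
  proof -
    have RPD: "R1 \<in> PD" "R2 \<in> PD" using R by (auto simp: is_local_max_def)
    obtain A :: "real^'m1^'m1" and m where A: "invertible A" "R1 = transpose A ** A"
      "S1 = transpose A ** diagm (\<lambda>a. exp (m a)) ** A"
      using PD_simultaneous_diagonalization[OF RPD(1) S(1)] by metis
    obtain B :: "real^'m2^'m2" and v where B: "invertible B" "R2 = transpose B ** B"
      "S2 = transpose B ** diagm (\<lambda>b. exp (v b)) ** B"
      using PD_simultaneous_diagonalization[OF RPD(2) S(2)] by metis
    show ?thesis
      using loglik_gap_nonneg(1)[OF A(1) B(1) local_max_critical[OF A(1) B(1)]] R
      unfolding A(2,3) B(2,3) by blast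
  qed
  have PD: "P1 \<in> PD" "P2 \<in> PD" "Q1 \<in> PD" "Q2 \<in> PD" using P Q by (auto simp: is_local_max_def)
  have eq: "loglik n Y (Q1, Q2) = loglik n Y (P1, P2)"
    using dom[OF P PD(3,4)] dom[OF Q PD(1,2)] by simp
  obtain A :: "real^'m1^'m1" and m where A: "invertible A" "P1 = transpose A ** A"
    "Q1 = transpose A ** diagm (\<lambda>a. exp (m a)) ** A"
    using PD_simultaneous_diagonalization[OF PD(1,3)] by metis
  obtain B :: "real^'m2^'m2" and v where B: "invertible B" "P2 = transpose B ** B"
    "Q2 = transpose B ** diagm (\<lambda>b. exp (v b)) ** B"
    using PD_simultaneous_diagonalization[OF PD(2,4)] by metis
  have "frame_mass n Y A B a b \<noteq> 0 \<Longrightarrow> m a + v b = 0" for a b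
    using loglik_gap_nonneg(2)[OF A(1) B(1) local_max_critical[OF A(1) B(1)]] P eq
    unfolding A(2,3) B(2,3) by blast
  with A B show ?thesis by (intro that[of A B m v]) auto
qed

text \<open>Being balanced is preserved by orthogonal changes of frame. So in frames that diagonalise \<open>Q\<^sub>1\<close> and \<open>Q\<^sub>2\<close>
  the masses have constant row sums and constant column sums, and the derivative of the log-likelihood vanishes at
  the identity in the direction of \<open>(Q\<^sub>1, Q\<^sub>2)\<close>.\<close>

lemma balanced_mle:
  fixes Y :: "nat \<Rightarrow> real^'m2^'m1"
  assumes row: "(\<Sum>i<n. Y i ** transpose (Y i)) = mat (real n * real CARD('m2))"
    and col: "(\<Sum>i<n. transpose (Y i) ** Y i) = mat (real n * real CARD('m1))"
    and Q: "Q1 \<in> PD" "Q2 \<in> PD"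
  shows "loglik n Y (Q1, Q2) \<le> loglik n Y (mat 1, mat 1)"
proof -
  obtain A :: "real^'m1^'m1" and m where A: "orthogonal_matrix A"
    "Q1 = transpose A ** diagm (\<lambda>a. exp (m a)) ** A" using PD_spectral[OF Q(1)] by metis
  obtain B :: "real^'m2^'m2" and v where B: "orthogonal_matrix B"
    "Q2 = transpose B ** diagm (\<lambda>b. exp (v b)) ** B" using PD_spectral[OF Q(2)] by metis
  have AA: "transpose A ** A = mat 1" "A ** transpose A = mat 1"
    and BB: "transpose B ** B = mat 1" "B ** transpose B = mat 1"
    using A B by (auto simp: orthogonal_matrix_def)
  have inv: "invertible A" "invertible B" using A B orthogonal_matrix_invertible by auto
  define G where "G = (\<lambda>i. A ** Y i ** transpose B)"
  have GGT: "G i ** transpose (G i) = A ** (Y i ** transpose (Y i)) ** transpose A" for i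
  proof -
    have "G i ** transpose (G i) = A ** Y i ** (transpose B ** B) ** transpose (Y i) ** transpose A"
      by (simp add: G_def matrix_transpose_mul matrix_mul_assoc)
    then show ?thesis by (simp add: BB matrix_mul_assoc)
  qed
  have GTG: "transpose (G i) ** G i = B ** (transpose (Y i) ** Y i) ** transpose B" for i
  proof -
    have "transpose (G i) ** G i = B ** transpose (Y i) ** (transpose A ** A) ** Y i ** transpose B"
      by (simp add: G_def matrix_transpose_mul matrix_mul_assoc)
    then show ?thesis by (simp add: AA matrix_mul_assoc)
  qed
  have rows: "(\<Sum>b\<in>UNIV. frame_mass n Y A B a b) = real n * real CARD('m2)" for a
  proof -
    have "(\<Sum>b\<in>UNIV. frame_mass n Y A B a b) = (\<Sum>i<n. \<Sum>b\<in>UNIV. (G i $ a $ b)\<^sup>2)"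
      unfolding frame_mass_def G_def by (rule sum.swap)
    also have "\<dots> = (\<Sum>i<n. (G i ** transpose (G i)) $ a $ a)"
      by (simp add: matrix_matrix_mult_def transpose_def power2_eq_square)
    also have "\<dots> = (A ** (\<Sum>i<n. Y i ** transpose (Y i)) ** transpose A) $ a $ a"
      unfolding GGT by (simp add: matrix_mult_sum_right matrix_mult_sum_left)
    also have "\<dots> = (real n * real CARD('m2)) * (A ** transpose A) $ a $ a"
      unfolding row by (rule mult_mat_mult_nth)
    finally show ?thesis by (simp add: AA mat_def)
  qed
  have cols: "(\<Sum>a\<in>UNIV. frame_mass n Y A B a b) = real n * real CARD('m1)" for b
  proof -
    have "(\<Sum>a\<in>UNIV. frame_mass n Y A B a b) = (\<Sum>i<n. \<Sum>a\<in>UNIV. (G i $ a $ b)\<^sup>2)"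
      unfolding frame_mass_def G_def by (rule sum.swap)
    also have "\<dots> = (\<Sum>i<n. (transpose (G i) ** G i) $ b $ b)"
      by (simp add: matrix_matrix_mult_def transpose_def power2_eq_square)
    also have "\<dots> = (B ** (\<Sum>i<n. transpose (Y i) ** Y i) ** transpose B) $ b $ b"
      unfolding GTG by (simp add: matrix_mult_sum_right matrix_mult_sum_left)
    also have "\<dots> = (real n * real CARD('m1)) * (B ** transpose B) $ b $ b"
      unfolding col by (rule mult_mat_mult_nth)
    finally show ?thesis by (simp add: BB mat_def)
  qed
  have "(\<Sum>a\<in>UNIV. \<Sum>b\<in>UNIV. (m a + v b) * frame_mass n Y A B a b)
      = (\<Sum>a\<in>UNIV. m a * (\<Sum>b\<in>UNIV. frame_mass n Y A B a b))
      + (\<Sum>a\<in>UNIV. \<Sum>b\<in>UNIV. v b * frame_mass n Y A B a b)"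
    by (simp add: distrib_right sum.distrib sum_distrib_left)
  also have "(\<Sum>a\<in>UNIV. \<Sum>b\<in>UNIV. v b * frame_mass n Y A B a b)
      = (\<Sum>b\<in>UNIV. v b * (\<Sum>a\<in>UNIV. frame_mass n Y A B a b))"
    by (subst sum.swap) (simp add: sum_distrib_left)
  finally have "real n * real CARD('m2) * (\<Sum>a\<in>UNIV. m a) + real n * real CARD('m1) * (\<Sum>b\<in>UNIV. v b)
      = (\<Sum>a\<in>UNIV. \<Sum>b\<in>UNIV. (m a + v b) * frame_mass n Y A B a b)"
    by (simp add: rows cols sum_distrib_right sum_distrib_left mult_ac)
  from loglik_gap_nonneg(1)[OF inv this] show ?thesis unfolding A(2) B(2) AA BB .
qed

section \<open>Linear changes of coordinates\<close>

lemma loglik_congruence: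
  fixes A :: "real^'m1^'m1" and B :: "real^'m2^'m2" and Y :: "nat \<Rightarrow> real^'m2^'m1"
  assumes A: "invertible A" and B: "invertible B" and P: "P1 \<in> PD" "P2 \<in> PD"
  shows "loglik n Y (transpose A ** P1 ** A, transpose B ** P2 ** B)
    = loglik n (\<lambda>i. A ** Y i ** transpose B) (P1, P2)
      + real n * real CARD('m2) * ln ((det A)\<^sup>2) + real n * real CARD('m1) * ln ((det B)\<^sup>2)"
proof -
  obtain C :: "real^'m1^'m1" where C: "invertible C" "P1 = transpose C ** C" using PD_factorization[OF P(1)] by metis
  obtain D :: "real^'m2^'m2" where D: "invertible D" "P2 = transpose D ** D" using PD_factorization[OF P(2)] by metis
  have "(transpose A ** P1 ** A, transpose B ** P2 ** B)
      = (transpose (C ** A) ** diagm (\<lambda>a. exp 0) ** (C ** A), transpose (D ** B) ** diagm (\<lambda>b. exp 0) ** (D ** B))"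
    by (simp add: C D matrix_transpose_mul matrix_mul_assoc)
  moreover have "(P1, P2) = (transpose C ** diagm (\<lambda>a. exp 0) ** C, transpose D ** diagm (\<lambda>b. exp 0) ** D)"
    by (simp add: C D)
  moreover have "frame_mass n Y (C ** A) (D ** B) a b = frame_mass n (\<lambda>i. A ** Y i ** transpose B) C D a b" for a b
    by (simp add: frame_mass_def matrix_transpose_mul matrix_mul_assoc)
  moreover have "invertible (C ** A)" "invertible (D ** B)" using A B C D invertible_mult by blast+
  moreover have "det C \<noteq> 0" "det D \<noteq> 0" "det A \<noteq> 0" "det B \<noteq> 0" using A B C D by (auto simp: invertible_det_nz)
  ultimately show ?thesis
    by (simp only: loglik_frame C D) (simp add: det_mul power_mult_distrib ln_mult algebra_simps)
qed

lemma PD_congruence_preimage: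
  fixes C S :: "real^'k^'k"
  assumes C: "invertible C" and S: "S \<in> PD"
  obtains R where "R \<in> PD" "S = transpose C ** R ** C"
proof -
  obtain C' where C': "C ** C' = mat 1" "C' ** C = mat 1" using C invertible_def by blast
  have T: "transpose C ** transpose C' = mat 1" by (rule transpose_inverse[OF C'(2)])
  have "transpose C ** (transpose C' ** S ** C') ** C = (transpose C ** transpose C') ** S ** (C' ** C)"
    by (simp only: matrix_mul_assoc)
  then have "S = transpose C ** (transpose C' ** S ** C') ** C"
    by (simp only: T C' matrix_mul_lid matrix_mul_rid)
  moreover have "transpose C' ** S ** C' \<in> PD"
    using C' by (intro congruence_in_PD S) (auto simp: invertible_def)
  ultimately show ?thesis using that by blast
qed

lemma mle_exists_congruence:
  fixes A :: "real^'m1^'m1" and B :: "real^'m2^'m2" and Y :: "nat \<Rightarrow> real^'m2^'m1"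
  assumes A: "invertible A" and B: "invertible B" and ex: "mle_exists n (\<lambda>i. A ** Y i ** transpose B)"
  shows "mle_exists n Y"
proof -
  obtain P1 P2 where P: "P1 \<in> PD" "P2 \<in> PD"
    and max: "\<And>R1 R2. R1 \<in> PD \<Longrightarrow> R2 \<in> PD \<Longrightarrow>
      loglik n (\<lambda>i. A ** Y i ** transpose B) (R1, R2) \<le> loglik n (\<lambda>i. A ** Y i ** transpose B) (P1, P2)"
    using ex unfolding mle_exists_def by fastforce
  have "loglik n Y (Q1, Q2) \<le> loglik n Y (transpose A ** P1 ** A, transpose B ** P2 ** B)"
    if Q: "Q1 \<in> PD" "Q2 \<in> PD" for Q1 Q2
  proof -
    obtain R1 where R1: "R1 \<in> PD" "Q1 = transpose A ** R1 ** A" using PD_congruence_preimage[OF A Q(1)] by metis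
    obtain R2 where R2: "R2 \<in> PD" "Q2 = transpose B ** R2 ** B" using PD_congruence_preimage[OF B Q(2)] by metis
    show ?thesis unfolding R1(2) R2(2)
      using max[OF R1(1) R2(1)] by (simp add: loglik_congruence[OF A B] P R1 R2)
  qed
  moreover have "(transpose A ** P1 ** A, transpose B ** P2 ** B) \<in> PD \<times> PD"
    by (intro SigmaI congruence_in_PD A B P)
  ultimately show ?thesis unfolding mle_exists_def
    by (intro bexI[of _ "(transpose A ** P1 ** A, transpose B ** P2 ** B)"]) auto
qed

lemma one_in_PD [simp]: "mat 1 \<in> PD"
  using diagm_in_PD[of "\<lambda>_. 1"] by simp

lemma balanced_mle_exists:
  fixes Y :: "nat \<Rightarrow> real^'m2^'m1"
  assumes "(\<Sum>i<n. Y i ** transpose (Y i)) = mat (real n * real CARD('m2))"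
    and "(\<Sum>i<n. transpose (Y i) ** Y i) = mat (real n * real CARD('m1))"
  shows "mle_exists n Y"
  unfolding mle_exists_def
proof (intro bexI[of _ "(mat 1, mat 1)"] ballI)
  fix Q :: "(real^'m1^'m1) \<times> (real^'m2^'m2)" assume "Q \<in> PD \<times> PD"
  then show "loglik n Y Q \<le> loglik n Y (mat 1, mat 1)"
    using balanced_mle[OF assms, of "fst Q" "snd Q"] by auto
qed auto

lemma mle_exists_bounded: "mle_exists n Y \<Longrightarrow> loglik_bounded n Y"
  unfolding mle_exists_def loglik_bounded_def bdd_above_def by blast

text \<open>A pair \<open>(X\<^sub>1, X\<^sub>2)\<close> with \<open>X\<^sub>1 Y\<^sub>i = Y\<^sub>i X\<^sub>2\<close> moves maximisers to maximisers: it changes the log-likelihood by a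
  constant and its inverse by the opposite constant, so the constant is zero. Evaluated at eigenvectors, equal Kronecker products
  would make the squares of the eigenvalues equal.\<close>

lemma not_unique_if_symmetry:
  fixes Y :: "nat \<Rightarrow> real^'m2^'m1" and X1 :: "real^'m1^'m1" and X2 :: "real^'m2^'m2"
  assumes X: "invertible X1" "invertible X2" and comm: "\<And>i. i < n \<Longrightarrow> X1 ** Y i = Y i ** X2"
    and e: "transpose X2 *v e = l *\<^sub>R e" "e \<noteq> 0" and f: "transpose X2 *v f = k *\<^sub>R f" "f \<noteq> 0"
    and lk: "l\<^sup>2 \<noteq> k\<^sup>2"
  shows "\<not> mle_exists_uniquely n Y"
proof
  assume uniq: "mle_exists_uniquely n Y"
  then obtain P1 P2 where P: "P1 \<in> PD" "P2 \<in> PD"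
    and max: "\<And>R1 R2. R1 \<in> PD \<Longrightarrow> R2 \<in> PD \<Longrightarrow> loglik n Y (R1, R2) \<le> loglik n Y (P1, P2)"
    unfolding mle_exists_uniquely_def mle_exists_def by fastforce
  obtain Z1 where Z1: "X1 ** Z1 = mat 1" "Z1 ** X1 = mat 1" using X(1) invertible_def by blast
  obtain Z2 where Z2: "X2 ** Z2 = mat 1" "Z2 ** X2 = mat 1" using X(2) invertible_def by blast
  have inv: "invertible Z1" "invertible Z2" "invertible (transpose X2)" "invertible (transpose Z2)"
    using X Z1 Z2 invertible_def invertible_transpose by blast+
  have Y1: "X1 ** Y i ** Z2 = Y i" if "i < n" for i
    using comm[OF that] Z2 by (metis matrix_mul_assoc matrix_mul_rid)
  have Y2: "Z1 ** Y i ** X2 = Y i" if "i < n" for i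
    using comm[OF that] Z1 by (metis matrix_mul_assoc matrix_mul_lid)
  have cong: "loglik n Y' R = loglik n Y R" if "\<And>i. i < n \<Longrightarrow> Y' i = Y i" for Y' R
    using that by (simp add: loglik_def split_beta)
  define Q1 where "Q1 = transpose X1 ** P1 ** X1"
  define Q2 where "Q2 = transpose (transpose Z2) ** P2 ** transpose Z2"
  have QPD: "Q1 \<in> PD" "Q2 \<in> PD" unfolding Q1_def Q2_def by (intro congruence_in_PD X inv P)+
  have T1: "loglik n Y (Q1, Q2) = loglik n Y (P1, P2)
      + real n * real CARD('m2) * ln ((det X1)\<^sup>2) + real n * real CARD('m1) * ln ((det Z2)\<^sup>2)"
    using loglik_congruence[OF X(1) inv(4) P, of n Y] cong[of "\<lambda>i. X1 ** Y i ** Z2"] Y1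
    by (simp add: Q1_def Q2_def)
  have "loglik n Y (transpose Z1 ** P1 ** Z1, transpose (transpose X2) ** P2 ** transpose X2) = loglik n Y (P1, P2)
      + real n * real CARD('m2) * ln ((det Z1)\<^sup>2) + real n * real CARD('m1) * ln ((det X2)\<^sup>2)"
    using loglik_congruence[OF inv(1,3) P, of n Y] cong[of "\<lambda>i. Z1 ** Y i ** X2"] Y2 by simp
  moreover have "loglik n Y (transpose Z1 ** P1 ** Z1, transpose (transpose X2) ** P2 ** transpose X2) \<le> loglik n Y (P1, P2)"
    by (intro max congruence_in_PD inv P)
  moreover have "ln ((det Z1)\<^sup>2) = - ln ((det X1)\<^sup>2)" "ln ((det X2)\<^sup>2) = - ln ((det Z2)\<^sup>2)"
  proof -
    have "det X1 * det Z1 = 1" "det X2 * det Z2 = 1" using Z1 Z2 by (metis det_I det_mul)+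
    then have "(det X1)\<^sup>2 * (det Z1)\<^sup>2 = 1" "(det X2)\<^sup>2 * (det Z2)\<^sup>2 = 1" "det X1 \<noteq> 0" "det Z1 \<noteq> 0" "det X2 \<noteq> 0" "det Z2 \<noteq> 0"
      by (auto simp flip: power_mult_distrib)
    then show "ln ((det Z1)\<^sup>2) = - ln ((det X1)\<^sup>2)" "ln ((det X2)\<^sup>2) = - ln ((det Z2)\<^sup>2)"
      using ln_mult[of "(det X1)\<^sup>2" "(det Z1)\<^sup>2"] ln_mult[of "(det X2)\<^sup>2" "(det Z2)\<^sup>2"] by auto
  qed
  ultimately have "loglik n Y (P1, P2) \<le> loglik n Y (Q1, Q2)" using T1 by simp
  then have "\<forall>Q \<in> PD \<times> PD. loglik n Y Q \<le> loglik n Y (Q1, Q2)" using max by force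
  then have "is_local_max n Y (Q1, Q2)" using QPD by (intro mle_is_local_max) auto
  moreover have "is_local_max n Y (P1, P2)" using P max by (intro mle_is_local_max) auto
  ultimately have kron: "kronecker_product P2 P1 = kronecker_product Q2 Q1"
    using uniq unfolding mle_exists_uniquely_def by blast
  have entries: "P2 $ b $ d * P1 $ a $ c = Q2 $ b $ d * Q1 $ a $ c" for a b c d
    using arg_cong[OF kron, of "\<lambda>K. K $ (b, a) $ (d, c)"] by (simp add: kronecker_product_def)
  define y where "y = (axis undefined 1 :: real^'m1)"
  have y: "y \<noteq> 0" by (simp add: y_def)
  have forms: "(x \<bullet> (P2 *v x)) * (y \<bullet> (P1 *v y)) = (x \<bullet> (Q2 *v x)) * (y \<bullet> (Q1 *v y))" for x
  proof -
    have 1: "z \<bullet> (S *v z) = (\<Sum>b\<in>UNIV. \<Sum>d\<in>UNIV. z $ b * z $ d * S $ b $ d)" for z :: "real^'k" and S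
      by (simp add: inner_vec_def matrix_vector_mult_def sum_distrib_left mult_ac)
    have y1: "y \<bullet> (S *v y) = S $ undefined $ undefined" for S
      by (simp add: y_def inner_axis' matrix_vector_mult_basis column_def)
    show ?thesis unfolding 1[of x] y1 by (simp add: sum_distrib_right mult.assoc entries)
  qed
  have eig: "(x \<bullet> (P2 *v x)) = r\<^sup>2 * (x \<bullet> (Q2 *v x))" if x: "transpose X2 *v x = r *\<^sub>R x" for x r
  proof -
    have "transpose Z2 ** transpose X2 = mat 1" by (rule transpose_inverse[OF Z2(1)])
    then have "x = (transpose Z2 ** transpose X2) *v x" by simp
    also have "\<dots> = r *\<^sub>R (transpose Z2 *v x)"
      using x by (simp only: matrix_vector_mul_assoc[symmetric] matrix_vector_mult_scaleR)
    finally have xr: "x = r *\<^sub>R (transpose Z2 *v x)" .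
    have "x \<bullet> (Q2 *v x) = (transpose Z2 *v x) \<bullet> (P2 *v (transpose Z2 *v x))"
      unfolding Q2_def
      using dot_matrix_vector_transpose[of x "transpose (transpose Z2)" "P2 *v (transpose Z2 *v x)"]
      by (simp only: matrix_vector_mul_assoc matrix_mul_assoc transpose_transpose)
    moreover have "x \<bullet> (P2 *v x) = r\<^sup>2 * ((transpose Z2 *v x) \<bullet> (P2 *v (transpose Z2 *v x)))"
      by (subst (1 2) xr) (simp only: matrix_vector_mult_scaleR inner_scaleR_left inner_scaleR_right power2_eq_square mult.assoc)
    ultimately show ?thesis by simp
  qed
  have main: "r\<^sup>2 * (y \<bullet> (P1 *v y)) = y \<bullet> (Q1 *v y)" if "transpose X2 *v x = r *\<^sub>R x" "x \<noteq> 0" for x r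
    using forms[of x] eig[OF that(1)] PD_positive[OF QPD(2) that(2)] by simp
  have "l\<^sup>2 * (y \<bullet> (P1 *v y)) = k\<^sup>2 * (y \<bullet> (P1 *v y))" using main[OF e] main[OF f] by simp
  then show False using lk PD_positive[OF P(1) y] by simp
qed

section \<open>Stable samples\<close>

text \<open>Stability in the sense of geometric invariant theory, in the form of King's criterion: the slope of every
  proper subrepresentation is strictly on one side of the slope of the whole.\<close>

definition stable_sample :: "nat \<Rightarrow> (nat \<Rightarrow> real^'m2^'m1) \<Rightarrow> bool" where
  "stable_sample n Y \<longleftrightarrow> (\<forall>U W. subspace U \<longrightarrow> subspace W \<longrightarrow> U \<noteq> {0} \<longrightarrow>
     (\<forall>i<n. \<forall>u\<in>U. Y i *v u \<in> W) \<longrightarrow> \<not> (U = UNIV \<and> W = UNIV) \<longrightarrow>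
     dim U * CARD('m1) < dim W * CARD('m2))"

lemma dim_coordinate_subspace: "dim {x::real^'n. \<forall>i. i \<notin> d \<longrightarrow> x $ i = 0} = card d"
  using dim_substandard_cart[of d, where 'a = real] by (simp add: dim_vec_eq)

lemma subspace_coordinate: "subspace {x::real^'n. \<forall>i. i \<notin> d \<longrightarrow> x $ i = 0}"
  by (auto simp: subspace_def)

lemma linear_matrix_image_subspace: "subspace S \<Longrightarrow> subspace ((*v) (A::real^'n^'m) ` S)"
  by (intro linear_subspace_image) auto

lemma dim_invertible_image:
  fixes A :: "real^'n^'n"
  assumes "invertible A"
  shows "dim ((*v) A ` S) = dim S"
proof -
  have "inj ((*v) A)" using assms by (simp add: inj_matrix_vector_mult)
  then show ?thesis by (intro dim_image_eq) (auto intro: inj_on_subset)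
qed

text \<open>Seen in the frames \<open>A\<close>, \<open>B\<close>, a block of zeros says that every sample matrix takes the span of the
  vectors indexed by \<open>J\<close> into the span of the vectors indexed by \<open>I\<close>.\<close>

lemma stable_sample_zero_block:
  fixes Y :: "nat \<Rightarrow> real^'m2^'m1" and A :: "real^'m1^'m1" and B :: "real^'m2^'m2"
  assumes st: "stable_sample n Y" and A: "invertible A" and B: "invertible B"
    and zero: "\<And>a b. a \<notin> I \<Longrightarrow> b \<in> J \<Longrightarrow> frame_mass n Y A B a b = 0"
    and J: "J \<noteq> {}" and proper: "\<not> (J = UNIV \<and> I = UNIV)"
  shows "card J * CARD('m1) < card I * CARD('m2)"
proof -
  obtain A' where A': "A ** A' = mat 1" "A' ** A = mat 1" using A invertible_def by blast
  have invA': "invertible A'" using A' invertible_def by blast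
  have invB: "invertible (transpose B)" using B invertible_transpose by blast
  define CJ where "CJ = {x::real^'m2. \<forall>i. i \<notin> J \<longrightarrow> x $ i = 0}"
  define CI where "CI = {x::real^'m1. \<forall>i. i \<notin> I \<longrightarrow> x $ i = 0}"
  define U where "U = (*v) (transpose B) ` CJ"
  define W where "W = (*v) A' ` CI"
  have dU: "dim U = card J" unfolding U_def CJ_def
    by (simp only: dim_invertible_image[OF invB] dim_coordinate_subspace)
  have dW: "dim W = card I" unfolding W_def CI_def
    by (simp only: dim_invertible_image[OF invA'] dim_coordinate_subspace)
  have "subspace U" "subspace W" unfolding U_def W_def CJ_def CI_def
    by (intro linear_matrix_image_subspace subspace_coordinate)+
  moreover have "card J \<noteq> 0" using J by simp
  then have "U \<noteq> {0}" using dU by auto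
  moreover have "\<forall>i<n. \<forall>u\<in>U. Y i *v u \<in> W"
  proof (intro allI impI ballI)
    fix i u assume i: "i < n" and "u \<in> U"
    then obtain x where x: "x \<in> CJ" "u = transpose B *v x" by (auto simp: U_def)
    have G0: "(A ** Y i ** transpose B) $ a $ b = 0" if "a \<notin> I" "b \<in> J" for a b
      using zero[OF that] i by (simp add: frame_mass_eq_0_iff)
    have "((A ** Y i ** transpose B) *v x) $ a = 0" if "a \<notin> I" for a
    proof -
      have z: "(A ** Y i ** transpose B) $ a $ b * x $ b = 0" for b
        using G0[OF that, of b] x(1) by (cases "b \<in> J") (auto simp: CJ_def)
      show ?thesis unfolding matrix_vector_mult_def vec_lambda_beta by (intro sum.neutral ballI z)
    qed
    then have "(A ** Y i ** transpose B) *v x \<in> CI" by (simp add: CI_def)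
    moreover have "Y i *v u = A' *v ((A ** Y i ** transpose B) *v x)"
    proof -
      have "A' *v ((A ** Y i ** transpose B) *v x) = (A' ** A) *v (Y i *v (transpose B *v x))"
        by (simp only: matrix_vector_mul_assoc matrix_mul_assoc)
      then show ?thesis by (simp only: A' x(2) matrix_vector_mul_lid)
    qed
    ultimately show "Y i *v u \<in> W" by (auto simp: W_def)
  qed
  moreover have "\<not> (U = UNIV \<and> W = UNIV)"
  proof
    assume "U = UNIV \<and> W = UNIV"
    then have "card J = CARD('m2)" "card I = CARD('m1)" using dU dW by auto
    then have "J = UNIV" "I = UNIV" by (metis card_eq_UNIV_imp_eq_UNIV finite)+
    with proper show False by blast
  qed
  ultimately show ?thesis using st dU dW unfolding stable_sample_def by metis
qed

text \<open>Between two local maxima the sets where \<open>v = s\<close> and where \<open>m = - s\<close> cut out zero blocks, one for each value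
  \<open>s\<close>. The strict inequalities for all of them would add up to \<open>m1 m2 < m1 m2\<close>, unless a single value
  occurs. Then the maxima differ by the factors \<open>exp (- s)\<close> and \<open>exp s\<close>, which cancel in the Kronecker product.\<close>

lemma stable_exists_unique:
  fixes Y :: "nat \<Rightarrow> real^'m2^'m1"
  assumes st: "stable_sample n Y" and ex: "mle_exists n Y"
  shows "mle_exists_uniquely n Y"
  unfolding mle_exists_uniquely_def
proof (intro conjI allI impI)
  fix P1 :: "real^'m1^'m1" and P2 :: "real^'m2^'m2" and Q1 Q2
  assume P: "is_local_max n Y (P1, P2)" and Q: "is_local_max n Y (Q1, Q2)"
  obtain A :: "real^'m1^'m1" and B :: "real^'m2^'m2" and m v where
    A: "invertible A" and B: "invertible B" and PQ: "P1 = transpose A ** A" "P2 = transpose B ** B"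
    "Q1 = transpose A ** diagm (\<lambda>a. exp (m a)) ** A" "Q2 = transpose B ** diagm (\<lambda>b. exp (v b)) ** B"
    and mv: "\<And>a b. frame_mass n Y A B a b \<noteq> 0 \<Longrightarrow> m a + v b = 0"
    using two_local_maxima[OF P Q] by metis
  define J where "J = (\<lambda>s. {b. v b = s})"
  define I where "I = (\<lambda>s. {a. m a = - s})"
  have "\<exists>s. J s = UNIV \<and> I s = UNIV"
  proof (rule ccontr)
    assume contra: "\<not> ?thesis"
    have lt: "card (J s) * CARD('m1) < card (I s) * CARD('m2)" if "s \<in> range v" for s
    proof (rule stable_sample_zero_block[OF st A B])
      fix a b assume "a \<notin> I s" "b \<in> J s"
      then show "frame_mass n Y A B a b = 0" using mv[of a b] by (auto simp: I_def J_def)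
    qed (use that contra in \<open>auto simp: J_def\<close>)
    have "(\<Sum>s\<in>range v. card (J s) * CARD('m1)) < (\<Sum>s\<in>range v. card (I s) * CARD('m2))"
      using lt by (intro sum_strict_mono) auto
    moreover have "(\<Sum>s\<in>range v. card (J s)) = CARD('m2)"
    proof -
      have "(\<Sum>s\<in>range v. card (J s)) = card (\<Union>s\<in>range v. J s)"
        by (rule card_UN_disjoint[symmetric]) (auto simp: J_def)
      also have "(\<Union>s\<in>range v. J s) = UNIV" by (auto simp: J_def)
      finally show ?thesis .
    qed
    moreover have "(\<Sum>s\<in>range v. card (I s)) \<le> CARD('m1)"
    proof -
      have "(\<Sum>s\<in>range v. card (I s)) = card (\<Union>s\<in>range v. I s)"
        by (rule card_UN_disjoint[symmetric]) (auto simp: I_def)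
      also have "\<dots> \<le> CARD('m1)" by (rule card_mono) auto
      finally show ?thesis .
    qed
    then have "(\<Sum>s\<in>range v. card (I s)) * CARD('m2) \<le> CARD('m1) * CARD('m2)" by (rule mult_le_mono1)
    ultimately show False by (simp flip: sum_distrib_right)
  qed
  then obtain s where "J s = UNIV" "I s = UNIV" by blast
  then have v: "v b = s" and m: "m a = - s" for a b by (auto simp: I_def J_def)
  have Q1: "Q1 $ i $ j = exp (- s) * P1 $ i $ j" for i j
  proof -
    have "diagm (\<lambda>i::'m1. exp (m i)) = mat (exp (- s))" by (simp add: vec_eq_iff mat_def m)
    then show ?thesis unfolding PQ using mult_mat_mult_nth[of "transpose A" "exp (- s)" A i j] by simp
  qed
  have Q2: "Q2 $ i $ j = exp s * P2 $ i $ j" for i j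
  proof -
    have "diagm (\<lambda>i::'m2. exp (v i)) = mat (exp s)" by (simp add: vec_eq_iff mat_def v)
    then show ?thesis unfolding PQ using mult_mat_mult_nth[of "transpose B" "exp s" B i j] by simp
  qed
  have "exp (- s) * exp s = (1::real)" by (simp flip: exp_add)
  then show "kronecker_product P2 P1 = kronecker_product Q2 Q1"
    by (simp add: kronecker_product_def vec_eq_iff Q1 Q2 mult.assoc mult.left_commute[of _ "exp (- s)"])
qed (rule ex)

section \<open>Existence of the maximum for stable samples\<close>

text \<open>A quantitative form of the dimension condition for a pair of frames: it survives when entries of mass
  below \<open>\<epsilon>\<close> count as zero.\<close>

definition heavy :: "nat \<Rightarrow> (nat \<Rightarrow> real^'m2^'m1) \<Rightarrow> real \<Rightarrow> real^'m1^'m1 \<Rightarrow> real^'m2^'m2 \<Rightarrow> bool" where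
  "heavy n Y \<epsilon> A B \<longleftrightarrow> (\<forall>J I. J \<noteq> {} \<longrightarrow> \<not> (J = UNIV \<and> I = UNIV) \<longrightarrow> card I * CARD('m2) \<le> card J * CARD('m1) \<longrightarrow>
      (\<exists>b\<in>J. \<exists>a. a \<notin> I \<and> frame_mass n Y A B a b \<ge> \<epsilon>))"

lemma compact_orthogonal_matrices: "compact {Q::real^'n^'n. orthogonal_matrix Q}"
proof (rule compact_eq_bounded_closed[THEN iffD2], rule conjI)
  have rownorm: "norm (Q $ i) = 1" if "orthogonal_matrix Q" for Q :: "real^'n^'n" and i
    using that by (simp add: orthogonal_matrix_orthonormal_rows row_def)
  have "norm Q \<le> real CARD('n)" if "orthogonal_matrix Q" for Q :: "real^'n^'n"
  proof -
    have "norm Q \<le> (\<Sum>i\<in>UNIV. norm (Q $ i))" unfolding norm_vec_def by (rule L2_set_le_sum) auto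
    then show ?thesis using rownorm[OF that] by simp
  qed
  then show "bounded {Q::real^'n^'n. orthogonal_matrix Q}" unfolding bounded_iff by blast
  have "{Q::real^'n^'n. orthogonal_matrix Q} = {Q. transpose Q ** Q = mat 1}"
    by (simp add: orthogonal_matrix)
  also have "closed \<dots>" by (intro closed_Collect_eq continuous_intros)
  finally show "closed {Q::real^'n^'n. orthogonal_matrix Q}" .
qed

text \<open>The total mass outside a forbidden zero block is a continuous positive function on the compact set of pairs of
  orthogonal frames, and there are finitely many blocks.\<close>

lemma stable_sample_heavy:
  fixes Y :: "nat \<Rightarrow> real^'m2^'m1"
  assumes st: "stable_sample n Y"
  obtains \<epsilon> where "\<epsilon> > 0" "\<And>A B. orthogonal_matrix A \<Longrightarrow> orthogonal_matrix B \<Longrightarrow> heavy n Y \<epsilon> A B"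
proof -
  define K where "K = {A::real^'m1^'m1. orthogonal_matrix A} \<times> {B::real^'m2^'m2. orthogonal_matrix B}"
  define h where "h = (\<lambda>(J, I) (A, B). \<Sum>b\<in>J. \<Sum>a\<in>-I. frame_mass n Y A B a b)"
  define bad where "bad = {(J, I). J \<noteq> {} \<and> \<not> (J = UNIV \<and> I = (UNIV::'m1 set)) \<and> card I * CARD('m2) \<le> card (J::'m2 set) * CARD('m1)}"
  have K: "compact K" "K \<noteq> {}"
  proof -
    show "compact K" unfolding K_def by (intro compact_Times compact_orthogonal_matrices)
    have "(mat 1, mat 1) \<in> K" by (simp add: K_def orthogonal_matrix_id)
    then show "K \<noteq> {}" by blast
  qed
  have "\<exists>\<delta>>0. \<forall>AB\<in>K. \<delta> \<le> h p AB" if p: "p \<in> bad" for p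
  proof -
    obtain J I where p_eq: "p = (J, I)" by fastforce
    have "continuous_on K (h p)"
      unfolding h_def p_eq frame_mass_def split_beta by (simp, intro continuous_intros)
    then obtain AB where AB: "AB \<in> K" "\<forall>x\<in>K. h p AB \<le> h p x"
      using continuous_attains_inf[OF K] by blast
    obtain A B where AB_eq: "AB = (A, B)" by fastforce
    have inv: "invertible A" "invertible B" using AB orthogonal_matrix_invertible unfolding K_def AB_eq by auto
    have "h p AB \<noteq> 0"
    proof
      assume "h p AB = 0"
      then have "frame_mass n Y A B a b = 0" if "a \<notin> I" "b \<in> J" for a b
        using that by (simp add: h_def p_eq AB_eq sum_nonneg_eq_0_iff sum_nonneg)
      then have "card J * CARD('m1) < card I * CARD('m2)"
        using p by (intro stable_sample_zero_block[OF st inv]) (auto simp: bad_def p_eq)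
      then show False using p by (auto simp: bad_def p_eq)
    qed
    moreover have "h p AB \<ge> 0" by (simp add: h_def p_eq AB_eq sum_nonneg)
    ultimately show ?thesis using AB(2) by (intro exI[of _ "h p AB"]) auto
  qed
  then obtain \<delta> where \<delta>: "\<And>p. p \<in> bad \<Longrightarrow> \<delta> p > 0" "\<And>p AB. p \<in> bad \<Longrightarrow> AB \<in> K \<Longrightarrow> \<delta> p \<le> h p AB" by metis
  define \<delta>0 where "\<delta>0 = Min (insert 1 (\<delta> ` bad))"
  have fin: "finite (insert 1 (\<delta> ` bad))" by simp
  have \<delta>0: "\<delta>0 > 0" unfolding \<delta>0_def using \<delta>(1) by (subst Min_gr_iff[OF fin]) auto
  have \<delta>0_le: "\<delta>0 \<le> \<delta> p" if "p \<in> bad" for p unfolding \<delta>0_def using that by (intro Min_le[OF fin]) auto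
  define N where "N = real CARD('m1) * real CARD('m2)"
  have N: "N > 0" by (simp add: N_def)
  define \<epsilon> where "\<epsilon> = \<delta>0 / (2 * N)"
  have "heavy n Y \<epsilon> A B" if "orthogonal_matrix A" "orthogonal_matrix B" for A B
    unfolding heavy_def
  proof (intro allI impI, rule ccontr)
    fix J I assume JI: "J \<noteq> {}" "\<not> (J = UNIV \<and> I = UNIV)" "card I * CARD('m2) \<le> card J * CARD('m1)"
      and no: "\<not> (\<exists>b\<in>J. \<exists>a. a \<notin> I \<and> \<epsilon> \<le> frame_mass n Y A B a b)"
    have bad: "(J, I) \<in> bad" using JI by (simp add: bad_def)
    have "h (J, I) (A, B) \<le> (\<Sum>b\<in>J. \<Sum>a\<in>-I. \<epsilon>)"
      unfolding h_def prod.case using no by (intro sum_mono) (meson ComplD linear)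
    also have "\<dots> = real (card J) * real (card (-I)) * \<epsilon>" by simp
    also have "\<dots> \<le> (real CARD('m2) * real CARD('m1)) * \<epsilon>"
      using \<delta>0 N by (intro mult_right_mono mult_mono) (auto simp: \<epsilon>_def intro!: card_mono)
    also have "\<dots> = \<delta>0 / 2" using N by (simp add: \<epsilon>_def N_def)
    also have "\<dots> < \<delta>0" using \<delta>0 by simp
    also have "\<delta>0 \<le> h (J, I) (A, B)" using \<delta>0_le[OF bad] \<delta>(2)[OF bad, of "(A, B)"] that by (auto simp: K_def)
    finally show False by simp
  qed
  moreover have "\<epsilon> > 0" using \<delta>0 N by (simp add: \<epsilon>_def)
  ultimately show ?thesis using that by blast
qed

lemma integral_step:
  fixes x M :: real
  assumes "- M \<le> x" "x \<le> M"
  shows "((\<lambda>s. if s \<le> x then 1 else 0 :: real) has_integral (x + M)) {-M..M}"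
proof -
  have "((\<lambda>s. 1::real) has_integral (x + M)) {-M..x}"
    using has_integral_const_real[of "1::real" "-M" x] assms by simp
  then have "((\<lambda>s. if s \<in> {-M..x} then 1 else 0 :: real) has_integral (x + M)) {-M..M}"
    using assms by (subst has_integral_restrict) auto
  then show ?thesis by (rule has_integral_eq[rotated]) auto
qed

text \<open>A layer-cake argument. At every level \<open>s\<close> the set where \<open>v \<ge> s\<close> has at least as many heavy neighbours as
  stability demands, and all these neighbours satisfy \<open>R - m \<ge> s\<close>. Between the values \<open>v b'\<close> and \<open>v b\<close> the demand is strict.
  Integration over \<open>s\<close> turns the counts into sums and the strictness into the spread of \<open>v\<close>.\<close>

lemma heavy_spread_bound:
  fixes Y :: "nat \<Rightarrow> real^'m2^'m1" and m :: "'m1 \<Rightarrow> real" and v :: "'m2 \<Rightarrow> real"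
  assumes hv: "heavy n Y \<epsilon> A B" and m0: "(\<Sum>a\<in>UNIV. m a) = 0" and v0: "(\<Sum>b\<in>UNIV. v b) = 0"
    and le: "\<And>a b. \<epsilon> \<le> frame_mass n Y A B a b \<Longrightarrow> m a + v b \<le> R"
  shows "v b - v b' \<le> real CARD('m1) * real CARD('m2) * R"
proof -
  \<comment> \<open>As a function of \<open>s\<close> on \<open>[- M, M]\<close>, \<open>f x\<close> is the indicator of \<open>s \<le> x\<close> and has integral \<open>x + M\<close>.\<close>
  define f where "f = (\<lambda>(x::real) s. if s \<le> x then 1 else 0 :: real)"
  define M where "M = (\<Sum>b\<in>UNIV. \<bar>v b\<bar>) + (\<Sum>a\<in>UNIV. \<bar>R - m a\<bar>)"
  have vM: "\<bar>v b\<bar> \<le> M" for b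
    using member_le_sum[of b UNIV "\<lambda>b. \<bar>v b\<bar>"] by (simp add: M_def sum_nonneg add_increasing2)
  have mM: "\<bar>R - m a\<bar> \<le> M" for a
    using member_le_sum[of a UNIV "\<lambda>a. \<bar>R - m a\<bar>"] by (simp add: M_def sum_nonneg add_increasing)
  have int: "(f x has_integral (x + M)) {-M..M}" if "\<bar>x\<bar> \<le> M" for x
    using integral_step[of M x] that by (simp add: f_def abs_le_iff)
  have pointwise: "real CARD('m1) * (\<Sum>b\<in>UNIV. f (v b) s) + (f (v b) s - f (v b') s)
      \<le> real CARD('m2) * (\<Sum>a\<in>UNIV. f (R - m a) s)" for s
  proof -
    define J where "J = {b. s \<le> v b}"
    define I where "I = {a. s \<le> R - m a}"
    have card_J: "(\<Sum>b\<in>UNIV. f (v b) s) = real (card J)"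
    proof -
      have "(\<Sum>i\<in>UNIV. f (v i) s) = (\<Sum>i\<in>{i. s \<le> v i}. 1)" unfolding f_def by (subst sum.inter_filter[symmetric]) auto
      then show ?thesis by (simp add: J_def)
    qed
    have card_I: "(\<Sum>a\<in>UNIV. f (R - m a) s) = real (card I)"
    proof -
      have "(\<Sum>i\<in>UNIV. f (R - m i) s) = (\<Sum>i\<in>{i. s \<le> R - m i}. 1)" unfolding f_def by (subst sum.inter_filter[symmetric]) auto
      then show ?thesis by (simp add: I_def)
    qed
    have none: "\<not> (\<exists>b\<in>J. \<exists>a. a \<notin> I \<and> \<epsilon> \<le> frame_mass n Y A B a b)"
      using le by (force simp: J_def I_def)
    have hall: "J = {} \<or> (J = UNIV \<and> I = UNIV) \<or> card J * CARD('m1) < card I * CARD('m2)"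
      using hv none unfolding heavy_def by (meson not_le)
    consider "J = {}" | "J = UNIV" "I = UNIV" | "card J * CARD('m1) < card I * CARD('m2)" using hall by blast
    then show ?thesis
    proof cases
      case 1
      then have "f (v b) s = 0" "f (v b') s = 0" by (auto simp: J_def f_def)
      then show ?thesis unfolding card_J card_I using 1 by simp
    next
      case 2
      then have "f (v b) s = 1" "f (v b') s = 1" by (auto simp: J_def f_def)
      then show ?thesis unfolding card_J card_I using 2 by simp
    next
      case 3
      then have "real (card J * CARD('m1) + 1) \<le> real (card I * CARD('m2))" by linarith
      moreover have "f (v b) s - f (v b') s \<le> 1" by (simp add: f_def)
      ultimately show ?thesis unfolding card_J card_I by (simp add: mult.commute)
    qed
  qed
  have "((\<lambda>s. real CARD('m1) * (\<Sum>b\<in>UNIV. f (v b) s) + (f (v b) s - f (v b') s)) has_integral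
      real CARD('m1) * (\<Sum>b\<in>UNIV. v b + M) + ((v b + M) - (v b' + M))) {-M..M}"
    by (intro has_integral_add has_integral_diff has_integral_mult_right has_integral_sum int vM) auto
  moreover have "((\<lambda>s. real CARD('m2) * (\<Sum>a\<in>UNIV. f (R - m a) s)) has_integral
      real CARD('m2) * (\<Sum>a\<in>UNIV. (R - m a) + M)) {-M..M}"
    by (intro has_integral_mult_right has_integral_sum int mM) auto
  ultimately have "real CARD('m1) * (\<Sum>b\<in>UNIV. v b + M) + ((v b + M) - (v b' + M))
      \<le> real CARD('m2) * (\<Sum>a\<in>UNIV. (R - m a) + M)"
    by (rule has_integral_le) (use pointwise in auto)
  then show ?thesis by (simp add: sum.distrib sum_subtractf m0 v0 algebra_simps)
qed

lemma heavy_bound: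
  fixes Y :: "nat \<Rightarrow> real^'m2^'m1" and m :: "'m1 \<Rightarrow> real" and v :: "'m2 \<Rightarrow> real"
  assumes hv: "heavy n Y \<epsilon> A B" and m0: "(\<Sum>a\<in>UNIV. m a) = 0" and v0: "(\<Sum>b\<in>UNIV. v b) = 0"
    and le: "\<And>a b. \<epsilon> \<le> frame_mass n Y A B a b \<Longrightarrow> m a + v b \<le> R"
  shows "v b \<le> real CARD('m1) * real CARD('m2) * R" "m a \<le> R + real CARD('m1) * real CARD('m2) * R"
proof -
  have spread: "v b - v b' \<le> real CARD('m1) * real CARD('m2) * R" for b b'
    by (rule heavy_spread_bound[OF hv m0 v0 le])
  have ex_le: "\<exists>b'. v b' \<le> 0"
  proof (rule ccontr)
    assume "\<not> ?thesis" then have "\<And>b. v b > 0" by (simp add: not_le)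
    then have "(\<Sum>b\<in>UNIV. v b) > 0" by (intro sum_pos) auto
    with v0 show False by simp
  qed
  have ex_ge: "\<exists>b'. v b' \<ge> 0"
  proof (rule ccontr)
    assume "\<not> ?thesis" then have "\<And>b. - v b > 0" by (simp add: not_le)
    then have "(\<Sum>b\<in>UNIV. - v b) > 0" by (intro sum_pos) auto
    with v0 show False by (simp add: sum_negf)
  qed
  obtain b' where "v b' \<le> 0" using ex_le by blast
  then show "v b \<le> real CARD('m1) * real CARD('m2) * R" using spread[of b b'] by simp
  have "\<exists>b\<in>UNIV. \<exists>c. c \<notin> - {a} \<and> \<epsilon> \<le> frame_mass n Y A B c b"
    using hv unfolding heavy_def by (elim allE[of _ UNIV] allE[of _ "- {a}"]) (auto simp: mult.commute intro!: mult_le_mono card_mono)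
  then obtain c where c: "\<epsilon> \<le> frame_mass n Y A B a c" by auto
  obtain b'' where "v b'' \<ge> 0" using ex_ge by blast
  then have "- v c \<le> real CARD('m1) * real CARD('m2) * R" using spread[of b'' c] by simp
  then show "m a \<le> R + real CARD('m1) * real CARD('m2) * R" using le[OF c] by simp
qed

lemma norm_matrix_le:
  fixes A :: "real^'n^'m"
  assumes "\<And>i j. \<bar>A $ i $ j\<bar> \<le> c"
  shows "norm A \<le> real CARD('m) * (real CARD('n) * c)"
proof -
  have "norm (A $ i) \<le> real CARD('n) * c" for i
  proof -
    have "norm (A $ i) \<le> (\<Sum>j\<in>UNIV. \<bar>A $ i $ j\<bar>)" by (rule norm_le_l1_cart)
    also have "\<dots> \<le> (\<Sum>j\<in>(UNIV::'n set). c)" using assms by (intro sum_mono) auto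
    finally show ?thesis by simp
  qed
  moreover have "norm A \<le> (\<Sum>i\<in>UNIV. norm (A $ i))" unfolding norm_vec_def by (rule L2_set_le_sum) auto
  ultimately show ?thesis using sum_mono[of UNIV "\<lambda>i. norm (A $ i)" "\<lambda>_. real CARD('n) * c"] by simp
qed

lemma norm_exp_congruence_le:
  fixes Q :: "real^'n^'n"
  assumes Q: "orthogonal_matrix Q" and m: "\<And>i. m i \<le> c"
  shows "norm (transpose Q ** diagm (\<lambda>i. exp (m i)) ** Q) \<le> real CARD('n) * (real CARD('n) * (real CARD('n) * exp c))"
proof (rule norm_matrix_le)
  fix i j
  have entry: "\<bar>Q $ k $ l\<bar> \<le> 1" for k l
  proof -
    have "norm (Q $ k) = 1" using Q by (simp add: orthogonal_matrix_orthonormal_rows row_def)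
    then show ?thesis using component_le_norm_cart[of "Q $ k" l] by simp
  qed
  have "(transpose Q ** diagm (\<lambda>i. exp (m i)) ** Q) $ i $ j
      = (\<Sum>k\<in>UNIV. (transpose Q ** diagm (\<lambda>i. exp (m i))) $ i $ k * Q $ k $ j)"
    by (simp only: matrix_matrix_mult_def[of "transpose Q ** _"] vec_lambda_beta)
  also have "\<dots> = (\<Sum>k\<in>UNIV. exp (m k) * (Q $ k $ i * Q $ k $ j))"
    by (simp add: transpose_def mult.assoc)
  also have "\<bar>\<dots>\<bar> \<le> (\<Sum>k\<in>UNIV. \<bar>exp (m k) * (Q $ k $ i * Q $ k $ j)\<bar>)" by (rule sum_abs)
  also have "\<dots> \<le> (\<Sum>k\<in>(UNIV::'n set). exp c * (1 * 1))"
    unfolding abs_mult using m entry by (intro sum_mono mult_mono) auto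
  finally show "\<bar>(transpose Q ** diagm (\<lambda>i. exp (m i)) ** Q) $ i $ j\<bar> \<le> real CARD('n) * exp c" by simp
qed

text \<open>The form in which positive definiteness with a fixed determinant is a closed condition.\<close>

lemma semidefinite_det_nonzero_in_PD:
  fixes P :: "real^'n^'n"
  assumes sym: "transpose P = P" and psd: "\<And>x. 0 \<le> x \<bullet> (P *v x)" and det: "det P \<noteq> 0"
  shows "P \<in> PD"
proof -
  obtain Q :: "real^'n^'n" and d where Q: "orthogonal_matrix Q" and P: "P = transpose Q ** diagm d ** Q"
    using symmetric_matrix_diagonalization[OF sym] by metis
  have "d i > 0" for i
  proof -
    have "Q *v (transpose Q *v axis i 1) = (Q ** transpose Q) *v axis i 1" by (rule matrix_vector_mul_assoc)
    then have Qx: "Q *v (transpose Q *v axis i 1) = axis i 1" using Q by (simp add: orthogonal_matrix_def)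
    define x where "x = transpose Q *v axis i 1"
    have "x \<bullet> (P *v x) = (Q *v x) \<bullet> (diagm d *v (Q *v x))"
      unfolding P using dot_matrix_vector_transpose[of x "transpose Q" "diagm d *v (Q *v x)"]
      by (simp add: matrix_vector_mul_assoc matrix_mul_assoc)
    also have "\<dots> = d i" unfolding x_def Qx by (simp add: inner_axis')
    finally have "d i \<ge> 0" using psd[of x] by simp
    moreover have "d i \<noteq> 0"
    proof
      assume "d i = 0"
      then have "prod d UNIV = 0" by (simp add: prod_zero_iff) blast
      then have "det P = 0" by (simp add: P det_mul)
      with det show False by simp
    qed
    ultimately show ?thesis by simp
  qed
  then show ?thesis unfolding P by (intro congruence_in_PD orthogonal_matrix_invertible Q diagm_in_PD)
qed

lemma PD_unit_det_spectral:
  fixes P :: "real^'n^'n"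
  assumes "P \<in> PD" "det P = 1"
  obtains Q :: "real^'n^'n" and m where "orthogonal_matrix Q" "P = transpose Q ** diagm (\<lambda>i. exp (m i)) ** Q" "(\<Sum>i\<in>UNIV. m i) = 0"
proof -
  obtain Q :: "real^'n^'n" and m where Q: "orthogonal_matrix Q" and P: "P = transpose Q ** diagm (\<lambda>i. exp (m i)) ** Q"
    using PD_spectral[OF assms(1)] by metis
  have "(det Q)\<^sup>2 = 1" using det_orthogonal_matrix[OF Q] by auto
  then have "exp (\<Sum>i\<in>UNIV. m i) = 1" using assms(2) unfolding P det_exp_congruence by simp
  then have "(\<Sum>i\<in>UNIV. m i) = 0" by simp
  with Q P show ?thesis by (rule that)
qed

lemma PD_normalize_det:
  fixes P :: "real^'n^'n"
  assumes "P \<in> PD"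
  obtains R s where "R \<in> PD" "det R = 1" "P = exp s *\<^sub>R R" "ln (det P) = real CARD('n) * s"
proof -
  obtain Q :: "real^'n^'n" and m where Q: "orthogonal_matrix Q" and P: "P = transpose Q ** diagm (\<lambda>i. exp (m i)) ** Q"
    using PD_spectral[OF assms] by metis
  define s where "s = (\<Sum>i\<in>UNIV. m i) / real CARD('n)"
  define R where "R = transpose Q ** diagm (\<lambda>i. exp (m i - s)) ** Q"
  have Q2: "(det Q)\<^sup>2 = 1" using det_orthogonal_matrix[OF Q] by auto
  have "R \<in> PD" unfolding R_def by (intro exp_congruence_in_PD orthogonal_matrix_invertible Q)
  moreover have "det R = 1" unfolding R_def det_exp_congruence Q2 by (simp add: sum_subtractf s_def)
  moreover have "P = exp s *\<^sub>R R"
  proof -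
    have "diagm (\<lambda>i. exp (m i)) = exp s *\<^sub>R (diagm (\<lambda>i. exp (m i - s)) :: real^'n^'n)"
      by (simp add: vec_eq_iff flip: exp_add)
    then show ?thesis unfolding P R_def by (simp add: matrix_mult_scaleR scaleR_matrix_mult)
  qed
  moreover have "ln (det P) = real CARD('n) * s" unfolding P det_exp_congruence Q2 by (simp add: s_def)
  ultimately show ?thesis by (rule that)
qed

lemma fit_term_scaleR:
  fixes Y :: "nat \<Rightarrow> real^'m2^'m1"
  shows "fit_term n Y (x *\<^sub>R P1) (y *\<^sub>R P2) = (x * y) * fit_term n Y P1 P2"
  by (simp add: fit_term_def trace_def matrix_matrix_mult_def sum_distrib_left sum_distrib_right mult_ac)

lemma PD_scaleR: "P \<in> PD \<Longrightarrow> c > 0 \<Longrightarrow> c *\<^sub>R P \<in> PD"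
  by (auto simp: PD_def transpose_def vec_eq_iff scaleR_matrix_vector_assoc[symmetric])

text \<open>With both determinants normalised to one, stability bounds the eigenvalues on sublevel sets of the fit term,
  which therefore attains a positive minimum. It remains to optimise over one scalar, and this is again
  the inequality \<open>exp x \<ge> 1 + x\<close>.\<close>

theorem stable_mle_exists:
  fixes Y :: "nat \<Rightarrow> real^'m2^'m1"
  assumes st: "stable_sample n Y" and n: "n > 0"
  shows "mle_exists n Y"
proof -
  obtain \<epsilon> where \<epsilon>: "\<epsilon> > 0" and heavy: "\<And>A B. orthogonal_matrix A \<Longrightarrow> orthogonal_matrix B \<Longrightarrow> heavy n Y \<epsilon> A B"
    using stable_sample_heavy[OF st] by metis
  have mass: "\<exists>a b. \<epsilon> \<le> frame_mass n Y A B a b" if "orthogonal_matrix A" "orthogonal_matrix B" for A B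
    using heavy[OF that] unfolding heavy_def by (elim allE[of _ UNIV] allE[of _ "{}"]) auto
  define F where "F = fit_term n Y"
  define F0 where "F0 = F (mat 1) (mat 1)"
  have term_le: "exp (m a + v b) * frame_mass n Y A B a b \<le> F (transpose A ** diagm (\<lambda>a. exp (m a)) ** A) (transpose B ** diagm (\<lambda>b. exp (v b)) ** B)"
    for A B m v a b
  proof -
    have "exp (m a + v b) * frame_mass n Y A B a b \<le> (\<Sum>b\<in>UNIV. exp (m a + v b) * frame_mass n Y A B a b)"
      by (rule member_le_sum) auto
    also have "\<dots> \<le> (\<Sum>a\<in>UNIV. \<Sum>b\<in>UNIV. exp (m a + v b) * frame_mass n Y A B a b)"
      by (rule member_le_sum[where f = "\<lambda>a. \<Sum>b\<in>UNIV. exp (m a + v b) * frame_mass n Y A B a b"]) (auto intro: sum_nonneg)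
    finally show ?thesis unfolding F_def fit_term_frame .
  qed
  have F_pos: "F P1 P2 > 0" if "P1 \<in> PD" "P2 \<in> PD" for P1 P2
  proof -
    obtain A :: "real^'m1^'m1" and m where A: "orthogonal_matrix A" "P1 = transpose A ** diagm (\<lambda>a. exp (m a)) ** A"
      using PD_spectral[OF \<open>P1 \<in> PD\<close>] by metis
    obtain B :: "real^'m2^'m2" and v where B: "orthogonal_matrix B" "P2 = transpose B ** diagm (\<lambda>b. exp (v b)) ** B"
      using PD_spectral[OF \<open>P2 \<in> PD\<close>] by metis
    obtain a b where ab: "\<epsilon> \<le> frame_mass n Y A B a b" using mass[OF A(1) B(1)] by blast
    have "0 < exp (m a + v b) * frame_mass n Y A B a b" using ab \<epsilon> by simp
    also have "\<dots> \<le> F P1 P2" unfolding A(2) B(2) by (rule term_le)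
    finally show ?thesis .
  qed
  have F0: "F0 > 0" unfolding F0_def by (intro F_pos) auto
  \<comment> \<open>A sublevel set at the value at the identity. Under \<open>det = 1\<close> semidefiniteness already means definiteness, so the set is closed.\<close>
  define S where "S = {(P1 :: real^'m1^'m1, P2 :: real^'m2^'m2).
    (transpose P1 = P1 \<and> (\<forall>x. 0 \<le> x \<bullet> (P1 *v x)) \<and> det P1 = 1) \<and>
    (transpose P2 = P2 \<and> (\<forall>x. 0 \<le> x \<bullet> (P2 *v x)) \<and> det P2 = 1) \<and> F P1 P2 \<le> F0}"
  have S_PD: "P1 \<in> PD" "P2 \<in> PD" "det P1 = 1" "det P2 = 1" "F P1 P2 \<le> F0" if "(P1, P2) \<in> S" for P1 P2
    using that by (auto simp: S_def intro!: semidefinite_det_nonzero_in_PD)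
  have PD_S: "(P1, P2) \<in> S" if "P1 \<in> PD" "P2 \<in> PD" "det P1 = 1" "det P2 = 1" "F P1 P2 \<le> F0" for P1 P2
  proof -
    have "0 \<le> x \<bullet> (P *v x)" if "P \<in> PD" for P :: "real^'m1^'m1" and x
      using PD_positive[OF that, of x] by (cases "x = 0") auto
    moreover have "0 \<le> x \<bullet> (P *v x)" if "P \<in> PD" for P :: "real^'m2^'m2" and x
      using PD_positive[OF that, of x] by (cases "x = 0") auto
    ultimately show ?thesis
      using that PD_symmetric[OF that(1)] PD_symmetric[OF that(2)] by (simp add: S_def)
  qed
  define R where "R = ln (F0 / \<epsilon>)"
  define c where "c = \<bar>R\<bar> + real CARD('m1) * real CARD('m2) * \<bar>R\<bar>"
  have "bounded S"
  proof -
    define b1 where "b1 = real CARD('m1) * (real CARD('m1) * (real CARD('m1) * exp c))"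
    define b2 where "b2 = real CARD('m2) * (real CARD('m2) * (real CARD('m2) * exp c))"
    have "norm x \<le> b1 + b2" if x: "x \<in> S" for x
    proof -
      obtain P1 P2 where x_eq: "x = (P1, P2)" by fastforce
      note P = S_PD[OF x[unfolded x_eq]]
      obtain A :: "real^'m1^'m1" and m where A: "orthogonal_matrix A" "P1 = transpose A ** diagm (\<lambda>a. exp (m a)) ** A"
        "(\<Sum>a\<in>UNIV. m a) = 0" using PD_unit_det_spectral[OF P(1,3)] by metis
      obtain B :: "real^'m2^'m2" and v where B: "orthogonal_matrix B" "P2 = transpose B ** diagm (\<lambda>b. exp (v b)) ** B"
        "(\<Sum>b\<in>UNIV. v b) = 0" using PD_unit_det_spectral[OF P(2,4)] by metis
      have le: "m a + v b \<le> R" if "\<epsilon> \<le> frame_mass n Y A B a b" for a b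
      proof -
        have "exp (m a + v b) * \<epsilon> \<le> exp (m a + v b) * frame_mass n Y A B a b" using that by simp
        also have "\<dots> \<le> F P1 P2" unfolding A(2) B(2) by (rule term_le)
        also have "\<dots> \<le> F0" by (rule P(5))
        finally have "exp (m a + v b) \<le> F0 / \<epsilon>" using \<epsilon> by (simp add: field_simps)
        then show ?thesis unfolding R_def using F0 \<epsilon> by (subst ln_ge_iff) auto
      qed
      have RR: "real CARD('m1) * real CARD('m2) * R \<le> real CARD('m1) * real CARD('m2) * \<bar>R\<bar>"
        by (intro mult_left_mono) auto
      have "m a \<le> c" "v b \<le> c" for a b
        using heavy_bound[OF heavy[OF A(1) B(1)] A(3) B(3) le] RR unfolding c_def
        by (smt (verit))+
      then have "norm P1 \<le> b1" "norm P2 \<le> b2"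
        unfolding A(2) B(2) b1_def b2_def using norm_exp_congruence_le[OF A(1)] norm_exp_congruence_le[OF B(1)] by auto
      then show ?thesis unfolding x_eq using norm_Pair_le[of P1 P2] by linarith
    qed
    then show ?thesis unfolding bounded_iff by blast
  qed
  moreover have "closed S"
  proof -
    have "S = {x. transpose (fst x) = fst x} \<inter> (\<Inter>y. {x. 0 \<le> y \<bullet> (fst x *v y)}) \<inter> {x. det (fst x) = 1}
        \<inter> {x. transpose (snd x) = snd x} \<inter> (\<Inter>y. {x. 0 \<le> y \<bullet> (snd x *v y)}) \<inter> {x. det (snd x) = 1}
        \<inter> {x. F (fst x) (snd x) \<le> F0}"
      by (auto simp: S_def)
    also have "closed \<dots>"
      unfolding F_def fit_term_def matrix_vector_mult_def
      by (intro closed_Int closed_INT ballI closed_Collect_eq closed_Collect_le continuous_intros)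
    finally show ?thesis .
  qed
  ultimately have "compact S" by (simp add: compact_eq_bounded_closed)
  moreover have I_S: "(mat 1, mat 1) \<in> S" by (intro PD_S) (auto simp: F0_def)
  moreover have "continuous_on S (\<lambda>x. F (fst x) (snd x))"
    unfolding F_def fit_term_def by (intro continuous_intros)
  ultimately obtain x where "x \<in> S" and "\<forall>y\<in>S. F (fst x) (snd x) \<le> F (fst y) (snd y)"
    using continuous_attains_inf[of S "\<lambda>x. F (fst x) (snd x)"] by blast
  then obtain M1 M2 where M: "(M1, M2) \<in> S" and min: "\<And>P1 P2. (P1, P2) \<in> S \<Longrightarrow> F M1 M2 \<le> F P1 P2"
    by (metis fst_conv snd_conv surj_pair)
  note MP = S_PD[OF M]
  have min': "F M1 M2 \<le> F P1 P2" if "P1 \<in> PD" "P2 \<in> PD" "det P1 = 1" "det P2 = 1" for P1 P2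
    using min PD_S[OF that] min[OF I_S] unfolding F0_def[symmetric] by fastforce
  define N where "N = real n * real CARD('m1) * real CARD('m2)"
  have N: "N > 0" using n by (simp add: N_def)
  have Fm: "F M1 M2 > 0" using F_pos MP by blast
  \<comment> \<open>The scalar \<open>t\<close> maximises \<open>N t - exp t * F M1 M2\<close>.\<close>
  define t where "t = ln (N / F M1 M2)"
  have et: "exp t * F M1 M2 = N" using N Fm by (simp add: t_def)
  have val: "loglik n Y (exp r *\<^sub>R P1, exp s *\<^sub>R P2) = N * (r + s) - exp (r + s) * F P1 P2"
    if "det P1 = 1" "det P2 = 1" for P1 P2 r s
  proof -
    have "det (exp r *\<^sub>R P1) = exp (real CARD('m1) * r)" "det (exp s *\<^sub>R P2) = exp (real CARD('m2) * s)"
      using that by (simp_all add: det_scaleR_matrix exp_of_nat_mult)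
    then show ?thesis
      by (simp add: loglik_eq F_def fit_term_scaleR exp_add N_def algebra_simps)
  qed
  have best: "loglik n Y (exp t *\<^sub>R M1, M2) = N * t - N"
    using val[OF MP(3,4), of t 0] et by simp
  have "loglik n Y Q \<le> loglik n Y (exp t *\<^sub>R M1, M2)" if Q: "Q \<in> PD \<times> PD" for Q
  proof -
    obtain Q1 Q2 where Q_eq: "Q = (Q1, Q2)" and QPD: "Q1 \<in> PD" "Q2 \<in> PD" using Q by auto
    obtain R1 r where R1: "R1 \<in> PD" "det R1 = 1" "Q1 = exp r *\<^sub>R R1" using PD_normalize_det[OF QPD(1)] by metis
    obtain R2 s where R2: "R2 \<in> PD" "det R2 = 1" "Q2 = exp s *\<^sub>R R2" using PD_normalize_det[OF QPD(2)] by metis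
    have "N * (1 + (r + s - t)) \<le> N * exp (r + s - t)"
      using N exp_ge_add_one_self[of "r + s - t"] by (intro mult_left_mono) auto
    also have "\<dots> = exp (r + s) * F M1 M2"
    proof -
      have "exp (r + s) = exp t * exp (r + s - t)" by (simp flip: exp_add)
      then show ?thesis using et by (simp add: mult_ac)
    qed
    also have "\<dots> \<le> exp (r + s) * F R1 R2" using min' R1 R2 by simp
    finally show ?thesis unfolding best Q_eq R1(3) R2(3) val[OF R1(2) R2(2)] by (simp add: algebra_simps)
  qed
  then show ?thesis unfolding mle_exists_def
    using MP by (intro bexI[of _ "(exp t *\<^sub>R M1, M2)"]) (auto intro: PD_scaleR)
qed

section \<open>Unbounded samples\<close>

text \<open>The rows of \<open>A\<close> form a basis of the whole space that extends a basis of \<open>S\<close>.\<close>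

lemma subspace_frame:
  fixes S :: "(real^'n) set"
  assumes "subspace S"
  obtains A :: "real^'n^'n" and J where "invertible A" "card J = dim S" "\<And>j. j \<in> J \<Longrightarrow> A $ j \<in> S"
proof -
  obtain B0 where B0: "B0 \<subseteq> S" "independent B0" "card B0 = dim S" using basis_exists[of S] by metis
  obtain B where B: "B0 \<subseteq> B" "independent B" "UNIV \<subseteq> span B"
    using maximal_independent_subset_extend[OF subset_UNIV B0(2)] by metis
  have "finite B" "card B = CARD('n)"
    using B(2,3) independent_bound[of B] dim_eq_card[of B UNIV] by (auto simp: top.extremum_unique)
  then obtain f where f: "bij_betw f (UNIV::'n set) B"
    using finite_same_card_bij[of "UNIV::'n set" B] by auto
  define A :: "real^'n^'n" where "A = (\<chi> i. f i)"
  have "rows A = B" using f by (auto simp: rows_def row_def A_def bij_betw_def)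
  then have "\<exists>A'. A' ** A = mat 1" using B(3) matrix_left_invertible_span_rows[of A] by auto
  then have "invertible A" by (simp add: invertible_left_inverse)
  moreover have "card (f -` B0) = dim S"
  proof -
    have "bij_betw f (f -` B0) B0"
      using f B(1) unfolding bij_betw_def by (auto simp: inj_on_def image_vimage_eq)
    then show ?thesis using B0(3) bij_betw_same_card by metis
  qed
  moreover have "A $ j \<in> S" if "j \<in> f -` B0" for j using that B0(1) by (auto simp: A_def)
  ultimately show ?thesis using that by blast
qed

lemma frame_entry:
  fixes A :: "real^'m1^'m1" and B :: "real^'m2^'m2" and Y :: "real^'m2^'m1"
  shows "(A ** Y ** transpose B) $ a $ b = (transpose Y *v (A $ a)) \<bullet> (B $ b)"
proof -
  have "(A ** Y ** transpose B) $ a $ b = (A ** (Y ** transpose B)) $ a $ b" by (simp only: matrix_mul_assoc)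
  also have "\<dots> = (A $ a) \<bullet> (Y *v (B $ b))"
    by (simp add: matrix_matrix_mult_def inner_vec_def matrix_vector_mult_def transpose_def)
  finally show ?thesis by (simp only: dot_matrix_vector_transpose)
qed

text \<open>Enlarge \<open>P\<^sub>1\<close> along \<open>W\<close> by \<open>exp t\<close> and shrink \<open>P\<^sub>2\<close> by the same factor, except on the orthogonal complement of \<open>V\<close>. No mass
  lies where only the first of these acts, so the fit term stays bounded, while the dimension condition makes the
  log-determinants grow linearly in \<open>t\<close>.\<close>

lemma unbounded_if_destabilised:
  fixes Y :: "nat \<Rightarrow> real^'m2^'m1"
  assumes W: "subspace W" and V: "subspace V"
    and WV: "\<And>i w. i < n \<Longrightarrow> w \<in> W \<Longrightarrow> transpose (Y i) *v w \<in> V"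
    and dim: "dim V * CARD('m1) < dim W * CARD('m2)" and n: "n > 0"
  shows "\<not> loglik_bounded n Y"
proof
  assume "loglik_bounded n Y"
  then obtain M where M: "\<And>P1 P2. P1 \<in> PD \<Longrightarrow> P2 \<in> PD \<Longrightarrow> loglik n Y (P1, P2) \<le> M"
    unfolding loglik_bounded_def bdd_above_def by blast
  define V' where "V' = {y. \<forall>x\<in>V. orthogonal x y}"
  have V': "subspace V'" unfolding V'_def by (rule subspace_orthogonal_to_vectors)
  have dV': "dim V' + dim V = CARD('m2)"
    using dim_subspace_orthogonal_to_vectors[OF V subspace_UNIV] by (simp add: V'_def)
  obtain A :: "real^'m1^'m1" and I where A: "invertible A" "card I = dim W" "\<And>a. a \<in> I \<Longrightarrow> A $ a \<in> W"
    using subspace_frame[OF W] by metis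
  obtain B :: "real^'m2^'m2" and J where B: "invertible B" "card J = dim V'" "\<And>b. b \<in> J \<Longrightarrow> B $ b \<in> V'"
    using subspace_frame[OF V'] by metis
  have zero: "frame_mass n Y A B a b = 0" if "a \<in> I" "b \<in> J" for a b
    using WV A(3)[OF that(1)] B(3)[OF that(2)]
    by (auto simp: frame_mass_eq_0_iff frame_entry V'_def orthogonal_def)
  define C where "C = (\<Sum>a\<in>UNIV. \<Sum>b\<in>UNIV. frame_mass n Y A B a b)"
  define K where "K = real n * real CARD('m2) * ln ((det A)\<^sup>2) + real n * real CARD('m1) * ln ((det B)\<^sup>2)"
  define g where "g = real n * (real CARD('m2) * real (dim W) - real CARD('m1) * real (dim V))"
  have "real (dim V * CARD('m1)) < real (dim W * CARD('m2))" using dim by (simp only: of_nat_less_iff)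
  then have g: "g > 0" unfolding g_def using n by (simp add: mult.commute)
  have lower: "t * g + K - C \<le> M" if t: "t \<ge> 0" for t
  proof -
    define m where "m = (\<lambda>a. if a \<in> I then t else 0)"
    define v where "v = (\<lambda>b. if b \<in> J then 0 else - t)"
    have "(\<Sum>a\<in>UNIV. \<Sum>b\<in>UNIV. exp (m a + v b) * frame_mass n Y A B a b) \<le> C"
      unfolding C_def
    proof (intro sum_mono)
      fix a b
      show "exp (m a + v b) * frame_mass n Y A B a b \<le> frame_mass n Y A B a b"
      proof (cases "a \<in> I \<and> b \<in> J")
        case True then show ?thesis using zero by simp
      next
        case False
        then have "m a + v b \<le> 0" using t by (auto simp: m_def v_def)
        then have "exp (m a + v b) \<le> 1" by simp
        then show ?thesis by (intro mult_left_le_one_le) auto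
      qed
    qed
    moreover have "(\<Sum>a\<in>UNIV. m a) = real (dim W) * t"
      unfolding m_def A(2)[symmetric] by (simp add: sum.If_cases)
    moreover have "(\<Sum>b\<in>UNIV. v b) = - (real (dim V) * t)"
    proof -
      have "card (- J) = dim V" using dV' B(2) by (simp add: Compl_eq_Diff_UNIV card_Diff_subset)
      then show ?thesis unfolding v_def by (simp add: sum.If_cases)
    qed
    moreover have "loglik n Y (transpose A ** diagm (\<lambda>a. exp (m a)) ** A, transpose B ** diagm (\<lambda>b. exp (v b)) ** B) \<le> M"
      by (intro M exp_congruence_in_PD A B)
    ultimately show ?thesis
      unfolding loglik_frame[OF A(1) B(1)] by (simp add: K_def g_def algebra_simps)
  qed
  define t where "t = (\<bar>M\<bar> + \<bar>C\<bar> + \<bar>K\<bar> + 1) / g"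
  have "t * g = \<bar>M\<bar> + \<bar>C\<bar> + \<bar>K\<bar> + 1" using g by (simp add: t_def)
  moreover have "t \<ge> 0" using g by (simp add: t_def)
  ultimately show False using lower[of t] by linarith
qed

section \<open>Kernel chains of a matrix pencil\<close>

lemma linear_inj_on_span:
  assumes T: "linear T" and C: "subspace C" and ker: "\<And>x. x \<in> C \<Longrightarrow> T x = 0 \<Longrightarrow> x = 0"
  shows "inj_on T (span C)"
  unfolding span_eq_iff[THEN iffD2, OF C]
proof (rule inj_onI)
  fix x y assume "x \<in> C" "y \<in> C" "T x = T y"
  then have "x - y \<in> C" "T (x - y) = 0" using C T by (auto simp: subspace_diff linear_diff)
  then show "x = y" using ker[of "x - y"] by simp
qed

lemma rank_nullity_on_subspace:
  fixes T :: "'a::euclidean_space \<Rightarrow> 'b::euclidean_space"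
  assumes T: "linear T" and W: "subspace W"
  shows "dim {x\<in>W. T x = 0} + dim (T ` W) = dim W"
proof -
  define K where "K = {x\<in>W. T x = 0}"
  define C where "C = {y\<in>W. \<forall>x\<in>K. orthogonal x y}"
  have K: "subspace K" unfolding K_def using W linear_subspace_kernel[OF T]
    by (simp add: Collect_conj_eq subspace_inter)
  have KW: "K \<subseteq> W" by (auto simp: K_def)
  have C: "subspace C" unfolding C_def using W subspace_orthogonal_to_vectors[of K]
    by (simp add: Collect_conj_eq subspace_inter)
  have dC: "dim C + dim K = dim W" unfolding C_def by (rule dim_subspace_orthogonal_to_vectors[OF K W KW])
  have "inj_on T (span C)"
  proof (rule linear_inj_on_span[OF T C])
    fix x assume "x \<in> C" "T x = 0"
    then have "orthogonal x x" by (auto simp: C_def K_def)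
    then show "x = 0" by (simp add: orthogonal_def)
  qed
  then have "dim (T ` C) = dim C" by (rule dim_image_eq[OF T])
  moreover have "T ` W = T ` C"
  proof
    show "T ` C \<subseteq> T ` W" by (auto simp: C_def)
    show "T ` W \<subseteq> T ` C"
    proof
      fix y assume "y \<in> T ` W"
      then obtain w where w: "w \<in> W" "y = T w" by blast
      obtain k c where kc: "k \<in> span K" "\<And>z. z \<in> span K \<Longrightarrow> orthogonal c z" "w = k + c"
        using orthogonal_subspace_decomp_exists[of K w] by blast
      have kK: "k \<in> K" using kc(1) K by (simp add: span_eq_iff[THEN iffD2])
      then have "c \<in> W" using w kc(3) KW W by (metis add_diff_cancel_left' subset_iff subspace_diff)
      then have "c \<in> C" using kc(2) by (auto simp: C_def orthogonal_commute span_base)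
      moreover have "y = T c" using w kc(3) kK T by (simp add: K_def linear_add)
      ultimately show "y \<in> T ` C" by blast
    qed
  qed
  ultimately show ?thesis using dC by (simp add: K_def)
qed

lemma dim_vimage_on_subspace:
  fixes T :: "'a::euclidean_space \<Rightarrow> 'b::euclidean_space"
  assumes T: "linear T" and W: "subspace W" and V: "subspace V" "T ` W \<subseteq> V" and S: "subspace S" "S \<subseteq> V"
  shows "dim S + dim W \<le> dim {x\<in>W. T x \<in> S} + dim V"
proof -
  define P where "P = {x\<in>W. T x \<in> S}"
  have P: "subspace P" unfolding P_def using W S(1) linear_subspace_vimage[OF T S(1)]
    by (simp add: Collect_conj_eq subspace_inter vimage_def)
  have TW: "subspace (T ` W)" using T W by (rule linear_subspace_image)
  have "{x\<in>P. T x = 0} = {x\<in>W. T x = 0}" using subspace_0[OF S(1)] by (auto simp: P_def)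
  then have 1: "dim {x\<in>W. T x = 0} + dim (T ` P) = dim P"
    using rank_nullity_on_subspace[OF T P] by simp
  have 2: "T ` P = S \<inter> T ` W" by (auto simp: P_def)
  have 3: "dim {x + y |x y. x \<in> S \<and> y \<in> T ` W} + dim (S \<inter> T ` W) = dim S + dim (T ` W)"
    by (rule dim_sums_Int[OF S(1) TW])
  have "{x + y |x y. x \<in> S \<and> y \<in> T ` W} \<subseteq> V" using S V subspace_add by blast
  then have 4: "dim {x + y |x y. x \<in> S \<and> y \<in> T ` W} \<le> dim V" by (rule dim_subset)
  show ?thesis using 1 2 3 4 rank_nullity_on_subspace[OF T W] by (simp add: P_def)
qed

text \<open>The elements of \<open>kernel_chain T1 T2 W j\<close> are the leading coefficients \<open>p\<^sub>j\<close> of the polynomials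
  \<open>p(t) = p\<^sub>0 + p\<^sub>1 t + \<dots> + p\<^sub>j t\<^sup>j\<close> over \<open>W\<close> for which \<open>(T1 - t T2) p(t)\<close> has no terms of degree at most \<open>j\<close>.\<close>

primrec kernel_chain :: "('a \<Rightarrow> 'b::zero) \<Rightarrow> ('a \<Rightarrow> 'b) \<Rightarrow> 'a set \<Rightarrow> nat \<Rightarrow> 'a set" where
  "kernel_chain T1 T2 W 0 = {x\<in>W. T1 x = 0}"
| "kernel_chain T1 T2 W (Suc j) = {x\<in>W. T1 x \<in> T2 ` kernel_chain T1 T2 W j}"

lemma kernel_chain_subset: "kernel_chain T1 T2 W j \<subseteq> W"
  by (cases j) auto

lemma kernel_chain_mono: "W \<subseteq> W' \<Longrightarrow> kernel_chain T1 T2 W j \<subseteq> kernel_chain T1 T2 W' j"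
  by (induction j) auto

lemma kernel_chain_subspace:
  fixes T1 T2 :: "'a::euclidean_space \<Rightarrow> 'b::euclidean_space"
  assumes T1: "linear T1" and T2: "linear T2" and W: "subspace W"
  shows "subspace (kernel_chain T1 T2 W j)"
proof (induction j)
  case 0
  show ?case using W linear_subspace_kernel[OF T1] by (simp add: Collect_conj_eq subspace_inter)
next
  case (Suc j)
  have "subspace (T2 ` kernel_chain T1 T2 W j)" by (rule linear_subspace_image[OF T2 Suc])
  then show ?case using W linear_subspace_vimage[OF T1]
    by (simp add: Collect_conj_eq subspace_inter vimage_def)
qed

text \<open>Taking preimages under \<open>T1\<close> within \<open>W\<close> raises the dimension of a subspace of \<open>V\<close> by at least \<open>k\<close>, and \<open>T2\<close>
  preserves dimensions as long as it is injective on the chain.\<close>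

lemma kernel_chain_dim:
  fixes T1 T2 :: "'a::euclidean_space \<Rightarrow> 'b::euclidean_space"
  assumes T1: "linear T1" and T2: "linear T2" and W: "subspace W" and V: "subspace V"
    and TV: "T1 ` W \<subseteq> V" "T2 ` W \<subseteq> V" and k: "dim V + k \<le> dim W"
    and inj: "\<And>i x. i < j \<Longrightarrow> x \<in> kernel_chain T1 T2 W i \<Longrightarrow> T2 x = 0 \<Longrightarrow> x = 0"
  shows "(j + 1) * k \<le> dim (kernel_chain T1 T2 W j)"
  using inj
proof (induction j)
  case 0
  show ?case using dim_vimage_on_subspace[OF T1 W V TV(1), of "{0}"] k subspace_0[OF V] by simp
next
  case (Suc j)
  define C where "C = kernel_chain T1 T2 W j"
  have C: "subspace C" "C \<subseteq> W" unfolding C_def by (intro kernel_chain_subspace T1 T2 W kernel_chain_subset)+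
  have IH: "(j + 1) * k \<le> dim C" unfolding C_def
    by (rule Suc.IH) (use Suc.prems less_SucI in blast)
  have "inj_on T2 (span C)"
    by (rule linear_inj_on_span[OF T2 C(1)]) (use Suc.prems[of j] in \<open>auto simp: C_def\<close>)
  then have "dim (T2 ` C) = dim C" by (rule dim_image_eq[OF T2])
  moreover have "dim (T2 ` C) + dim W \<le> dim (kernel_chain T1 T2 W (Suc j)) + dim V"
    using dim_vimage_on_subspace[OF T1 W V TV(1), of "T2 ` C"] C TV(2) linear_subspace_image[OF T2 C(1)]
    by (auto simp: C_def)
  ultimately show ?case using IH k by simp
qed

lemma kernel_chain_coefficients:
  assumes "x \<in> kernel_chain T1 T2 W j"
  shows "\<exists>p. p j = x \<and> T1 (p 0) = 0 \<and> (\<forall>i<j. T1 (p (Suc i)) = T2 (p i)) \<and> (\<forall>i\<le>j. p i \<in> W)"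
  using assms
proof (induction j arbitrary: x)
  case 0
  then show ?case by (auto intro: exI[of _ "\<lambda>_. x"])
next
  case (Suc j)
  then obtain y where x: "x \<in> W" and y: "y \<in> kernel_chain T1 T2 W j" "T1 x = T2 y" by auto
  obtain p where p: "p j = y" "T1 (p 0) = 0" "\<forall>i<j. T1 (p (Suc i)) = T2 (p i)" "\<forall>i\<le>j. p i \<in> W"
    using Suc.IH[OF y(1)] by blast
  show ?case
    by (rule exI[of _ "p(Suc j := x)"]) (use x y p in \<open>auto simp: less_Suc_eq le_Suc_eq\<close>)
qed

text \<open>If moreover \<open>T2 p\<^sub>j = 0\<close>, the pencil annihilates \<open>p(t)\<close>. On the span of the coefficients the images of both maps
  then lie in that of \<open>T2\<close>, which has a kernel there.\<close>

lemma closed_kernel_chain: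
  fixes T1 T2 :: "'a::euclidean_space \<Rightarrow> 'b::euclidean_space"
  assumes T1: "linear T1" and T2: "linear T2" and x: "x \<in> kernel_chain T1 T2 UNIV j" "T2 x = 0" "x \<noteq> 0"
  obtains W where "subspace W" "dim W \<le> j + 1" "dim (T2 ` W) < dim W" "T1 ` W \<subseteq> T2 ` W"
proof -
  obtain p where p: "p j = x" "T1 (p 0) = 0" "\<forall>i<j. T1 (p (Suc i)) = T2 (p i)"
    using kernel_chain_coefficients[OF x(1)] by blast
  define W where "W = span (p ` {..j})"
  have W: "subspace W" by (simp add: W_def)
  have pW: "p i \<in> W" if "i \<le> j" for i using that by (auto simp: W_def span_base)
  have "dim W \<le> card (p ` {..j})" unfolding W_def by (simp add: dim_le_card')
  also have "\<dots> \<le> j + 1" using card_image_le[of "{..j}" p] by simp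
  finally have dW: "dim W \<le> j + 1" .
  have "dim {y\<in>W. T2 y = 0} \<noteq> 0"
    using x pW[of j] p(1) by (auto simp: dim_eq_0)
  then have lt: "dim (T2 ` W) < dim W" using rank_nullity_on_subspace[OF T2 W] by linarith
  have TW: "subspace (T2 ` W)" by (rule linear_subspace_image[OF T2 W])
  have "T1 ` p ` {..j} \<subseteq> T2 ` W"
  proof
    fix y assume "y \<in> T1 ` p ` {..j}"
    then obtain i where i: "i \<le> j" "y = T1 (p i)" by auto
    show "y \<in> T2 ` W"
    proof (cases i)
      case 0 then show ?thesis using i p(2) subspace_0[OF TW] by simp
    next
      case (Suc i') then show ?thesis using i p(3) pW[of i'] by auto
    qed
  qed
  then have "span (T1 ` p ` {..j}) \<subseteq> T2 ` W" by (intro span_minimal TW)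
  then have "T1 ` W \<subseteq> T2 ` W" by (simp add: W_def linear_span_image[OF T1])
  with W dW lt show ?thesis by (rule that)
qed

lemma linear_transpose_mult: "linear ((*v) (transpose (A::real^'m2^'m1)))"
  by simp

text \<open>By the count of dimensions \<open>T2\<close> cannot stay injective for \<open>m2 div k + 1\<close> steps. The chain that closes spans
  a subspace of dimension at most \<open>m2 div k + 1\<close>, small enough to destabilise as \<open>k\<close> does not divide \<open>m2\<close>.\<close>

theorem two_samples_unbounded:
  fixes Y :: "nat \<Rightarrow> real^'m2^'m1"
  assumes lt: "CARD('m2) < CARD('m1)" and ndvd: "\<not> (CARD('m1) - CARD('m2)) dvd CARD('m2)"
  shows "\<not> loglik_bounded 2 Y"
proof -
  define k where "k = CARD('m1) - CARD('m2)"
  define q where "q = CARD('m2) div k"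
  have k: "k > 0" using lt by (simp add: k_def)
  have "CARD('m2) mod k > 0" using ndvd by (simp add: k_def dvd_eq_mod_eq_0)
  then have q: "q * k < CARD('m2)" "CARD('m2) < (q + 1) * k"
    using div_mult_mod_eq[of "CARD('m2)" k] mod_less_divisor[OF k, of "CARD('m2)"] unfolding q_def
    by (simp_all only: distrib_right mult_1)
  define T1 where "T1 = (\<lambda>x. transpose (Y 0) *v x)"
  define T2 where "T2 = (\<lambda>x. transpose (Y 1) *v x)"
  have T: "linear T1" "linear T2" unfolding T1_def T2_def by (rule linear_transpose_mult)+
  have "\<exists>j\<le>q. \<exists>x\<in>kernel_chain T1 T2 UNIV j. T2 x = 0 \<and> x \<noteq> 0"
  proof (rule ccontr)
    assume "\<not> ?thesis"
    then have inj: "\<And>i x. i \<le> q \<Longrightarrow> x \<in> kernel_chain T1 T2 UNIV i \<Longrightarrow> T2 x = 0 \<Longrightarrow> x = 0" by blast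
    define C where "C = kernel_chain T1 T2 UNIV q"
    have C: "subspace C" unfolding C_def by (intro kernel_chain_subspace T subspace_UNIV)
    have "(q + 1) * k \<le> dim C" unfolding C_def
    proof (rule kernel_chain_dim[OF T subspace_UNIV subspace_UNIV])
      fix i x assume "i < q" "x \<in> kernel_chain T1 T2 UNIV i" "T2 x = 0"
      then show "x = 0" using inj[of i x] by simp
    qed (use lt in \<open>auto simp: k_def\<close>)
    moreover have "inj_on T2 (span C)"
      by (rule linear_inj_on_span[OF T(2) C]) (use inj[of q] in \<open>auto simp: C_def\<close>)
    then have "dim C = dim (T2 ` C)" using dim_image_eq[OF T(2)] by metis
    then have "dim C \<le> CARD('m2)" using dim_subset_UNIV[of "T2 ` C"] by simp
    ultimately show False using q by linarith
  qed
  then obtain j x where j: "j \<le> q" and x: "x \<in> kernel_chain T1 T2 UNIV j" "T2 x = 0" "x \<noteq> 0" by blast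
  obtain W where W: "subspace W" "dim W \<le> j + 1" "dim (T2 ` W) < dim W" "T1 ` W \<subseteq> T2 ` W"
    using closed_kernel_chain[OF T x] by blast
  have "dim W * k \<le> (q + 1) * k" using W(2) j by (intro mult_le_mono1) linarith
  also have "\<dots> < CARD('m1)" using q(1) lt by (simp add: k_def)
  finally have wk: "dim W * k < CARD('m1)" .
  have "dim (T2 ` W) * CARD('m1) < dim W * CARD('m2)"
  proof -
    have m1: "CARD('m1) = CARD('m2) + k" using lt by (simp add: k_def)
    have "(dim (T2 ` W) + 1) * CARD('m1) \<le> dim W * CARD('m1)" using W(3) by (intro mult_le_mono1) linarith
    also have "\<dots> = dim W * CARD('m2) + dim W * k" by (simp add: m1 algebra_simps)
    finally show ?thesis using wk by simp
  qed
  then show ?thesis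
  proof (rule unbounded_if_destabilised[OF W(1), rotated 2])
    show "subspace (T2 ` W)" by (rule linear_subspace_image[OF T(2) W(1)])
    fix i :: nat and w assume "i < 2" "w \<in> W"
    then show "transpose (Y i) *v w \<in> T2 ` W"
      using W(4) by (auto simp: T1_def T2_def less_2_cases_iff image_subset_iff)
  qed simp
qed

lemma one_sample_unbounded:
  fixes Y :: "nat \<Rightarrow> real^'m2^'m1"
  assumes lt: "CARD('m2) < CARD('m1)"
  shows "\<not> loglik_bounded 1 Y"
proof -
  define W where "W = {x \<in> UNIV. transpose (Y 0) *v x = 0}"
  have "dim W + dim ((*v) (transpose (Y 0)) ` UNIV) = CARD('m1)"
    unfolding W_def using rank_nullity_on_subspace[OF linear_transpose_mult[of "Y 0"] subspace_UNIV] by simp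
  moreover have "dim ((*v) (transpose (Y 0)) ` UNIV) \<le> CARD('m2)" using dim_subset_UNIV[of "(*v) (transpose (Y 0)) ` UNIV"] by simp
  ultimately have "dim W > 0" using lt by linarith
  moreover have "subspace W" unfolding W_def using linear_subspace_kernel[OF linear_transpose_mult[of "Y 0"]] by simp
  ultimately show ?thesis
    by (intro unbounded_if_destabilised[of W "{0}"]) (auto simp: W_def)
qed

section \<open>Generic samples have no small invariant subspaces\<close>

lemma nilpotent_shear_inverse:
  fixes N :: "real^'n^'n"
  assumes N: "\<forall>d b. N $ d $ b \<noteq> 0 \<longrightarrow> d \<notin> J \<and> b \<in> J"
  shows "(mat 1 + N) ** (mat 1 - N) = mat 1" "(mat 1 - N) ** (mat 1 + N) = mat 1"
proof -
  have NN: "N ** N = 0"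
  proof -
    have z: "N $ i $ k * N $ k $ j = 0" for i j k using N by (cases "N $ i $ k = 0") auto
    have "(N ** N) $ i $ j = 0" for i j
      unfolding matrix_matrix_mult_def vec_lambda_beta by (intro sum.neutral ballI z)
    then show ?thesis by (simp add: vec_eq_iff)
  qed
  show 1: "(mat 1 + N) ** (mat 1 - N) = mat 1"
    by (simp only: matrix_diff_ldistrib matrix_add_rdistrib matrix_mul_lid matrix_mul_rid NN) simp
  then show "(mat 1 - N) ** (mat 1 + N) = mat 1" by (simp add: matrix_left_right_inverse)
qed

text \<open>Every subspace is the graph of a linear map from some coordinate subspace to the complementary one. These
  are the standard charts of the Grassmannian.\<close>

lemma subspace_graph:
  fixes U :: "(real^'n) set"
  assumes U: "subspace U"
  obtains J and N :: "real^'n^'n" where "card J = dim U" "\<forall>d b. N $ d $ b \<noteq> 0 \<longrightarrow> d \<notin> J \<and> b \<in> J"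
    "U = (*v) (mat 1 + N) ` {x. \<forall>i. i \<notin> J \<longrightarrow> x $ i = 0}"
proof -
  obtain B0 where B0: "B0 \<subseteq> U" "independent B0" "U \<subseteq> span B0" "card B0 = dim U"
    using basis_exists[of U] by metis
  define E where "E = range (\<lambda>d. axis d (1::real) :: real^'n)"
  have spanE: "span E = UNIV"
  proof -
    have "E = Basis" by (auto simp: E_def Basis_vec_def)
    then show ?thesis by simp
  qed
  obtain B where B: "B0 \<subseteq> B" "B \<subseteq> B0 \<union> E" "independent B" "B0 \<union> E \<subseteq> span B"
    using maximal_independent_subset_extend[OF _ B0(2), of "B0 \<union> E"] by auto
  have spanB: "span B = UNIV"
  proof -
    have "span E \<subseteq> span B" using B(4) by (intro span_minimal) auto
    then show ?thesis using spanE by auto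
  qed
  have finB: "finite B" using B(3) independent_bound by blast
  have cardB: "card B = CARD('n)" using B(3) spanB dim_eq_card[of B UNIV] by simp
  define K where "K = {d. axis d (1::real) \<in> B - B0}"
  have BK: "B - B0 = (\<lambda>d. axis d (1::real)) ` K" using B(2) by (auto simp: K_def E_def)
  have "card (B - B0) = card K" unfolding BK
    by (intro card_image) (auto simp: inj_on_def axis_eq_axis)
  then have cardK: "card K + dim U = CARD('n)"
    using cardB B(1) B0(4) finB by (metis card_Diff_subset card_mono finite_subset le_add_diff_inverse2)
  define J where "J = - K"
  have cardJ: "card J = dim U"
    using cardK by (simp add: J_def Compl_eq_Diff_UNIV card_Diff_subset)
  have dec: "\<exists>u k. u \<in> U \<and> (\<forall>d. d \<notin> K \<longrightarrow> k $ d = 0) \<and> x = u + k" for x :: "real^'n"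
  proof -
    have "x \<in> span (B0 \<union> (B - B0))" using spanB B(1) by (simp add: Un_absorb1)
    then obtain u k where uk: "x = u + k" "u \<in> span B0" "k \<in> span (B - B0)"
      unfolding span_Un by auto
    have "span (B - B0) \<subseteq> {y. \<forall>d. d \<notin> K \<longrightarrow> y $ d = 0}"
      unfolding BK by (intro span_minimal) (auto simp: subspace_def axis_def)
    moreover have "u \<in> U" using uk(2) B0(1) U span_minimal by blast
    ultimately show ?thesis using uk by blast
  qed
  define kk where "kk = (\<lambda>b. SOME k. (\<forall>d. d \<notin> K \<longrightarrow> k $ d = 0) \<and> axis b (1::real) - k \<in> U)"
  have kk: "(\<forall>d. d \<notin> K \<longrightarrow> kk b $ d = 0) \<and> axis b (1::real) - kk b \<in> U" for b
    unfolding kk_def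
  proof (rule someI_ex)
    obtain u k where "u \<in> U" "\<forall>d. d \<notin> K \<longrightarrow> k $ d = 0" "axis b (1::real) = u + k" using dec by blast
    then show "\<exists>k. (\<forall>d. d \<notin> K \<longrightarrow> k $ d = 0) \<and> axis b (1::real) - k \<in> U"
      by (intro exI[of _ k]) auto
  qed
  define N :: "real^'n^'n" where "N = (\<chi> d b. if b \<in> J then - (kk b $ d) else 0)"
  have Nsupp: "\<forall>d b. N $ d $ b \<noteq> 0 \<longrightarrow> d \<notin> J \<and> b \<in> J"
    using kk by (auto simp: N_def J_def split: if_splits)
  define C where "C = {x::real^'n. \<forall>i. i \<notin> J \<longrightarrow> x $ i = 0}"
  have col: "(mat 1 + N) *v axis b 1 = axis b 1 - kk b" if "b \<in> J" for b
  proof -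
    have "N *v axis b 1 = - kk b" using that
      by (simp add: matrix_vector_mult_basis column_def N_def vec_eq_iff)
    then show ?thesis by (simp add: matrix_vector_mult_add_rdistrib)
  qed
  have inv: "invertible (mat 1 + N)"
    using nilpotent_shear_inverse[OF Nsupp] unfolding invertible_def by blast
  have sub: "(*v) (mat 1 + N) ` C \<subseteq> U"
  proof
    fix y assume "y \<in> (*v) (mat 1 + N) ` C"
    then obtain x where x: "x \<in> C" "y = (mat 1 + N) *v x" by blast
    have "x = (\<Sum>b\<in>UNIV. x $ b *\<^sub>R axis b 1)"
      using basis_expansion[of x] by (simp add: scalar_mult_eq_scaleR)
    then have "y = (\<Sum>b\<in>UNIV. x $ b *\<^sub>R ((mat 1 + N) *v axis b 1))"
      unfolding x(2) by (metis (no_types, lifting) linear_scale linear_sum matrix_vector_mul_linear sum.cong)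
    also have "\<dots> \<in> U"
    proof (intro subspace_sum[OF U])
      fix b
      show "x $ b *\<^sub>R ((mat 1 + N) *v axis b 1) \<in> U"
      proof (cases "b \<in> J")
        case True then show ?thesis using col[OF True] kk[of b] U by (simp add: subspace_scale)
      next
        case False then show ?thesis using x(1) subspace_0[OF U] by (simp add: C_def)
      qed
    qed
    finally show "y \<in> U" .
  qed
  have dimC: "dim C = card J" unfolding C_def by (rule dim_coordinate_subspace)
  have "inj ((*v) (mat 1 + N))" using inv by (simp add: inj_matrix_vector_mult)
  then have "dim ((*v) (mat 1 + N) ` C) = dim C" by (intro dim_image_eq) (auto intro: inj_on_subset)
  moreover have "subspace ((*v) (mat 1 + N) ` C)"
    by (intro linear_subspace_image) (auto simp: C_def subspace_def)
  ultimately have img: "(*v) (mat 1 + N) ` C = U"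
    using subspace_dim_equal[OF _ U sub] dimC cardJ by simp
  show ?thesis by (rule that[OF cardJ Nsupp img[symmetric, unfolded C_def]])
qed

text \<open>The set is the image of a coordinate hyperplane under a polynomial map of the space to itself. By the
  inequality the entries of \<open>N1\<close> and \<open>N2\<close> can be stored in the entries of the zero block, with at least one entry left over.\<close>

lemma negligible_zero_block:
  fixes I :: "'m1::finite set" and J :: "'m2::finite set"
  assumes count: "card I * card (- I) + card J * card (- J) < CARD('n::finite) * card (- I) * card J"
  shows "negligible {y :: real^'m2^'m1^'n. \<exists>(N1::real^'m1^'m1) (N2::real^'m2^'m2) z.
      (\<forall>a c. N1 $ a $ c \<noteq> 0 \<longrightarrow> a \<notin> I \<and> c \<in> I) \<and> (\<forall>d b. N2 $ d $ b \<noteq> 0 \<longrightarrow> d \<notin> J \<and> b \<in> J) \<and>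
      (\<forall>i a b. a \<notin> I \<longrightarrow> b \<in> J \<longrightarrow> z $ i $ a $ b = 0) \<and>
      (\<forall>i. y $ i = (mat 1 + N1) ** z $ i ** (mat 1 - N2))}" (is "negligible ?S")
proof -
  define F1 where "F1 = (- I) \<times> I"
  define F2 where "F2 = (- J) \<times> J"
  define Z where "Z = (UNIV::'n set) \<times> (- I) \<times> J"
  have fin: "finite (F1 <+> F2)" "finite Z" by auto
  have cardF: "card (F1 <+> F2) < card Z"
    using count by (simp add: card_Plus F1_def F2_def Z_def card_cartesian_product mult_ac)
  \<comment> \<open>The map \<open>\<phi>\<close> assigns to each free entry of \<open>N1\<close> and \<open>N2\<close> its place in the zero block. The place \<open>z0\<close> is left over.\<close>
  obtain \<phi> where \<phi>: "\<phi> ` (F1 <+> F2) \<subseteq> Z" "inj_on \<phi> (F1 <+> F2)"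
    using card_le_inj[OF fin] cardF by auto
  have "card (\<phi> ` (F1 <+> F2)) < card Z" using \<phi>(2) cardF by (simp add: card_image)
  then have "\<phi> ` (F1 <+> F2) \<noteq> Z" by auto
  then obtain z0 where z0: "z0 \<in> Z" "z0 \<notin> \<phi> ` (F1 <+> F2)" using \<phi>(1) by blast
  define co where "co = (\<lambda>(x::real^'m2^'m1^'n) (i, a, b). x $ i $ a $ b)"
  define M1 where "M1 = (\<lambda>x. \<chi> a c. if (a, c) \<in> F1 then co x (\<phi> (Inl (a, c))) else 0)"
  define M2 where "M2 = (\<lambda>x. \<chi> d b. if (d, b) \<in> F2 then co x (\<phi> (Inr (d, b))) else 0)"
  define zz where "zz = (\<lambda>(x::real^'m2^'m1^'n) i. \<chi> a b. if a \<notin> I \<and> b \<in> J then 0 else x $ i $ a $ b)"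
  define f where "f = (\<lambda>x. \<chi> i. (mat 1 + M1 x) ** zz x i ** (mat 1 - M2 x))"
  have poly_co: "real_polynomial_function (\<lambda>x. co x p)" for p
  proof -
    obtain i a b where p: "p = (i, a, b)" by (cases p) auto
    have "bounded_linear (\<lambda>x::real^'m2^'m1^'n. x $ i $ a $ b)"
      by (intro bounded_linear_compose[OF bounded_linear_vec_nth] bounded_linear_vec_nth)
    then show ?thesis by (auto simp: co_def p)
  qed
  have poly_M1: "real_polynomial_function (\<lambda>x. (mat 1 + M1 x) $ a $ c)" for a c
    by (cases "(a, c) \<in> F1") (auto simp: M1_def poly_co intro!: real_polynomial_function.intros(2,3))
  have poly_M2: "real_polynomial_function (\<lambda>x. (mat 1 - M2 x) $ d $ b)" for d b
    by (cases "(d, b) \<in> F2") (auto simp: M2_def poly_co intro!: real_polynomial_function.intros(2) real_polynomial_function_diff)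
  have poly_zz: "real_polynomial_function (\<lambda>x. zz x i $ a $ b)" for i a b
    using poly_co[of "(i, a, b)"]
    by (cases "a \<notin> I \<and> b \<in> J") (auto simp: zz_def co_def)
  have "real_polynomial_function (\<lambda>x. f x $ i $ a $ b)" for i a b
    unfolding f_def vec_lambda_beta matrix_matrix_mult_def
    by (intro real_polynomial_function_sum real_polynomial_function.intros(4) poly_M1 poly_M2 poly_zz finite_UNIV finite)
  then have "polynomial_function f"
    unfolding polynomial_function_iff_Basis_inner by (auto simp: Basis_vec_def inner_axis)
  then have diff: "f differentiable_on {x. co x z0 = 0}" by (rule differentiable_on_polynomial_function)
  have "negligible {x. co x z0 = 0}"
  proof -
    obtain i a b where p: "z0 = (i, a, b)" by (cases z0) auto
    have "axis i (axis a (axis b (1::real))) \<in> (Basis :: (real^'m2^'m1^'n) set)" by (auto simp: Basis_vec_def)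
    from negligible_standard_hyperplane[OF this, of 0] show ?thesis by (simp add: inner_axis co_def p)
  qed
  then have "negligible (f ` {x. co x z0 = 0})"
    by (intro negligible_differentiable_image_negligible diff) auto
  moreover have "?S \<subseteq> f ` {x. co x z0 = 0}"
  proof
    fix y assume "y \<in> ?S"
    then obtain N1 :: "real^'m1^'m1" and N2 :: "real^'m2^'m2" and z where
      N1: "\<And>a c. N1 $ a $ c \<noteq> 0 \<Longrightarrow> a \<notin> I \<and> c \<in> I" and N2: "\<And>d b. N2 $ d $ b \<noteq> 0 \<Longrightarrow> d \<notin> J \<and> b \<in> J"
      and z: "\<And>i a b. a \<notin> I \<Longrightarrow> b \<in> J \<Longrightarrow> z $ i $ a $ b = 0"
      and y: "\<And>i. y $ i = (mat 1 + N1) ** z $ i ** (mat 1 - N2)" by blast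
    define param where "param = (\<lambda>q. case q of Inl (a, c) \<Rightarrow> N1 $ a $ c | Inr (d, b) \<Rightarrow> N2 $ d $ b)"
    define x :: "real^'m2^'m1^'n" where "x = (\<chi> i a b. if (i, a, b) \<in> \<phi> ` (F1 <+> F2)
        then param (the_inv_into (F1 <+> F2) \<phi> (i, a, b)) else z $ i $ a $ b)"
    have co_phi: "co x (\<phi> q) = param q" if "q \<in> F1 <+> F2" for q
    proof -
      have x_co: "co x p = (if p \<in> \<phi> ` (F1 <+> F2) then param (the_inv_into (F1 <+> F2) \<phi> p) else co z p)" for p
        by (cases p) (auto simp: co_def x_def)
      show ?thesis unfolding x_co using that \<phi>(2) by (simp add: the_inv_into_f_f)
    qed
    have "M1 x = N1"
    proof -
      have "M1 x $ a $ c = N1 $ a $ c" for a c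
        using N1[of a c] co_phi[of "Inl (a, c)"] by (auto simp: M1_def param_def F1_def)
      then show ?thesis by (simp add: vec_eq_iff)
    qed
    moreover have "M2 x = N2"
    proof -
      have "M2 x $ a $ c = N2 $ a $ c" for a c
        using N2[of a c] co_phi[of "Inr (a, c)"] by (auto simp: M2_def param_def F2_def)
      then show ?thesis by (simp add: vec_eq_iff)
    qed
    moreover have "zz x i = z $ i" for i
    proof -
      have "zz x i $ a $ b = z $ i $ a $ b" for a b
      proof (cases "a \<notin> I \<and> b \<in> J")
        case False
        then have "(i, a, b) \<notin> \<phi> ` (F1 <+> F2)" using \<phi>(1) by (auto simp: Z_def)
        then show ?thesis using False by (auto simp: zz_def x_def)
      qed (use z in \<open>simp add: zz_def\<close>)
      then show ?thesis by (simp add: vec_eq_iff)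
    qed
    ultimately have "f x $ i = y $ i" for i by (simp add: f_def y)
    then have "y = f x" by (metis vec_eq_iff)
    moreover have "co x z0 = 0"
      using z0 z by (cases z0) (auto simp: co_def x_def Z_def)
    ultimately show "y \<in> f ` {x. co x z0 = 0}" by blast
  qed
  ultimately show ?thesis by (rule negligible_subset)
qed

text \<open>Charts for \<open>U\<close> and \<open>W\<close> bring the sample into block form. The difference of the two sides of the
  hypothesis is the expected codimension of the set.\<close>

lemma negligible_invariant_subspaces:
  assumes count: "w * (CARD('m1) - w) + u * (CARD('m2) - u) < CARD('n) * (CARD('m1) - w) * u"
  shows "negligible {y :: real^'m2^'m1^'n. \<exists>U W. subspace U \<and> subspace W \<and> dim U = u \<and> dim W = w \<and>
      (\<forall>i. \<forall>x\<in>U. y $ i *v x \<in> W)}" (is "negligible ?S")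
proof -
  define bad where "bad = (\<lambda>(I::'m1 set, J::'m2 set). {y :: real^'m2^'m1^'n. \<exists>(N1::real^'m1^'m1) (N2::real^'m2^'m2) z.
      (\<forall>a c. N1 $ a $ c \<noteq> 0 \<longrightarrow> a \<notin> I \<and> c \<in> I) \<and> (\<forall>d b. N2 $ d $ b \<noteq> 0 \<longrightarrow> d \<notin> J \<and> b \<in> J) \<and>
      (\<forall>i a b. a \<notin> I \<longrightarrow> b \<in> J \<longrightarrow> z $ i $ a $ b = 0) \<and>
      (\<forall>i. y $ i = (mat 1 + N1) ** z $ i ** (mat 1 - N2))})"
  define IJ where "IJ = {(I::'m1 set, J::'m2 set). card I = w \<and> card J = u}"
  have "negligible (bad p)" if "p \<in> IJ" for p
  proof -
    obtain I J where p: "p = (I, J)" by fastforce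
    then have card: "card I = w" "card J = u" using that by (auto simp: IJ_def)
    have "card (- I) = CARD('m1) - w" "card (- J) = CARD('m2) - u"
      using card by (simp_all add: Compl_eq_Diff_UNIV card_Diff_subset)
    then show ?thesis unfolding bad_def p prod.case
      using count card by (intro negligible_zero_block) simp
  qed
  then have "negligible (\<Union>p\<in>IJ. bad p)" by (intro negligible_Union) auto
  moreover have "?S \<subseteq> (\<Union>p\<in>IJ. bad p)"
  proof
    fix y assume "y \<in> ?S"
    then obtain U W where UW: "subspace U \<and> subspace W \<and> dim U = u \<and> dim W = w \<and> (\<forall>i. \<forall>x\<in>U. y $ i *v x \<in> W)"
      by (elim CollectE exE) (rule that)
    then have U: "subspace U" "dim U = u" and W: "subspace W" "dim W = w"
      and inv: "\<And>i x. x \<in> U \<Longrightarrow> y $ i *v x \<in> W" by auto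
    obtain J and N2 :: "real^'m2^'m2" where J: "card J = dim U" "\<forall>d b. N2 $ d $ b \<noteq> 0 \<longrightarrow> d \<notin> J \<and> b \<in> J"
      "U = (*v) (mat 1 + N2) ` {x. \<forall>i. i \<notin> J \<longrightarrow> x $ i = 0}" using subspace_graph[OF U(1)] .
    obtain I and N1 :: "real^'m1^'m1" where I: "card I = dim W" "\<forall>d b. N1 $ d $ b \<noteq> 0 \<longrightarrow> d \<notin> I \<and> b \<in> I"
      "W = (*v) (mat 1 + N1) ` {x. \<forall>i. i \<notin> I \<longrightarrow> x $ i = 0}" using subspace_graph[OF W(1)] .
    note s2 = nilpotent_shear_inverse[OF J(2)] and s1 = nilpotent_shear_inverse[OF I(2)]
    define z :: "real^'m2^'m1^'n" where "z = (\<chi> i. (mat 1 - N1) ** y $ i ** (mat 1 + N2))"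
    have "y $ i = (mat 1 + N1) ** z $ i ** (mat 1 - N2)" for i
    proof -
      have "(mat 1 + N1) ** z $ i ** (mat 1 - N2)
          = ((mat 1 + N1) ** (mat 1 - N1)) ** y $ i ** ((mat 1 + N2) ** (mat 1 - N2))"
        by (simp add: z_def matrix_mul_assoc)
      then show ?thesis by (simp only: s1 s2 matrix_mul_lid matrix_mul_rid)
    qed
    moreover have "z $ i $ a $ b = 0" if "a \<notin> I" "b \<in> J" for i a b
    proof -
      have "(mat 1 + N2) *v axis b 1 \<in> U" unfolding J(3) using that(2)
        by (intro imageI) (auto simp: axis_def)
      from inv[OF this, of i] obtain x where x: "\<forall>i. i \<notin> I \<longrightarrow> x $ i = 0"
        "y $ i *v ((mat 1 + N2) *v axis b 1) = (mat 1 + N1) *v x" unfolding I(3) by blast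
      have "z $ i *v axis b 1 = (mat 1 - N1) *v (y $ i *v ((mat 1 + N2) *v axis b 1))"
        by (simp add: z_def matrix_vector_mul_assoc matrix_mul_assoc)
      also have "\<dots> = ((mat 1 - N1) ** (mat 1 + N1)) *v x" unfolding x(2) by (rule matrix_vector_mul_assoc)
      also have "\<dots> = x" by (simp add: s1)
      finally have "(z $ i *v axis b 1) $ a = 0" using x(1) that(1) by simp
      then show ?thesis by (simp add: matrix_vector_mult_basis column_def)
    qed
    ultimately have "y \<in> bad (I, J)" unfolding bad_def prod.case using I(2) J(2)
      by (intro CollectI exI[of _ N1] exI[of _ N2] exI[of _ z] conjI allI impI) auto
    moreover have "(I, J) \<in> IJ" using I(1) J(1) U(2) W(2) by (simp add: IJ_def)
    ultimately show "y \<in> (\<Union>p\<in>IJ. bad p)" by blast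
  qed
  ultimately show ?thesis by (rule negligible_subset)
qed

section \<open>Samples and Lebesgue measure\<close>

text \<open>Lebesgue measure on a Euclidean space is the product of Lebesgue measures on the blocks of any
  partition of its coordinates, here in the form used for vectors and matrices.\<close>

lemma lborel_blocks:
  fixes I :: "'i set" and \<beta> :: "'i \<times> 'a::euclidean_space \<Rightarrow> 'e::euclidean_space" and T :: "('i \<Rightarrow> 'a) \<Rightarrow> 'e"
  assumes I: "finite I" and \<beta>: "bij_betw \<beta> (I \<times> Basis) Basis"
    and T: "\<And>z i v. i \<in> I \<Longrightarrow> v \<in> Basis \<Longrightarrow> T z \<bullet> \<beta> (i, v) = z i \<bullet> v"
  shows "distr (PiM I (\<lambda>_. lborel)) borel T = lborel" "T \<in> borel_measurable (PiM I (\<lambda>_. lborel))"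
proof -
  interpret product_sigma_finite "\<lambda>_::'i. lborel :: 'a measure" ..
  have T': "\<exists>i\<in>I. \<exists>v\<in>Basis. b = \<beta> (i, v)" if "b \<in> Basis" for b
    using \<beta> that unfolding bij_betw_def by (metis (no_types, lifting) SigmaE imageE)
  have \<beta>B: "\<beta> (i, v) \<in> Basis" if "i \<in> I" "v \<in> Basis" for i v
    using \<beta> that unfolding bij_betw_def by auto
  show meas: "T \<in> borel_measurable (PiM I (\<lambda>_. lborel))"
  proof (rule borel_measurable_euclidean_space[THEN iffD2], rule ballI)
    fix b :: 'e assume "b \<in> Basis"
    then obtain i v where iv: "i \<in> I" "v \<in> Basis" "b = \<beta> (i, v)" using T' by blast
    have "(\<lambda>z. z i) \<in> borel_measurable (PiM I (\<lambda>_. lborel :: 'a measure))"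
      using measurable_component_singleton[OF iv(1), of "\<lambda>_. lborel :: 'a measure"] by simp
    then have "(\<lambda>z. z i \<bullet> v) \<in> borel_measurable (PiM I (\<lambda>_. lborel :: 'a measure))"
      by (intro borel_measurable_inner) auto
    then show "(\<lambda>z. T z \<bullet> b) \<in> borel_measurable (PiM I (\<lambda>_. lborel))"
      using iv by (simp add: T)
  qed
  have "lborel = distr (PiM I (\<lambda>_. lborel)) borel T"
  proof (rule lborel_eqI)
    fix l u :: 'e assume lu: "\<And>b. b \<in> Basis \<Longrightarrow> l \<bullet> b \<le> u \<bullet> b"
    define L where "L = (\<lambda>x i. \<Sum>v\<in>Basis. (x \<bullet> \<beta> (i, v)) *\<^sub>R (v::'a))"
    have L: "L x i \<bullet> v = x \<bullet> \<beta> (i, v)" if "v \<in> Basis" for x i v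
      using that by (simp add: L_def inner_sum_left_Basis)
    have "T -` box l u \<inter> space (PiM I (\<lambda>_. lborel :: 'a measure)) = PiE I (\<lambda>i. box (L l i) (L u i))"
    proof (intro set_eqI iffI)
      fix z assume z: "z \<in> T -` box l u \<inter> space (PiM I (\<lambda>_. lborel :: 'a measure))"
      then have zE: "z \<in> extensional I" by (auto simp: space_PiM PiE_def)
      have "z i \<in> box (L l i) (L u i)" if i: "i \<in> I" for i
        unfolding mem_box
      proof (intro ballI)
        fix v :: 'a assume v: "v \<in> Basis"
        have "l \<bullet> \<beta> (i, v) < T z \<bullet> \<beta> (i, v) \<and> T z \<bullet> \<beta> (i, v) < u \<bullet> \<beta> (i, v)"
          using z \<beta>B[OF i v] by (auto simp: mem_box)
        then show "L l i \<bullet> v < z i \<bullet> v \<and> z i \<bullet> v < L u i \<bullet> v" by (simp add: L[OF v] T[OF i v])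
      qed
      then show "z \<in> PiE I (\<lambda>i. box (L l i) (L u i))" using zE by (auto simp: PiE_def)
    next
      fix z assume z: "z \<in> PiE I (\<lambda>i. box (L l i) (L u i))"
      have "T z \<in> box l u" unfolding mem_box
      proof (intro ballI)
        fix b :: 'e assume "b \<in> Basis"
        then obtain i v where iv: "i \<in> I" "v \<in> Basis" "b = \<beta> (i, v)" using T' by blast
        have "z i \<in> box (L l i) (L u i)" using z iv(1) by auto
        then have "L l i \<bullet> v < z i \<bullet> v \<and> z i \<bullet> v < L u i \<bullet> v" using iv(2) by (auto simp: mem_box)
        then show "l \<bullet> b < T z \<bullet> b \<and> T z \<bullet> b < u \<bullet> b" using iv by (simp add: L T)
      qed
      then show "z \<in> T -` box l u \<inter> space (PiM I (\<lambda>_. lborel :: 'a measure))"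
        using z by (auto simp: space_PiM PiE_def)
    qed
    then have "emeasure (distr (PiM I (\<lambda>_. lborel)) borel T) (box l u)
        = emeasure (PiM I (\<lambda>_. lborel)) (PiE I (\<lambda>i. box (L l i) (L u i)))"
      by (subst emeasure_distr) (auto simp: meas)
    also have "\<dots> = (\<Prod>i\<in>I. emeasure lborel (box (L l i) (L u i)))"
      by (rule emeasure_PiM[OF I]) auto
    also have "\<dots> = (\<Prod>i\<in>I. \<Prod>v\<in>Basis. ennreal ((u - l) \<bullet> \<beta> (i, v)))"
    proof (intro prod.cong refl)
      fix i assume i: "i \<in> I"
      have "emeasure lborel (box (L l i) (L u i)) = (\<Prod>v\<in>Basis. (L u i - L l i) \<bullet> v)"
        by (rule emeasure_lborel_box) (use lu \<beta>B i in \<open>auto simp: L\<close>)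
      also have "\<dots> = (\<Prod>v\<in>Basis. ennreal ((L u i - L l i) \<bullet> v))"
        using lu \<beta>B i by (subst prod_ennreal) (auto simp: L inner_diff_left)
      finally show "emeasure lborel (box (L l i) (L u i)) = (\<Prod>v\<in>Basis. ennreal ((u - l) \<bullet> \<beta> (i, v)))"
        by (simp add: L inner_diff_left)
    qed
    also have "\<dots> = (\<Prod>p\<in>I \<times> Basis. ennreal ((u - l) \<bullet> \<beta> p))"
      by (subst prod.cartesian_product) (simp add: split_def)
    also have "\<dots> = (\<Prod>b\<in>Basis. ennreal ((u - l) \<bullet> b))"
      by (rule prod.reindex_bij_betw[OF \<beta>])
    also have "\<dots> = ennreal (\<Prod>b\<in>Basis. (u - l) \<bullet> b)"
      using lu by (intro prod_ennreal) (auto simp: inner_diff_left)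
    finally show "emeasure (distr (PiM I (\<lambda>_. lborel)) borel T) (box l u) = (\<Prod>b\<in>Basis. (u - l) \<bullet> b)" .
  qed simp
  then show "distr (PiM I (\<lambda>_. lborel)) borel T = lborel" ..
qed

lemma lborel_vec:
  "distr (PiM (UNIV::'n::finite set) (\<lambda>_. lborel :: 'a::euclidean_space measure)) borel (\<lambda>z. \<chi> i. z i) = lborel"
  "(\<lambda>z. \<chi> i. z i) \<in> borel_measurable (PiM (UNIV::'n set) (\<lambda>_. lborel :: 'a measure))"
proof -
  have b: "bij_betw (\<lambda>(i, v). axis i v) ((UNIV::'n set) \<times> Basis) (Basis :: ('a^'n) set)"
    by (auto simp: bij_betw_def inj_on_def axis_eq_axis Basis_vec_def nonzero_Basis)
  show "distr (PiM (UNIV::'n::finite set) (\<lambda>_. lborel :: 'a::euclidean_space measure)) borel (\<lambda>z. \<chi> i. z i) = lborel"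
    "(\<lambda>z. \<chi> i. z i) \<in> borel_measurable (PiM (UNIV::'n set) (\<lambda>_. lborel :: 'a measure))"
    using lborel_blocks[OF _ b, of "\<lambda>z. \<chi> i. z i"] by (auto simp: inner_axis)
qed

lemma lborel_matrix:
  "distr (PiM (UNIV::('m1::finite \<times> 'm2::finite) set) (\<lambda>_. lborel :: real measure)) borel (\<lambda>z. \<chi> i j. z (i, j)) = lborel"
  "(\<lambda>z. \<chi> i j. z (i, j)) \<in> borel_measurable (PiM (UNIV::('m1 \<times> 'm2) set) (\<lambda>_. lborel :: real measure))"
proof -
  have b: "bij_betw (\<lambda>((i, j), v). axis i (axis j v)) ((UNIV::('m1 \<times> 'm2) set) \<times> Basis) (Basis :: (real^'m2^'m1) set)"
    by (auto simp: bij_betw_def inj_on_def axis_eq_axis Basis_vec_def nonzero_Basis image_iff)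
  show "distr (PiM (UNIV::('m1::finite \<times> 'm2::finite) set) (\<lambda>_. lborel :: real measure)) borel (\<lambda>z. \<chi> i j. z (i, j)) = lborel"
    "(\<lambda>z. \<chi> i j. z (i, j)) \<in> borel_measurable (PiM (UNIV::('m1 \<times> 'm2) set) (\<lambda>_. lborel :: real measure))"
    using lborel_blocks[OF _ b, of "\<lambda>z. \<chi> i j. z (i, j)"] by (auto simp: inner_axis split_beta)
qed

lemma PiM_density:
  fixes M :: "'a measure" and f :: "'a \<Rightarrow> ennreal"
  assumes I: "finite I" and M: "sigma_finite_measure M" and fM: "sigma_finite_measure (density M f)"
    and f[measurable]: "f \<in> borel_measurable M"
  shows "PiM I (\<lambda>_. density M f) = density (PiM I (\<lambda>_. M)) (\<lambda>x. \<Prod>i\<in>I. f (x i))"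
proof -
  interpret M: product_sigma_finite "\<lambda>_::'b. M" using M by (simp add: product_sigma_finite_def)
  interpret D: product_sigma_finite "\<lambda>_::'b. density M f" using fM by (simp add: product_sigma_finite_def)
  have fP[measurable]: "(\<lambda>x. \<Prod>i\<in>I. f (x i)) \<in> borel_measurable (PiM I (\<lambda>_. M))" by measurable
  have "density (PiM I (\<lambda>_. M)) (\<lambda>x. \<Prod>i\<in>I. f (x i)) = PiM I (\<lambda>_. density M f)"
  proof (rule D.PiM_eqI[OF I])
    have "sets (PiM I (\<lambda>_. M)) = sets (PiM I (\<lambda>_. density M f))" by (intro sets_PiM_cong) auto
    then show "sets (density (PiM I (\<lambda>_. M)) (\<lambda>x. \<Prod>i\<in>I. f (x i))) = sets (PiM I (\<lambda>_. density M f))" by simp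
    fix A assume "\<And>i. i \<in> I \<Longrightarrow> A i \<in> sets (density M f)"
    then have A[measurable]: "\<And>i. i \<in> I \<Longrightarrow> A i \<in> sets M" by simp
    have "emeasure (density (PiM I (\<lambda>_. M)) (\<lambda>x. \<Prod>i\<in>I. f (x i))) (PiE I A)
        = (\<integral>\<^sup>+ x. (\<Prod>i\<in>I. f (x i)) * indicator (PiE I A) x \<partial>PiM I (\<lambda>_. M))"
      using A I by (intro emeasure_density fP sets_PiM_I_finite) auto
    also have "\<dots> = (\<integral>\<^sup>+ x. (\<Prod>i\<in>I. f (x i) * indicator (A i) (x i)) \<partial>PiM I (\<lambda>_. M))"
    proof (rule nn_integral_cong)
      fix x assume "x \<in> space (PiM I (\<lambda>_. M))"
      then have x: "x \<in> extensional I" by (auto simp: space_PiM PiE_def)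
      show "(\<Prod>i\<in>I. f (x i)) * indicator (PiE I A) x = (\<Prod>i\<in>I. f (x i) * indicator (A i) (x i))"
      proof (cases "x \<in> PiE I A")
        case True
        then have "(\<Prod>i\<in>I. f (x i) * indicator (A i) (x i)) = (\<Prod>i\<in>I. f (x i))"
          by (intro prod.cong) (auto simp: indicator_def)
        then show ?thesis using True by simp
      next
        case False
        then obtain i where "i \<in> I" "x i \<notin> A i" using x by (auto simp: PiE_def)
        then have "(\<Prod>i\<in>I. f (x i) * indicator (A i) (x i)) = 0"
          using I by (intro prod_zero) (auto intro!: bexI[of _ i])
        then show ?thesis using False by simp
      qed
    qed
    also have "\<dots> = (\<Prod>i\<in>I. \<integral>\<^sup>+ y. f y * indicator (A i) y \<partial>M)"
      using I by (intro M.product_nn_integral_prod) auto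
    also have "\<dots> = (\<Prod>i\<in>I. emeasure (density M f) (A i))"
      by (intro prod.cong refl) (simp add: emeasure_density)
    finally show "emeasure (density (PiM I (\<lambda>_. M)) (\<lambda>x. \<Prod>i\<in>I. f (x i))) (PiE I A) = (\<Prod>i\<in>I. emeasure (density M f) (A i))" .
  qed
  then show ?thesis ..
qed

lemma AE_PiM_density:
  fixes M :: "'a measure" and f :: "'a \<Rightarrow> ennreal"
  assumes I: "finite I" and M: "sigma_finite_measure M" "sigma_finite_measure (density M f)"
    and f: "f \<in> borel_measurable M" "\<And>x. f x > 0"
  shows "(AE x in PiM I (\<lambda>_. density M f). P x) \<longleftrightarrow> (AE x in PiM I (\<lambda>_. M). P x)"
proof -
  have "(\<lambda>x. \<Prod>i\<in>I. f (x i)) \<in> borel_measurable (PiM I (\<lambda>_. M))" using f(1) by measurable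
  moreover have "0 < (\<Prod>i\<in>I. f (x i))" for x
  proof -
    have "(\<Prod>i\<in>I. f (x i)) \<noteq> 0" using I f(2) by (auto simp: prod_zero_iff less_le)
    then show ?thesis by (simp add: less_le zero_less_iff_neq_zero)
  qed
  ultimately show ?thesis unfolding PiM_density[OF I M f(1)] by (simp add: AE_density)
qed

lemma AE_std_normal_matrix:
  assumes A: "A \<in> sets borel"
  shows "(AE Z in (std_normal_matrix :: (real^'m2^'m1) measure). Z \<notin> A) \<longleftrightarrow> (AE Z in lborel. Z \<notin> A)"
proof -
  define T :: "('m1 \<times> 'm2 \<Rightarrow> real) \<Rightarrow> real^'m2^'m1" where "T = (\<lambda>z. \<chi> i j. z (i, j))"
  define P where "P = PiM (UNIV::('m1 \<times> 'm2) set) (\<lambda>_. lborel :: real measure)"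
  define N where "N = PiM (UNIV::('m1 \<times> 'm2) set) (\<lambda>_. std_normal_distribution)"
  have TP: "T \<in> borel_measurable P" unfolding T_def P_def by (rule lborel_matrix(2))
  have "sets N = sets P" unfolding N_def P_def by (intro sets_PiM_cong) auto
  then have TN: "T \<in> borel_measurable N" using TP by (simp cong: measurable_cong_sets)
  have A': "{x \<in> space borel. x \<notin> A} \<in> sets borel" using A by simp
  have "(AE Z in (std_normal_matrix :: (real^'m2^'m1) measure). Z \<notin> A) \<longleftrightarrow> (AE z in N. T z \<notin> A)"
    unfolding std_normal_matrix_def T_def[symmetric] N_def[symmetric] by (rule AE_distr_iff[OF TN A'])
  also have "\<dots> \<longleftrightarrow> (AE z in P. T z \<notin> A)"
    unfolding N_def P_def
    by (rule AE_PiM_density)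
       (auto intro!: sigma_finite_lborel prob_space_imp_sigma_finite prob_space_normal_density normal_density_pos)
  also have "\<dots> \<longleftrightarrow> (AE Z in distr P borel T. Z \<notin> A)" by (rule AE_distr_iff[OF TP A', symmetric])
  also have "distr P borel T = lborel" unfolding P_def T_def by (rule lborel_matrix(1))
  finally show ?thesis .
qed

lemma AE_lborel_iff_negligible:
  fixes A :: "'a::euclidean_space set"
  assumes "A \<in> sets borel"
  shows "(AE x in lborel. x \<notin> A) \<longleftrightarrow> negligible A"
  using assms by (simp add: negligible_iff_null_sets AE_completion_iff AE_iff_null_sets null_sets_completion_iff)

lemma negligible_linear_iso:
  fixes L :: "'a::euclidean_space \<Rightarrow> 'a"
  assumes "linear L" "negligible A"
  shows "negligible (L ` A)"
  using assms by (intro negligible_differentiable_image_negligible linear_imp_differentiable_on) auto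

text \<open>The factors \<open>A\<close> and \<open>B\<close> are invertible, and an invertible linear map preserves null sets in both
  directions.\<close>

lemma matrix_normal_null_sets:
  fixes S1 :: "real^'m1^'m1" and S2 :: "real^'m2^'m2"
  assumes D: "is_matrix_normal S1 S2 D" and S: "S1 \<in> PD" "S2 \<in> PD"
  shows "prob_space D" "sets D = sets borel"
    "\<And>A. A \<in> sets borel \<Longrightarrow> (AE Y in D. Y \<notin> A) \<longleftrightarrow> (AE Y in lborel. Y \<notin> A)"
proof -
  obtain A :: "real^'m1^'m1" and B :: "real^'m2^'m2" where AB: "S1 = A ** transpose A" "S2 = B ** transpose B"
    and D_eq: "D = distr std_normal_matrix borel (\<lambda>Z. A ** Z ** transpose B)"
    using D unfolding is_matrix_normal_def by blast
  have "det S1 \<noteq> 0" "det S2 \<noteq> 0"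
    using S by (metis PD_factorization det_mul det_transpose invertible_det_nz mult_eq_0_iff)+
  then have "det A \<noteq> 0" "det B \<noteq> 0" unfolding AB by (auto simp: det_mul)
  then have "invertible A" "invertible (transpose B)" by (auto simp: invertible_det_nz)
  then obtain A' B' where A': "A ** A' = mat 1" "A' ** A = mat 1" and B': "transpose B ** B' = mat 1" "B' ** transpose B = mat 1"
    unfolding invertible_def by blast
  define L where "L = (\<lambda>Z. A ** Z ** transpose B)"
  define L' where "L' = (\<lambda>Z. A' ** Z ** B')"
  have LL': "L (L' Z) = Z" for Z
  proof -
    have "L (L' Z) = (A ** A') ** Z ** (B' ** transpose B)" by (simp add: L_def L'_def matrix_mul_assoc)
    then show ?thesis by (simp only: A' B' matrix_mul_lid matrix_mul_rid)
  qed
  have L'L: "L' (L Z) = Z" for Z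
  proof -
    have "L' (L Z) = (A' ** A) ** Z ** (transpose B ** B')" by (simp add: L_def L'_def matrix_mul_assoc)
    then show ?thesis by (simp only: A' B' matrix_mul_lid matrix_mul_rid)
  qed
  have "linear (\<lambda>Z. C ** Z ** E)" for C :: "real^'m1^'m1" and E :: "real^'m2^'m2"
    by (rule linearI)
       (simp_all add: vec_eq_iff matrix_matrix_mult_def sum_distrib_left sum_distrib_right sum.distrib distrib_left distrib_right mult_ac)
  then have lin: "linear L" "linear L'" by (simp_all add: L_def L'_def)
  have meas: "L \<in> borel_measurable borel"
    by (intro borel_measurable_continuous_onI linear_continuous_on linear_conv_bounded_linear[THEN iffD1] lin)
  have sets_std: "sets (std_normal_matrix :: (real^'m2^'m1) measure) = sets borel" by (simp add: std_normal_matrix_def)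
  have meas': "L \<in> borel_measurable (std_normal_matrix :: (real^'m2^'m1) measure)"
    using meas sets_std by (simp cong: measurable_cong_sets)
  have "prob_space (std_normal_matrix :: (real^'m2^'m1) measure)"
  proof -
    define T :: "('m1 \<times> 'm2 \<Rightarrow> real) \<Rightarrow> real^'m2^'m1" where "T = (\<lambda>z. \<chi> i j. z (i, j))"
    define N where "N = PiM (UNIV::('m1 \<times> 'm2) set) (\<lambda>_. std_normal_distribution)"
    have "sets N = sets (PiM (UNIV::('m1 \<times> 'm2) set) (\<lambda>_. lborel :: real measure))"
      unfolding N_def by (intro sets_PiM_cong) auto
    then have "T \<in> borel_measurable N" using lborel_matrix(2) unfolding T_def by (simp cong: measurable_cong_sets)
    moreover have "prob_space N" unfolding N_def by (intro prob_space_PiM prob_space_normal_density) auto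
    ultimately show ?thesis unfolding std_normal_matrix_def T_def[symmetric] N_def[symmetric]
      by (intro prob_space.prob_space_distr)
  qed
  then show "prob_space D" unfolding D_eq L_def[symmetric] by (rule prob_space.prob_space_distr[OF _ meas'])
  show "sets D = sets borel" by (simp add: D_eq)
  fix E :: "(real^'m2^'m1) set" assume E: "E \<in> sets borel"
  have E': "L -` E \<in> sets borel" using measurable_sets[OF meas E] by simp
  have "(AE Y in D. Y \<notin> E) \<longleftrightarrow> (AE Z in std_normal_matrix. L Z \<notin> E)"
    unfolding D_eq L_def[symmetric] by (rule AE_distr_iff[OF meas']) (use E in simp)
  also have "\<dots> \<longleftrightarrow> (AE Z in lborel. Z \<notin> L -` E)" using AE_std_normal_matrix[OF E'] by simp
  also have "\<dots> \<longleftrightarrow> negligible (L -` E)" by (rule AE_lborel_iff_negligible[OF E'])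
  also have "\<dots> \<longleftrightarrow> negligible E"
  proof
    assume "negligible (L -` E)"
    then have "negligible (L ` (L -` E))" by (intro negligible_linear_iso lin)
    moreover have "L ` (L -` E) = E" using LL' by (metis surj_def surj_image_vimage_eq)
    ultimately show "negligible E" by simp
  next
    assume "negligible E"
    then have "negligible (L' ` E)" by (intro negligible_linear_iso lin)
    moreover have "L -` E \<subseteq> L' ` E" using L'L by (metis imageI subsetI vimageE)
    ultimately show "negligible (L -` E)" by (rule negligible_subset)
  qed
  also have "\<dots> \<longleftrightarrow> (AE Y in lborel. Y \<notin> E)" by (rule AE_lborel_iff_negligible[OF E, symmetric])
  finally show "(AE Y in D. Y \<notin> E) \<longleftrightarrow> (AE Y in lborel. Y \<notin> E)" .
qed

text \<open>The Radon-Nikodym derivative vanishes only on a null set, where it can be changed to one.\<close>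

lemma equivalent_measure_positive_density:
  fixes D :: "'a::euclidean_space measure"
  assumes sets: "sets D = sets borel"
    and null: "\<And>A. A \<in> sets borel \<Longrightarrow> (AE Y in D. Y \<notin> A) \<longleftrightarrow> (AE Y in lborel. Y \<notin> A)"
  obtains f where "f \<in> borel_measurable lborel" "\<And>x. f x > 0" "density lborel f = D"
proof -
  have ns: "A \<in> null_sets D \<longleftrightarrow> A \<in> null_sets lborel" if "A \<in> sets borel" for A
    using null[OF that] that sets by (simp add: AE_iff_null_sets)
  have "absolutely_continuous lborel D"
    unfolding absolutely_continuous_def using ns by (auto simp: null_sets_def)
  then obtain g where g: "g \<in> borel_measurable lborel" "density lborel g = D"
    using sigma_finite_measure.Radon_Nikodym[OF sigma_finite_lborel] sets by auto
  define f where "f = (\<lambda>x. if g x = 0 then 1 else g x)"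
  have f: "f \<in> borel_measurable lborel" unfolding f_def using g(1) by measurable
  have Z: "{x. g x = 0} \<in> sets borel" using g(1) by simp
  have "AE x in D. x \<notin> {x. g x = 0}" unfolding g(2)[symmetric] using g(1) by (auto simp: AE_density)
  then have "AE x in lborel. x \<notin> {x. g x = 0}" using null[OF Z] by simp
  then have "density lborel f = density lborel g"
    by (intro density_cong f g(1)) (auto simp: f_def elim!: eventually_mono)
  moreover have "f x > 0" for x by (simp add: f_def zero_less_iff_neq_zero)
  ultimately show ?thesis using that f g(2) by blast
qed

text \<open>The map \<open>f\<close> selects the sample matrices that the event depends on, so that their joint law lives on a
  Euclidean space. Positive densities multiply, hence the product of the distributions has the null sets of Lebesgue
  measure.\<close>

theorem AE_matrix_normal_sample:
  fixes S1 :: "real^'m1^'m1" and S2 :: "real^'m2^'m2" and f :: "'n::finite \<Rightarrow> nat"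
  assumes D: "is_matrix_normal S1 S2 D" and S: "S1 \<in> PD" "S2 \<in> PD"
    and f: "inj f" "range f \<subseteq> {..<n}" and E: "E \<in> sets borel"
  shows "(AE Y in PiM {..<n} (\<lambda>_. D). (\<chi> i. Y (f i)) \<notin> E) \<longleftrightarrow> negligible (E :: (real^'m2^'m1^'n) set)"
proof -
  note DD = matrix_normal_null_sets[OF D S]
  obtain g where g: "g \<in> borel_measurable lborel" "\<And>x. g x > 0" "density lborel g = D"
    using equivalent_measure_positive_density[OF DD(2,3)] by blast
  define T :: "('n \<Rightarrow> real^'m2^'m1) \<Rightarrow> real^'m2^'m1^'n" where "T = (\<lambda>z. \<chi> i. z i)"
  define P where "P = PiM (UNIV::'n set) (\<lambda>_. lborel :: (real^'m2^'m1) measure)"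
  define Q where "Q = PiM (UNIV::'n set) (\<lambda>_. D)"
  have TP: "T \<in> borel_measurable P" unfolding T_def P_def by (rule lborel_vec(2))
  have "sets Q = sets P" unfolding Q_def P_def by (intro sets_PiM_cong) (auto simp: DD(2))
  then have TQ: "T \<in> borel_measurable Q" using TP by (simp cong: measurable_cong_sets)
  have r: "(\<lambda>\<omega>. \<lambda>i\<in>UNIV. \<omega> (f i)) \<in> measurable (PiM {..<n} (\<lambda>_. D)) Q"
    unfolding Q_def using f(2) by (intro measurable_restrict measurable_component_singleton) auto
  have Q: "distr (PiM {..<n} (\<lambda>_. D)) Q (\<lambda>\<omega>. \<lambda>i\<in>UNIV. \<omega> (f i)) = Q"
    unfolding Q_def using DD(1) f by (intro distr_PiM_reindex) auto
  have QE: "{x \<in> space Q. T x \<notin> E} \<in> sets Q" using TQ E by measurable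
  have "(AE Y in PiM {..<n} (\<lambda>_. D). (\<chi> i. Y (f i)) \<notin> E)
      \<longleftrightarrow> (AE Y in PiM {..<n} (\<lambda>_. D). T (\<lambda>i\<in>UNIV. Y (f i)) \<notin> E)" by (simp add: T_def restrict_def)
  also have "\<dots> \<longleftrightarrow> (AE z in distr (PiM {..<n} (\<lambda>_. D)) Q (\<lambda>\<omega>. \<lambda>i\<in>UNIV. \<omega> (f i)). T z \<notin> E)"
    by (rule AE_distr_iff[OF r QE, symmetric])
  also have "\<dots> \<longleftrightarrow> (AE z in Q. T z \<notin> E)" unfolding Q ..
  also have "\<dots> \<longleftrightarrow> (AE z in P. T z \<notin> E)"
    unfolding Q_def P_def g(3)[symmetric]
    using g DD(1) by (intro AE_PiM_density) (auto intro: sigma_finite_lborel prob_space_imp_sigma_finite)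
  also have "\<dots> \<longleftrightarrow> (AE y in distr P borel T. y \<notin> E)" by (rule AE_distr_iff[OF TP, symmetric]) (use E in simp)
  also have "distr P borel T = lborel" unfolding P_def T_def by (rule lborel_vec(1))
  also have "(AE y in lborel. y \<notin> E) \<longleftrightarrow> negligible E" by (rule AE_lborel_iff_negligible[OF E])
  finally show ?thesis .
qed

text \<open>Negligible sets need not be Borel, but each is contained in a Borel null set.\<close>

corollary AE_sample_if_negligible:
  fixes S1 :: "real^'m1^'m1" and S2 :: "real^'m2^'m2" and f :: "'n::finite \<Rightarrow> nat"
  assumes D: "is_matrix_normal S1 S2 D" and S: "S1 \<in> PD" "S2 \<in> PD"
    and f: "inj f" "range f \<subseteq> {..<n}" and E: "negligible (E :: (real^'m2^'m1^'n) set)"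
  shows "AE Y in PiM {..<n} (\<lambda>_. D). (\<chi> i. Y (f i)) \<notin> E"
proof -
  obtain E' where E': "E' \<in> null_sets lborel" "E \<subseteq> E'"
    using E by (auto simp: negligible_iff_null_sets null_sets_completion_iff2)
  then have b: "E' \<in> sets borel" by auto
  have "negligible E'" using E'(1) b by (simp add: negligible_iff_null_sets null_sets_completion_iff)
  then have "AE Y in PiM {..<n} (\<lambda>_. D). (\<chi> i. Y (f i)) \<notin> E'"
    using AE_matrix_normal_sample[OF D S f b] by simp
  then show ?thesis using E'(2) by (auto elim!: eventually_mono)
qed

section \<open>Pairs of matrices of size \<open>(d + 1) k \<times> d k\<close>\<close>

text \<open>The direct sum of \<open>k\<close> copies of the Kronecker block of size \<open>(d + 1) \<times> d\<close>. Bijections index the rows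
  and the columns by pairs (position in the block, number of the block), because the index types carry no such structure. The
  squares of the weights are \<open>2 k j\<close> and \<open>2 k (d - j)\<close> in row \<open>j\<close> of each block.\<close>

definition kronecker_block_sum ::
  "nat \<Rightarrow> nat \<Rightarrow> ('m1 \<Rightarrow> nat \<times> nat) \<Rightarrow> ('m2 \<Rightarrow> nat \<times> nat) \<Rightarrow> nat \<Rightarrow> real^'m2^'m1" where
  "kronecker_block_sum d k \<sigma> \<tau> i = (\<chi> a b.
     if \<tau> b = (fst (\<sigma> a) + i, snd (\<sigma> a))
     then sqrt (2 * real k * (if i = 0 then real (fst (\<sigma> a)) else real d - real (fst (\<sigma> a)))) else 0)"

lemma sum_bij_single:
  fixes \<tau> :: "'m::finite \<Rightarrow> 'p" and c :: real
  assumes "inj \<tau>"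
  shows "(\<Sum>b\<in>UNIV. if \<tau> b = p then c else 0) = (if p \<in> range \<tau> then c else 0)"
proof (cases "p \<in> range \<tau>")
  case True
  then obtain b0 where "\<tau> b0 = p" by blast
  then have "(\<tau> b = p) = (b = b0)" for b using assms by (auto simp: inj_def)
  then show ?thesis using True by simp
next
  case False
  then have "\<tau> b \<noteq> p" for b by blast
  then show ?thesis using False by simp
qed

text \<open>In each of the two matrices a row or column has at most one nonzero entry. The squared weights add up to
  \<open>2 k d\<close> in every row and to \<open>2 k (d + 1)\<close> in every column.\<close>

lemma kronecker_block_sum_balanced:
  fixes \<sigma> :: "'m1::finite \<Rightarrow> nat \<times> nat" and \<tau> :: "'m2::finite \<Rightarrow> nat \<times> nat"
  assumes \<sigma>: "bij_betw \<sigma> UNIV ({..d} \<times> {..<k})" and \<tau>: "bij_betw \<tau> UNIV ({1..d} \<times> {..<k})"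
  defines "G \<equiv> (kronecker_block_sum d k \<sigma> \<tau> :: nat \<Rightarrow> real^'m2^'m1)"
  shows "(\<Sum>i<2. G i ** transpose (G i)) = mat (real 2 * real CARD('m2))"
    and "(\<Sum>i<2. transpose (G i) ** G i) = mat (real 2 * real CARD('m1))"
proof -
  have inj: "inj \<sigma>" "inj \<tau>" and range: "range \<sigma> = {..d} \<times> {..<k}" "range \<tau> = {1..d} \<times> {..<k}"
    using \<sigma> \<tau> by (auto simp: bij_betw_def)
  have cards: "CARD('m1) = (d + 1) * k" "CARD('m2) = d * k"
    using bij_betw_same_card[OF \<sigma>] bij_betw_same_card[OF \<tau>] by simp_all
  have \<sigma>_bd: "fst (\<sigma> a) \<le> d" "snd (\<sigma> a) < k" for a using range(1) by (metis SigmaE atMost_iff fst_conv lessThan_iff rangeI snd_conv)+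
  have \<tau>_bd: "1 \<le> fst (\<tau> b)" "fst (\<tau> b) \<le> d" "snd (\<tau> b) < k" for b
    using range(2) by (metis SigmaE atLeastAtMost_iff fst_conv lessThan_iff rangeI snd_conv)+
  define w where "w = (\<lambda>i (j::nat). 2 * real k * (if i = (0::nat) then real j else real d - real j))"
  have w_nonneg: "w i (fst (\<sigma> a)) \<ge> 0" for i a using \<sigma>_bd(1)[of a] by (simp add: w_def)
  have G: "G i $ a $ b = (if \<tau> b = (fst (\<sigma> a) + i, snd (\<sigma> a)) then sqrt (w i (fst (\<sigma> a))) else 0)" for i a b
    by (simp add: G_def kronecker_block_sum_def w_def)
  have two: "(\<Sum>i<2. h i) = h 0 + h 1" for h :: "nat \<Rightarrow> real" by (simp add: numeral_2_eq_2)
  have "(\<Sum>i<2. G i ** transpose (G i)) $ a $ c = mat (real 2 * real CARD('m2)) $ a $ c" for a c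
  proof (cases "a = c")
    case False
    then have z: "G i $ a $ b * G i $ c $ b = 0" for i b
      using inj(1) by (auto simp: G inj_def prod_eq_iff)
    have "(G i ** transpose (G i)) $ a $ c = 0" for i
      unfolding matrix_matrix_mult_def transpose_def vec_lambda_beta by (intro sum.neutral ballI z)
    then show ?thesis using False by (simp add: mat_def)
  next
    case True
    have "(\<Sum>b\<in>UNIV. G i $ a $ b * G i $ a $ b) = (if (fst (\<sigma> a) + i, snd (\<sigma> a)) \<in> range \<tau> then w i (fst (\<sigma> a)) else 0)" for i
    proof -
      have "(\<Sum>b\<in>UNIV. G i $ a $ b * G i $ a $ b) = (\<Sum>b\<in>UNIV. if \<tau> b = (fst (\<sigma> a) + i, snd (\<sigma> a)) then w i (fst (\<sigma> a)) else 0)"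
        using w_nonneg by (intro sum.cong) (auto simp: G)
      then show ?thesis using sum_bij_single[OF inj(2)] by simp
    qed
    then have "(\<Sum>i<2. G i ** transpose (G i)) $ a $ a
        = (\<Sum>i<2. if (fst (\<sigma> a) + i, snd (\<sigma> a)) \<in> range \<tau> then w i (fst (\<sigma> a)) else 0)"
      by (simp add: matrix_matrix_mult_def transpose_def)
    also have "\<dots> = 2 * real k * real d"
      unfolding two range(2) using \<sigma>_bd[of a] by (cases "fst (\<sigma> a) = 0"; cases "fst (\<sigma> a) = d") (auto simp: w_def algebra_simps mem_Times_iff)
    finally show ?thesis using True by (simp add: mat_def cards mult_ac)
  qed
  then show "(\<Sum>i<2. G i ** transpose (G i)) = mat (real 2 * real CARD('m2))" by (simp add: vec_eq_iff)
  have "(\<Sum>i<2. transpose (G i) ** G i) $ b $ c = mat (real 2 * real CARD('m1)) $ b $ c" for b c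
  proof (cases "b = c")
    case False
    then have z: "G i $ a $ b * G i $ a $ c = 0" for i a
      using inj(2) by (auto simp: G inj_def)
    have "(transpose (G i) ** G i) $ b $ c = 0" for i
      unfolding matrix_matrix_mult_def transpose_def vec_lambda_beta by (intro sum.neutral ballI z)
    then show ?thesis using False by (simp add: mat_def)
  next
    case True
    have "(\<Sum>a\<in>UNIV. G i $ a $ b * G i $ a $ b) = w i (fst (\<tau> b) - i)" if i: "i < 2" for i
    proof -
      have ib: "i \<le> fst (\<tau> b)" using \<tau>_bd(1)[of b] i by linarith
      have eq: "(\<tau> b = (fst (\<sigma> a) + i, snd (\<sigma> a))) = (\<sigma> a = (fst (\<tau> b) - i, snd (\<tau> b)))" for a
        using ib by (cases "\<sigma> a"; cases "\<tau> b") auto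
      have "(\<Sum>a\<in>UNIV. G i $ a $ b * G i $ a $ b) = (\<Sum>a\<in>UNIV. if \<sigma> a = (fst (\<tau> b) - i, snd (\<tau> b)) then w i (fst (\<tau> b) - i) else 0)"
      proof (rule sum.cong[OF refl])
        fix a show "G i $ a $ b * G i $ a $ b = (if \<sigma> a = (fst (\<tau> b) - i, snd (\<tau> b)) then w i (fst (\<tau> b) - i) else 0)"
          using w_nonneg[of i a] unfolding G eq by auto
      qed
      also have "\<dots> = (if (fst (\<tau> b) - i, snd (\<tau> b)) \<in> range \<sigma> then w i (fst (\<tau> b) - i) else 0)"
        by (rule sum_bij_single[OF inj(1)])
      also have "\<dots> = w i (fst (\<tau> b) - i)"
        unfolding range(1) using \<tau>_bd(2,3)[of b] by (auto simp: mem_Times_iff)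
      finally show ?thesis .
    qed
    then have "(\<Sum>i<2. transpose (G i) ** G i) $ b $ b = (\<Sum>i<2. w i (fst (\<tau> b) - i))"
      by (simp add: matrix_matrix_mult_def transpose_def)
    also have "\<dots> = 2 * real k * (real d + 1)"
      unfolding two using \<tau>_bd[of b] by (simp add: w_def of_nat_diff algebra_simps)
    finally show ?thesis using True by (simp add: mat_def cards algebra_simps)
  qed
  then show "(\<Sum>i<2. transpose (G i) ** G i) = mat (real 2 * real CARD('m1))" by (simp add: vec_eq_iff)
qed

text \<open>Scaling one copy of the block against the others is a symmetry.\<close>

lemma kronecker_block_sum_not_unique:
  fixes Y :: "nat \<Rightarrow> real^'m2^'m1" and A :: "real^'m1^'m1" and B :: "real^'m2^'m2"
  assumes \<tau>: "bij_betw \<tau> (UNIV :: 'm2 set) ({1..d} \<times> {..<k})" and k: "k \<ge> 2" and d: "d \<ge> 1"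
    and A: "invertible A" and B: "invertible B"
    and Y: "\<And>i. i < n \<Longrightarrow> A ** Y i ** transpose B = kronecker_block_sum d k \<sigma> \<tau> i"
  shows "\<not> mle_exists_uniquely n Y"
proof -
  define l where "l = (\<lambda>s::nat. if s = 0 then 2 else 1 :: real)"
  define D1 :: "real^'m1^'m1" where "D1 = diagm (\<lambda>a. l (snd (\<sigma> a)))"
  define D2 :: "real^'m2^'m2" where "D2 = diagm (\<lambda>b. l (snd (\<tau> b)))"
  obtain A' where A': "A ** A' = mat 1" "A' ** A = mat 1" using A invertible_def by blast
  obtain B' where B': "B ** B' = mat 1" "B' ** B = mat 1" using B invertible_def by blast
  have TB: "transpose B ** transpose B' = mat 1" "transpose B' ** transpose B = mat 1"
    by (rule transpose_inverse[OF B'(2)] transpose_inverse[OF B'(1)])+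
  have inv: "invertible A'" "invertible (transpose B')" "invertible (transpose B)" "invertible B'"
    using A' TB B' unfolding invertible_def by blast+
  have Dinv: "invertible D1" "invertible D2" by (simp_all add: D1_def D2_def invertible_det_nz l_def)
  define X1 where "X1 = A' ** D1 ** A"
  define X2 where "X2 = transpose B ** D2 ** transpose B'"
  have X: "invertible X1" "invertible X2" unfolding X1_def X2_def by (intro invertible_mult inv Dinv A)+
  have DG: "D1 ** kronecker_block_sum d k \<sigma> \<tau> i = kronecker_block_sum d k \<sigma> \<tau> i ** D2" for i
    by (auto simp: vec_eq_iff D1_def D2_def kronecker_block_sum_def)
  have comm: "X1 ** Y i = Y i ** X2" if "i < n" for i
  proof -
    have "Y i = (A' ** A) ** Y i ** (transpose B ** transpose B')"
      by (simp only: A' TB matrix_mul_lid matrix_mul_rid)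
    also have "\<dots> = A' ** (A ** Y i ** transpose B) ** transpose B'" by (simp only: matrix_mul_assoc)
    finally have Yi: "Y i = A' ** kronecker_block_sum d k \<sigma> \<tau> i ** transpose B'" unfolding Y[OF that] .
    have "X1 ** Y i = A' ** D1 ** (A ** A') ** kronecker_block_sum d k \<sigma> \<tau> i ** transpose B'"
      unfolding X1_def by (subst Yi) (simp only: matrix_mul_assoc)
    also have "\<dots> = A' ** (D1 ** kronecker_block_sum d k \<sigma> \<tau> i) ** transpose B'"
      by (simp only: A' matrix_mul_rid matrix_mul_assoc)
    also have "\<dots> = A' ** kronecker_block_sum d k \<sigma> \<tau> i ** (transpose B' ** transpose B) ** D2 ** transpose B'"
      unfolding DG by (simp only: TB matrix_mul_rid matrix_mul_assoc)
    also have "\<dots> = Y i ** X2"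
      unfolding X2_def by (subst Yi) (simp only: matrix_mul_assoc)
    finally show ?thesis .
  qed
  have eig: "transpose X2 *v (B' *v axis b 1) = l (snd (\<tau> b)) *\<^sub>R (B' *v axis b 1)" for b
  proof -
    have "transpose X2 ** B' = B' ** D2 ** (B ** B')"
      by (simp add: X2_def D2_def matrix_transpose_mul matrix_mul_assoc)
    then have "transpose X2 ** B' = B' ** D2" by (simp only: B' matrix_mul_rid)
    then have "transpose X2 *v (B' *v axis b 1) = B' *v (D2 *v axis b 1)"
      by (simp only: matrix_vector_mul_assoc)
    also have "D2 *v axis b 1 = l (snd (\<tau> b)) *\<^sub>R axis b 1"
      by (simp add: D2_def vec_eq_iff axis_def)
    finally show ?thesis by (simp add: matrix_vector_mult_scaleR)
  qed
  have nz: "B' *v axis b 1 \<noteq> 0" for b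
    using invertible_mult_cancel[OF inv(4)] by (metis axis_eq_0_iff zero_neq_one)
  have "(1, 0) \<in> range \<tau>" "(1, 1) \<in> range \<tau>" using \<tau> k d by (auto simp: bij_betw_def)
  then obtain b0 b1 where "\<tau> b0 = (1, 0)" "\<tau> b1 = (1, 1)" by (metis imageE)
  then show ?thesis
    using not_unique_if_symmetry[OF X comm eig[of b0] nz eig[of b1] nz] by (simp add: l_def)
qed

text \<open>In the absence of short closed chains the map \<open>T2\<close> is surjective, and every element of its kernel, which has
  dimension \<open>k\<close>, is the end of a chain of length \<open>d\<close>. The span \<open>W\<close> of \<open>k\<close> such chains and its image under \<open>T2\<close>
  differ in dimension by \<open>k\<close> as well. So the dimension count applies to chains inside \<open>W\<close> and forces \<open>W\<close> to be the whole space.\<close>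

lemma pencil_chain_basis:
  fixes T1 T2 :: "real^'m1 \<Rightarrow> real^'m2"
  assumes T: "linear T1" "linear T2" and m1: "CARD('m1) = (d + 1) * k" and m2: "CARD('m2) = d * k"
    and no_short: "\<And>W. subspace W \<Longrightarrow> dim W \<le> d \<Longrightarrow> T1 ` W \<subseteq> T2 ` W \<Longrightarrow> \<not> dim (T2 ` W) < dim W"
  obtains p where "span {p s j |s j. s < k \<and> j \<le> d} = UNIV" "\<And>s. s < k \<Longrightarrow> T1 (p s 0) = 0"
    "\<And>s j. s < k \<Longrightarrow> j < d \<Longrightarrow> T1 (p s (Suc j)) = T2 (p s j)" "\<And>s. s < k \<Longrightarrow> T2 (p s d) = 0"
    "T2 ` UNIV = UNIV"
proof -
  have d: "d \<ge> 1" using m2 by (cases d) auto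
  have inj: "x = 0" if i: "i < d" and x: "x \<in> kernel_chain T1 T2 UNIV i" "T2 x = 0" for i x
  proof (rule ccontr)
    assume "x \<noteq> 0"
    then obtain W where "subspace W" "dim W \<le> i + 1" "dim (T2 ` W) < dim W" "T1 ` W \<subseteq> T2 ` W"
      using closed_kernel_chain[OF T x] by blast
    then show False using no_short[of W] i by simp
  qed
  \<comment> \<open>The dimension count for kernel chains, relative to a subspace \<open>W\<close> instead of the whole space.\<close>
  have large: "d * k \<le> dim (T2 ` W)" if W: "subspace W" "T1 ` W \<subseteq> T2 ` W" "dim (T2 ` W) + k \<le> dim W" for W
  proof -
    define C where "C = kernel_chain T1 T2 W (d - 1)"
    have C: "subspace C" "C \<subseteq> W" unfolding C_def by (intro kernel_chain_subspace T W kernel_chain_subset)+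
    have inj_W: "x = 0" if "i < d" "x \<in> kernel_chain T1 T2 W i" "T2 x = 0" for i x
      using inj[OF that(1) _ that(3)] kernel_chain_mono[of W UNIV T1 T2 i] that(2) by auto
    have "(d - 1 + 1) * k \<le> dim C" unfolding C_def
    proof (rule kernel_chain_dim[OF T W(1) _ W(2)])
      show "subspace (T2 ` W)" by (rule linear_subspace_image[OF T(2) W(1)])
      fix i x assume "i < d - 1" "x \<in> kernel_chain T1 T2 W i" "T2 x = 0"
      then show "x = 0" using inj_W[of i x] by simp
    qed (use W in auto)
    moreover have "inj_on T2 (span C)"
      by (rule linear_inj_on_span[OF T(2) C(1)]) (use inj_W[of "d - 1"] d in \<open>auto simp: C_def\<close>)
    then have "dim (T2 ` C) = dim C" by (rule dim_image_eq[OF T(2)])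
    moreover have "dim (T2 ` C) \<le> dim (T2 ` W)" using C(2) by (intro dim_subset) auto
    ultimately show ?thesis using d by simp
  qed
  define C where "C = kernel_chain T1 T2 UNIV (d - 1)"
  have C: "subspace C" unfolding C_def by (intro kernel_chain_subspace T subspace_UNIV)
  have "(d - 1 + 1) * k \<le> dim C" unfolding C_def
  proof (rule kernel_chain_dim[OF T subspace_UNIV subspace_UNIV])
    fix i x assume "i < d - 1" "x \<in> kernel_chain T1 T2 UNIV i" "T2 x = 0"
    then show "x = 0" using inj[of i x] by simp
  qed (use m1 m2 in auto)
  moreover have "inj_on T2 (span C)"
    by (rule linear_inj_on_span[OF T(2) C]) (use inj[of "d - 1"] d in \<open>auto simp: C_def\<close>)
  then have "dim (T2 ` C) = dim C" by (rule dim_image_eq[OF T(2)])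
  ultimately have dTC: "dim (T2 ` C) = CARD('m2)"
    using d m2 dim_subset_UNIV[of "T2 ` C"] by simp
  have "subspace (T2 ` C)" by (rule linear_subspace_image[OF T(2) C])
  then have TC: "T2 ` C = UNIV" using dTC by (intro subspace_dim_equal) auto
  then have surj: "T2 ` UNIV = UNIV" by auto
  define K where "K = {x\<in>UNIV. T2 x = 0}"
  have K: "subspace K" unfolding K_def using linear_subspace_kernel[OF T(2)] by simp
  have "dim K + CARD('m2) = CARD('m1)"
    unfolding K_def using rank_nullity_on_subspace[OF T(2) subspace_UNIV] by (simp add: surj)
  then have dK: "dim K = k" using m1 m2 by simp
  obtain K0 where K0: "K0 \<subseteq> K" "independent K0" "K \<subseteq> span K0" "card K0 = dim K"
    using basis_exists[of K] by metis
  have "finite K0" using K0(2) independent_bound by blast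
  then obtain e where e: "bij_betw e {..<k} K0" using K0(4) dK
    by (metis card_lessThan finite_lessThan finite_same_card_bij)
  have "\<exists>q. q d = e s \<and> T1 (q 0) = 0 \<and> (\<forall>i<d. T1 (q (Suc i)) = T2 (q i))" for s
  proof -
    have "e s \<in> kernel_chain T1 T2 UNIV d"
    proof -
      have d': "d = Suc (d - 1)" using d by simp
      have "e s \<in> kernel_chain T1 T2 UNIV (Suc (d - 1))"
        unfolding kernel_chain.simps C_def[symmetric] TC by simp
      then show ?thesis unfolding d'[symmetric] .
    qed
    from kernel_chain_coefficients[OF this] show ?thesis by blast
  qed
  then have "\<forall>s. \<exists>q. q d = e s \<and> T1 (q 0) = 0 \<and> (\<forall>i<d. T1 (q (Suc i)) = T2 (q i))" by blast
  from choice[OF this] obtain p where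
    pp: "\<forall>s. p s d = e s \<and> T1 (p s 0) = 0 \<and> (\<forall>i<d. T1 (p s (Suc i)) = T2 (p s i))" ..
  then have p: "\<And>s. p s d = e s" "\<And>s. T1 (p s 0) = 0" "\<And>s i. i < d \<Longrightarrow> T1 (p s (Suc i)) = T2 (p s i)"
    by auto
  define S where "S = {p s j |s j. s < k \<and> j \<le> d}"
  define W where "W = span S"
  have W: "subspace W" by (simp add: W_def)
  have pS: "p s j \<in> W" if "s < k" "j \<le> d" for s j using that unfolding W_def S_def by (intro span_base) blast
  have "K0 \<subseteq> W"
  proof
    fix x assume "x \<in> K0"
    then obtain s where "s < k" "x = e s" using e by (auto simp: bij_betw_def)
    then show "x \<in> W" using pS[of s d] p(1) by simp
  qed
  then have "span K0 \<subseteq> W" by (intro span_minimal W)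
  then have KW: "K \<subseteq> W" using K0(3) by blast
  have TW: "subspace (T2 ` W)" by (rule linear_subspace_image[OF T(2) W])
  have "T1 ` S \<subseteq> T2 ` W"
  proof
    fix y assume "y \<in> T1 ` S"
    then obtain s j where sj: "s < k" "j \<le> d" "y = T1 (p s j)" by (auto simp: S_def)
    show "y \<in> T2 ` W"
    proof (cases j)
      case 0 then show ?thesis using sj p(2) subspace_0[OF TW] by simp
    next
      case (Suc i) then show ?thesis using sj p(3)[of i s] pS[of s i] by auto
    qed
  qed
  then have "span (T1 ` S) \<subseteq> T2 ` W" by (intro span_minimal TW)
  then have T1W: "T1 ` W \<subseteq> T2 ` W" by (simp add: W_def linear_span_image[OF T(1)])
  have "{x\<in>W. T2 x = 0} = K" using KW by (auto simp: K_def)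
  then have dW: "k + dim (T2 ` W) = dim W" using rank_nullity_on_subspace[OF T(2) W] dK by simp
  then have "d * k \<le> dim (T2 ` W)" by (intro large W T1W) simp
  then have "dim W = CARD('m1)" using dW m1 dim_subset_UNIV[of W] by simp
  then have "W = UNIV" using W by (intro subspace_dim_equal) auto
  moreover have "T2 (p s d) = 0" if "s < k" for s
  proof -
    have "e s \<in> K" using e that K0(1) by (auto simp: bij_betw_def)
    then show ?thesis using p(1) by (simp add: K_def)
  qed
  ultimately show ?thesis using that[of p] p surj unfolding W_def S_def by blast
qed

lemma rows_invertible:
  fixes A :: "real^'n^'n"
  assumes "span (range (\<lambda>i. A $ i)) = UNIV"
  shows "invertible A"
proof -
  have "rows A = range (\<lambda>i. A $ i)" by (auto simp: rows_def row_def)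
  then have "\<exists>A'. A' ** A = mat 1" using assms matrix_left_invertible_span_rows[of A] by simp
  then show ?thesis by (simp add: invertible_left_inverse)
qed

text \<open>The chain elements serve as a basis of the row space, their images as a basis of the column space.\<close>

theorem two_samples_normal_form:
  fixes Y :: "nat \<Rightarrow> real^'m2^'m1"
  assumes m1: "CARD('m1) = (d + 1) * k" and m2: "CARD('m2) = d * k"
    and no_short: "\<And>W V. subspace W \<Longrightarrow> subspace V \<Longrightarrow> dim W \<le> d \<Longrightarrow> dim V < dim W
      \<Longrightarrow> \<exists>i<2. \<exists>w\<in>W. transpose (Y i) *v w \<notin> V"
  obtains A :: "real^'m1^'m1" and B :: "real^'m2^'m2" and \<sigma> \<tau> where "invertible A" "invertible B"
    "bij_betw \<sigma> UNIV ({..d} \<times> {..<k})" "bij_betw \<tau> UNIV ({1..d} \<times> {..<k})"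
    "\<And>i. i < 2 \<Longrightarrow> A ** Y i ** transpose B = kronecker_block_sum d k \<sigma> \<tau> i"
proof -
  define T1 where "T1 = (\<lambda>x. transpose (Y 0) *v x)"
  define T2 where "T2 = (\<lambda>x. transpose (Y 1) *v x)"
  have T: "linear T1" "linear T2" unfolding T1_def T2_def by (rule linear_transpose_mult)+
  have no_short': "\<not> dim (T2 ` W) < dim W" if W: "subspace W" "dim W \<le> d" "T1 ` W \<subseteq> T2 ` W" for W
  proof
    assume "dim (T2 ` W) < dim W"
    then obtain i w where "i < 2" "w \<in> W" "transpose (Y i) *v w \<notin> T2 ` W"
      using no_short[OF W(1) linear_subspace_image[OF T(2) W(1)] W(2)] by blast
    then show False using W(3) by (auto simp: T1_def T2_def less_2_cases_iff image_subset_iff)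
  qed
  obtain p where p: "span {p s j |s j. s < k \<and> j \<le> d} = UNIV" "\<And>s. s < k \<Longrightarrow> T1 (p s 0) = 0"
    "\<And>s j. s < k \<Longrightarrow> j < d \<Longrightarrow> T1 (p s (Suc j)) = T2 (p s j)" "\<And>s. s < k \<Longrightarrow> T2 (p s d) = 0"
    and surj: "T2 ` UNIV = UNIV"
    using pencil_chain_basis[OF T m1 m2 no_short'] by blast
  obtain \<sigma> where \<sigma>: "bij_betw \<sigma> (UNIV :: 'm1 set) ({..d} \<times> {..<k})"
    using finite_same_card_bij[of "UNIV::'m1 set" "{..d} \<times> {..<k}"] m1 by auto
  obtain \<tau> where \<tau>: "bij_betw \<tau> (UNIV :: 'm2 set) ({1..d} \<times> {..<k})"
    using finite_same_card_bij[of "UNIV::'m2 set" "{1..d} \<times> {..<k}"] m2 by auto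
  have range: "range \<sigma> = {..d} \<times> {..<k}" "range \<tau> = {1..d} \<times> {..<k}"
    using \<sigma> \<tau> by (auto simp: bij_betw_def)
  have \<sigma>_bd: "fst (\<sigma> a) \<le> d" "snd (\<sigma> a) < k" for a using range(1) by (metis SigmaE atMost_iff fst_conv lessThan_iff rangeI snd_conv)+
  have \<tau>_bd: "1 \<le> fst (\<tau> b)" "fst (\<tau> b) \<le> d" "snd (\<tau> b) < k" for b
    using range(2) by (metis SigmaE atLeastAtMost_iff fst_conv lessThan_iff rangeI snd_conv)+
  have d: "d \<ge> 1" using m2 by (cases d) auto
  define r where "r = (\<lambda>(j, s). T2 (p s (j - 1)))"
  define P :: "real^'m1^'m1" where "P = (\<chi> a. p (snd (\<sigma> a)) (fst (\<sigma> a)))"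
  define R :: "real^'m2^'m2" where "R = (\<chi> b. r (\<tau> b))"
  have "range (\<lambda>a. P $ a) = {p s j |s j. s < k \<and> j \<le> d}"
  proof (intro set_eqI iffI)
    fix x assume "x \<in> range (\<lambda>a. P $ a)"
    then show "x \<in> {p s j |s j. s < k \<and> j \<le> d}" using \<sigma>_bd by (auto simp: P_def)
  next
    fix x assume "x \<in> {p s j |s j. s < k \<and> j \<le> d}"
    then obtain s j where sj: "s < k" "j \<le> d" "x = p s j" by blast
    then have "(j, s) \<in> range \<sigma>" unfolding range(1) by auto
    then obtain a where "\<sigma> a = (j, s)" by (metis imageE)
    then show "x \<in> range (\<lambda>a. P $ a)" using sj by (intro image_eqI[of _ _ a]) (auto simp: P_def)
  qed
  then have P: "invertible P" using p(1) by (intro rows_invertible) simp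
  have "span (range (\<lambda>b. R $ b)) = UNIV"
  proof -
    have "T2 ` {p s j |s j. s < k \<and> j \<le> d} \<subseteq> span (range (\<lambda>b. R $ b))"
    proof
      fix y assume "y \<in> T2 ` {p s j |s j. s < k \<and> j \<le> d}"
      then obtain s j where sj: "s < k" "j \<le> d" "y = T2 (p s j)" by blast
      show "y \<in> span (range (\<lambda>b. R $ b))"
      proof (cases "j = d")
        case True then show ?thesis using sj p(4) by (simp add: span_zero)
      next
        case False
        then have "(j + 1, s) \<in> range \<tau>" unfolding range(2) using sj by auto
        then obtain b where "\<tau> b = (j + 1, s)" by (metis imageE)
        then have "R $ b = y" using sj by (simp add: R_def r_def)
        then show ?thesis by (metis rangeI span_base)
      qed
    qed
    then have "span (T2 ` {p s j |s j. s < k \<and> j \<le> d}) \<subseteq> span (range (\<lambda>b. R $ b))" by (rule span_minimal) auto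
    then show ?thesis unfolding linear_span_image[OF T(2)] p(1) surj by auto
  qed
  then have "invertible R" by (rule rows_invertible)
  then obtain R' where R': "R ** R' = mat 1" "R' ** R = mat 1" unfolding invertible_def by blast
  \<comment> \<open>The columns of \<open>R'\<close> are the basis dual to the rows of \<open>R\<close>, so they read off coordinates of images.\<close>
  have dual: "(R $ b) \<bullet> (transpose R' $ c) = (if b = c then 1 else 0)" for b c
  proof -
    have "(R ** R') $ b $ c = (R $ b) \<bullet> (transpose R' $ c)"
      by (simp add: matrix_matrix_mult_def inner_vec_def transpose_def)
    then show ?thesis by (simp add: R' mat_def)
  qed
  \<comment> \<open>Binomial weights turn the Kronecker blocks with unit entries into the balanced ones.\<close>
  define \<alpha> where "\<alpha> = (\<lambda>j. sqrt (2 * real k * real d / real (d choose j)))"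
  define \<beta> where "\<beta> = (\<lambda>j. sqrt (real ((d - 1) choose (j - 1))))"
  have \<alpha>\<beta>0: "\<alpha> j * \<beta> j = sqrt (2 * real k * real j)" if "1 \<le> j" "j \<le> d" for j
  proof -
    have "j * (d choose j) = d * ((d - 1) choose (j - 1))" using that by (intro times_binomial_minus1_eq) auto
    then have "real j * real (d choose j) = real d * real ((d - 1) choose (j - 1))" by (metis of_nat_mult)
    moreover have "real (d choose j) > 0" using that by simp
    ultimately have "2 * real k * real d / real (d choose j) * real ((d - 1) choose (j - 1)) = 2 * real k * real j"
      by (simp add: field_simps)
    then show ?thesis unfolding \<alpha>_def \<beta>_def real_sqrt_mult[symmetric] by simp
  qed
  have \<alpha>\<beta>1: "\<alpha> j * \<beta> (j + 1) = sqrt (2 * real k * (real d - real j))" if "j \<le> d" for j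
  proof -
    have "(d - j) * (d choose j) = d * ((d - 1) choose j)" by (rule binomial_absorb_comp)
    then have "(real d - real j) * real (d choose j) = real d * real ((d - 1) choose j)"
      using that by (metis of_nat_diff of_nat_mult)
    moreover have "real (d choose j) > 0" using that by simp
    ultimately have "real d * real ((d - 1) choose j) / real (d choose j) = real d - real j"
      by (metis less_irrefl nonzero_mult_div_cancel_right)
    then have "2 * real k * real d / real (d choose j) * real ((d - 1) choose j) = 2 * real k * (real d - real j)"
      by (metis times_divide_eq_left times_divide_eq_right mult.assoc)
    then show ?thesis unfolding \<alpha>_def \<beta>_def real_sqrt_mult[symmetric] by simp
  qed
  have k: "k > 0" using m1 by (cases k) auto
  define A :: "real^'m1^'m1" where "A = diagm (\<lambda>a. \<alpha> (fst (\<sigma> a))) ** P"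
  define B :: "real^'m2^'m2" where "B = diagm (\<lambda>b. \<beta> (fst (\<tau> b))) ** transpose R'"
  have "invertible (diagm (\<lambda>a. \<alpha> (fst (\<sigma> a))) :: real^'m1^'m1)"
    using d k by (simp add: invertible_det_nz \<alpha>_def not_less \<sigma>_bd(1))
  then have A: "invertible A" unfolding A_def using P invertible_mult by blast
  have "fst (\<tau> b) - 1 \<le> d - 1" for b using \<tau>_bd(2)[of b] by simp
  then have "invertible (diagm (\<lambda>b. \<beta> (fst (\<tau> b))) :: real^'m2^'m2)"
    by (simp add: invertible_det_nz \<beta>_def not_less)
  moreover have "invertible (transpose R')" using R' invertible_def invertible_transpose by blast
  ultimately have B: "invertible B" unfolding B_def using invertible_mult by blast
  have Aa: "A $ a = \<alpha> (fst (\<sigma> a)) *\<^sub>R p (snd (\<sigma> a)) (fst (\<sigma> a))" for a by (simp add: A_def P_def vec_eq_iff)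
  have Bb: "B $ b = \<beta> (fst (\<tau> b)) *\<^sub>R (transpose R' $ b)" for b by (simp add: B_def vec_eq_iff)
  have pair: "r q \<bullet> (transpose R' $ b) = (if \<tau> b = q then 1 else 0)" if q: "q \<in> range \<tau>" for q b
  proof -
    obtain c where c: "q = \<tau> c" using q by blast
    have "(\<tau> b = \<tau> c) = (c = b)" using \<tau> by (auto simp: bij_betw_def inj_def)
    then show ?thesis using dual[of c b] by (simp add: c R_def)
  qed
  have entry0: "(A ** Y 0 ** transpose B) $ a $ b = kronecker_block_sum d k \<sigma> \<tau> 0 $ a $ b" for a b
  proof -
    obtain j s where js: "\<sigma> a = (j, s)" by fastforce
    then have bd: "j \<le> d" "s < k" using \<sigma>_bd[of a] by auto
    have "(A ** Y 0 ** transpose B) $ a $ b = T1 (A $ a) \<bullet> (B $ b)" by (simp only: frame_entry T1_def)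
    also have "\<dots> = \<alpha> j * \<beta> (fst (\<tau> b)) * (T1 (p s j) \<bullet> (transpose R' $ b))"
      by (simp add: Aa Bb js linear_scale[OF T(1)])
    also have "\<dots> = kronecker_block_sum d k \<sigma> \<tau> 0 $ a $ b"
    proof (cases j)
      case 0
      then have "\<tau> b \<noteq> (j, s)" using \<tau>_bd(1)[of b] by auto
      then show ?thesis using 0 p(2)[OF bd(2)] by (simp add: kronecker_block_sum_def js)
    next
      case (Suc i)
      then have "(j, s) \<in> range \<tau>" unfolding range(2) using bd by auto
      moreover have "T1 (p s j) = r (j, s)" using p(3)[OF bd(2), of i] Suc bd by (simp add: r_def)
      ultimately show ?thesis using pair[of "(j, s)" b] \<alpha>\<beta>0[of j] bd Suc by (simp add: kronecker_block_sum_def js)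
    qed
    finally show ?thesis .
  qed
  have entry1: "(A ** Y 1 ** transpose B) $ a $ b = kronecker_block_sum d k \<sigma> \<tau> 1 $ a $ b" for a b
  proof -
    obtain j s where js: "\<sigma> a = (j, s)" by fastforce
    then have bd: "j \<le> d" "s < k" using \<sigma>_bd[of a] by auto
    have "(A ** Y 1 ** transpose B) $ a $ b = T2 (A $ a) \<bullet> (B $ b)" by (simp only: frame_entry T2_def)
    also have "\<dots> = \<alpha> j * \<beta> (fst (\<tau> b)) * (T2 (p s j) \<bullet> (transpose R' $ b))"
      by (simp add: Aa Bb js linear_scale[OF T(2)])
    also have "\<dots> = kronecker_block_sum d k \<sigma> \<tau> 1 $ a $ b"
    proof (cases "j = d")
      case True
      then have "\<tau> b \<noteq> (j + 1, s)" using \<tau>_bd(2)[of b] by auto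
      then show ?thesis using True p(4)[OF bd(2)] by (simp add: kronecker_block_sum_def js)
    next
      case False
      then have "(j + 1, s) \<in> range \<tau>" unfolding range(2) using bd by auto
      moreover have "T2 (p s j) = r (j + 1, s)" by (simp add: r_def)
      ultimately show ?thesis using pair[of "(j + 1, s)" b] \<alpha>\<beta>1[of j] bd by (simp add: kronecker_block_sum_def js)
    qed
    finally show ?thesis .
  qed
  have "A ** Y i ** transpose B = kronecker_block_sum d k \<sigma> \<tau> i" if i: "i < 2" for i
  proof -
    consider "i = 0" | "i = 1" using i by linarith
    then show ?thesis
    proof cases
      case 1 then show ?thesis using entry0 by (simp add: vec_eq_iff)
    next
      case 2
      have "(A ** Y 1 ** transpose B) = kronecker_block_sum d k \<sigma> \<tau> 1" unfolding vec_eq_iff using entry1 by blast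
      then show ?thesis using 2 by simp
    qed
  qed
  then show ?thesis using that[OF A B \<sigma> \<tau>] by blast
qed

section \<open>Zero sets of polynomial functions\<close>

text \<open>On every line through a point where \<open>f\<close> does not vanish there are only finitely many zeros. By
  Fubini almost every homothetic copy of the zero set about that point is null, hence so is the zero set.\<close>

lemma negligible_zeros_real_polynomial:
  fixes f :: "'a::euclidean_space \<Rightarrow> real"
  assumes f: "real_polynomial_function f" and x0: "f x0 \<noteq> 0"
  shows "negligible {x. f x = 0}"
proof -
  have cont: "continuous_on UNIV f"
    using continuous_real_polymonial_function[OF f] by (simp add: continuous_on_eq_continuous_within)
  have ray: "finite {t::real. f (x0 + t *\<^sub>R v) = 0}" for v
  proof -
    have "polynomial_function (\<lambda>t::real. x0 + t *\<^sub>R v)"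
      by (intro polynomial_function_add polynomial_function_const polynomial_function_bounded_linear bounded_linear_scaleR_left)
    then have "real_polynomial_function (f \<circ> (\<lambda>t::real. x0 + t *\<^sub>R v))"
      using f by (rule real_polynomial_function_compose)
    then obtain a n where an: "(f \<circ> (\<lambda>t. x0 + t *\<^sub>R v)) = (\<lambda>t. \<Sum>i\<le>n. a i * t ^ i)"
      unfolding real_polynomial_function_iff_sum by blast
    then have eq: "f (x0 + t *\<^sub>R v) = (\<Sum>i\<le>n. a i * t ^ i)" for t by (metis comp_apply)
    have "\<exists>k\<le>n. a k \<noteq> 0"
    proof (rule ccontr)
      assume "\<not> ?thesis"
      then have "(\<Sum>i\<le>n. a i * 0 ^ i) = 0" by (intro sum.neutral) auto
      then show False using eq[of 0] x0 by simp
    qed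
    then show ?thesis unfolding eq by (intro polyfun_rootbound_finite) auto
  qed
  define g where "g = (\<lambda>p :: 'a \<times> real. f (x0 + snd p *\<^sub>R fst p))"
  have "continuous_on UNIV g" unfolding g_def
    by (intro continuous_on_compose2[OF cont] continuous_intros) auto
  then have "open (g -` (- {0}))" by (intro open_vimage) auto
  then have "g -` (- {0}) \<in> sets (borel :: ('a \<times> real) measure)" by simp
  moreover have "{p \<in> space (lborel \<Otimes>\<^sub>M lborel). f (x0 + snd p *\<^sub>R fst p) \<noteq> 0} = g -` (- {0})"
    by (auto simp: g_def space_pair_measure)
  ultimately have meas: "{p \<in> space (lborel \<Otimes>\<^sub>M lborel). f (x0 + snd p *\<^sub>R fst p) \<noteq> 0} \<in> sets ((lborel :: 'a measure) \<Otimes>\<^sub>M (lborel :: real measure))"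
    unfolding lborel_prod by simp
  have "AE v in (lborel :: 'a measure). AE t in (lborel :: real measure). f (x0 + t *\<^sub>R v) \<noteq> 0"
  proof (rule AE_I2)
    fix v :: 'a
    have "{t::real. f (x0 + t *\<^sub>R v) = 0} \<in> null_sets lborel"
      using ray[of v] by (intro countable_imp_null_set_lborel countable_finite)
    then show "AE t in (lborel :: real measure). f (x0 + t *\<^sub>R v) \<noteq> 0" by (rule AE_I') auto
  qed
  then have ae: "AE t in (lborel :: real measure). AE v in (lborel :: 'a measure). f (x0 + t *\<^sub>R v) \<noteq> 0"
    using lborel_pair.AE_commute[OF meas] by simp
  have "AE t in (lborel :: real measure). t \<noteq> 0" by (rule AE_lborel_singleton)
  with ae have "AE t in (lborel :: real measure). t \<noteq> 0 \<and> (AE v in (lborel :: 'a measure). f (x0 + t *\<^sub>R v) \<noteq> 0)"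
    by eventually_elim auto
  moreover have "ae_filter (lborel :: real measure) \<noteq> bot" unfolding ae_filter_eq_bot_iff by simp
  ultimately have "\<exists>t. t \<noteq> 0 \<and> (AE v in (lborel :: 'a measure). f (x0 + t *\<^sub>R v) \<noteq> 0)"
    by (metis (mono_tags, lifting) eventually_happens')
  then obtain t where t: "t \<noteq> 0" "AE v in (lborel :: 'a measure). f (x0 + t *\<^sub>R v) \<noteq> 0" by blast
  define Z where "Z = {v. f (x0 + t *\<^sub>R v) = 0}"
  have "Z = (\<lambda>v. f (x0 + t *\<^sub>R v)) -` {0}" by (auto simp: Z_def)
  moreover have "closed ((\<lambda>v. f (x0 + t *\<^sub>R v)) -` {0})"
  proof -
    have "continuous_on UNIV (\<lambda>v. f (x0 + t *\<^sub>R v))"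
      by (intro continuous_on_compose2[OF cont] continuous_intros) auto
    then show ?thesis by (intro closed_vimage) auto
  qed
  ultimately have "Z \<in> sets borel" by simp
  moreover have "AE v in lborel. v \<notin> Z" using t(2) by (simp add: Z_def)
  ultimately have "negligible Z" using AE_lborel_iff_negligible[of Z] by simp
  then have "negligible ((\<lambda>v. x0 + v) ` ((\<lambda>v. t *\<^sub>R v) ` Z))"
    by (intro negligible_translation negligible_linear_iso) (auto intro: linear_scale_self)
  moreover have "{x. f x = 0} \<subseteq> (\<lambda>v. x0 + v) ` ((\<lambda>v. t *\<^sub>R v) ` Z)"
  proof
    fix x assume "x \<in> {x. f x = 0}"
    then have "(1 / t) *\<^sub>R (x - x0) \<in> Z" "x = x0 + t *\<^sub>R ((1 / t) *\<^sub>R (x - x0))" using t(1) by (auto simp: Z_def)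
    then show "x \<in> (\<lambda>v. x0 + v) ` ((\<lambda>v. t *\<^sub>R v) ` Z)" by blast
  qed
  ultimately show ?thesis by (rule negligible_subset)
qed

section \<open>Generic square matrices have simple eigenvalues\<close>

lemma det_hom:
  fixes \<phi> :: "'a::comm_ring_1 \<Rightarrow> 'b::comm_ring_1" and M :: "'a^'n^'n"
  assumes add: "\<And>x y. \<phi> (x + y) = \<phi> x + \<phi> y" and mult: "\<And>x y. \<phi> (x * y) = \<phi> x * \<phi> y" and one: "\<phi> 1 = 1"
  shows "\<phi> (det M) = det (\<chi> i j. \<phi> (M $ i $ j))"
proof -
  have zero: "\<phi> 0 = 0" using add[of 0 0] by simp
  have neg: "\<phi> (- 1) = - 1" using add[of 1 "- 1"] by (simp add: zero one eq_neg_iff_add_eq_0 add.commute)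
  have sum: "\<phi> (sum h S) = (\<Sum>x\<in>S. \<phi> (h x))" for h :: "('n \<Rightarrow> 'n) \<Rightarrow> 'a" and S
    by (induction S rule: infinite_finite_induct) (auto simp: zero add)
  have prod: "\<phi> (prod h S) = (\<Prod>x\<in>S. \<phi> (h x))" for h :: "'n \<Rightarrow> 'a" and S
    by (induction S rule: infinite_finite_induct) (auto simp: one mult)
  have "\<phi> (of_int (sign p)) = of_int (sign p)" for p :: "'n \<Rightarrow> 'n"
    by (cases p rule: sign_cases) (auto simp: one neg)
  then show ?thesis by (simp add: det_def sum mult prod)
qed

definition charpoly :: "'a::comm_ring_1^'n^'n \<Rightarrow> 'a poly" where
  "charpoly A = det (\<chi> i j. [:- (A $ i $ j), if i = j then 1 else 0:])"

lemma poly_charpoly: "poly (charpoly A) x = det (mat x - A)"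
proof -
  have "poly (charpoly A) x = det (\<chi> i j. poly ((\<chi> i j. [:- (A $ i $ j), if i = j then 1 else 0:]) $ i $ j) x)"
    unfolding charpoly_def by (rule det_hom[of "\<lambda>p. poly p x"]) auto
  also have "(\<chi> i j. poly ((\<chi> i j. [:- (A $ i $ j), if i = j then 1 else 0:]) $ i $ j) x) = mat x - A"
    by (simp add: vec_eq_iff mat_def)
  finally show ?thesis .
qed

text \<open>Only the identity permutation contributes a product of full degree.\<close>

lemma charpoly_degree:
  fixes A :: "'a::idom^'n^'n"
  shows "coeff (charpoly A) CARD('n) = 1" "degree (charpoly A) = CARD('n)"
proof -
  define m where "m = (\<lambda>i j. [:- (A $ i $ j), if i = j then 1 else 0:])"
  define T where "T = (\<lambda>p. of_int (sign p) * (\<Prod>i\<in>UNIV. m i (p i)))"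
  have cp: "charpoly A = (\<Sum>p\<in>{p. p permutes UNIV}. T p)"
    by (simp add: charpoly_def det_def T_def m_def)
  have deg_m: "degree (m i j) \<le> (if i = j then 1 else 0)" for i j by (simp add: m_def)
  have deg_prod: "degree (\<Prod>i\<in>UNIV. m i (p i)) \<le> card {i. i = p i}" for p
  proof -
    have "degree (\<Prod>i\<in>UNIV. m i (p i)) \<le> (\<Sum>i\<in>UNIV. degree (m i (p i)))"
      using degree_prod_sum_le[of UNIV "\<lambda>i. m i (p i)"] by (simp add: o_def)
    also have "\<dots> \<le> (\<Sum>i\<in>UNIV. if i = p i then 1 else 0)" using deg_m by (intro sum_mono) auto
    also have "\<dots> = card {i. i = p i}" by (simp add: sum.If_cases)
    finally show ?thesis .
  qed
  have deg_T: "degree (T p) \<le> card {i. i = p i}" for p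
  proof -
    have "degree (T p) \<le> degree (of_int (sign p) :: 'a poly) + degree (\<Prod>i\<in>UNIV. m i (p i))"
      unfolding T_def by (rule degree_mult_le)
    then show ?thesis using deg_prod[of p] by simp
  qed
  have other: "coeff (T p) CARD('n) = 0" if p: "p \<noteq> id" for p
  proof -
    obtain i where "p i \<noteq> i" using p by (auto simp: fun_eq_iff)
    then have "i \<notin> {i. i = p i}" by simp
    then have "{i. i = p i} \<noteq> UNIV" by blast
    then have "card {i. i = p i} < CARD('n)" by (intro psubset_card_mono) auto
    then show ?thesis using deg_T[of p] by (intro coeff_eq_0) linarith
  qed
  have one: "coeff (T id) CARD('n) = 1"
  proof -
    have mi: "m i i = [:- (A $ i $ i), 1:]" for i by (simp add: m_def)
    have "degree (\<Prod>i\<in>UNIV. m i i) = CARD('n)" unfolding mi by (subst degree_prod_eq_sum_degree) auto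
    moreover have "lead_coeff (\<Prod>i\<in>UNIV. m i i) = 1" unfolding mi by (simp add: lead_coeff_prod)
    ultimately show ?thesis by (simp add: T_def sign_id)
  qed
  have "coeff (charpoly A) CARD('n) = (\<Sum>p\<in>{p. p permutes (UNIV::'n set)}. if p = id then 1 else 0)"
    unfolding cp coeff_sum using other one by (intro sum.cong) auto
  also have "\<dots> = 1" by (simp add: permutes_id finite_permutations)
  finally show 1: "coeff (charpoly A) CARD('n) = 1" .
  have "degree (T p) \<le> CARD('n)" for p using deg_T[of p] card_mono[of UNIV "{i. i = p i}"] by simp
  then have "degree (charpoly A) \<le> CARD('n)" unfolding cp by (intro degree_sum_le) (auto simp: finite_permutations)
  moreover have "CARD('n) \<le> degree (charpoly A)" using 1 by (intro le_degree) simp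
  ultimately show "degree (charpoly A) = CARD('n)" by simp
qed

primrec matpow :: "'a::semiring_1^'n^'n \<Rightarrow> nat \<Rightarrow> 'a^'n^'n" where
  "matpow A 0 = mat 1"
| "matpow A (Suc i) = A ** matpow A i"

text \<open>Up to sign the discriminant of the characteristic polynomial: evaluating the derivative \<open>f'\<close> of the
  characteristic polynomial at the matrix gives the determinant \<open>\<Prod> f'(l)\<close> over the eigenvalues \<open>l\<close>.\<close>

definition matrix_discriminant :: "real^'n^'n \<Rightarrow> real" where
  "matrix_discriminant A = det (\<Sum>i\<le>CARD('n). coeff (pderiv (charpoly A)) i *\<^sub>R matpow A i)"

lemma real_polynomial_function_coeff_charpoly:
  fixes F :: "'a::real_normed_vector \<Rightarrow> real^'n^'n"
  assumes F: "\<And>i j. real_polynomial_function (\<lambda>x. F x $ i $ j)"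
  shows "real_polynomial_function (\<lambda>x. coeff (charpoly (F x)) r)"
proof -
  define PF where "PF = (\<lambda>G :: 'a \<Rightarrow> real poly. \<forall>r. real_polynomial_function (\<lambda>x. coeff (G x) r))"
  have const: "PF (\<lambda>x. c)" for c by (auto simp: PF_def)
  have mult: "PF (\<lambda>x. G x * H x)" if "PF G" "PF H" for G H
    using that unfolding PF_def coeff_mult
    by (intro allI real_polynomial_function_sum real_polynomial_function.intros(4)) auto
  have sum: "PF (\<lambda>x. \<Sum>p\<in>S. G p x)" if "\<And>p. p \<in> S \<Longrightarrow> PF (G p)" "finite S" for S :: "('n \<Rightarrow> 'n) set" and G
    using that unfolding PF_def coeff_sum by (intro allI real_polynomial_function_sum) auto
  have prod: "PF (\<lambda>x. \<Prod>i\<in>S. G i x)" if "finite S" "\<And>i. i \<in> S \<Longrightarrow> PF (G i)" for S :: "'n set" and G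
    using that by (induction S rule: finite_induct) (auto intro: mult const)
  have lin: "PF (\<lambda>x. [:- (F x $ i $ j), if i = j then 1 else 0:])" for i j
    unfolding PF_def
  proof
    fix r
    show "real_polynomial_function (\<lambda>x. coeff [:- (F x $ i $ j), if i = j then 1 else 0:] r)"
    proof (cases r)
      case 0 then show ?thesis using F[of i j] by auto
    next
      case (Suc r') then show ?thesis by (cases r') auto
    qed
  qed
  have "PF (\<lambda>x. charpoly (F x))"
    unfolding charpoly_def det_def
    by (intro sum mult const prod) (auto simp: finite_permutations lin)
  then show ?thesis by (simp add: PF_def)
qed

lemma real_polynomial_function_matrix_mult:
  fixes F :: "'a::real_normed_vector \<Rightarrow> real^'n^'m" and G :: "'a \<Rightarrow> real^'k^'n"
  assumes "\<And>i j. real_polynomial_function (\<lambda>x. F x $ i $ j)" "\<And>i j. real_polynomial_function (\<lambda>x. G x $ i $ j)"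
  shows "real_polynomial_function (\<lambda>x. (F x ** G x) $ i $ j)"
  unfolding matrix_matrix_mult_def vec_lambda_beta
  using assms by (intro real_polynomial_function_sum real_polynomial_function.intros(4)) auto

lemma real_polynomial_function_det:
  fixes F :: "'a::real_normed_vector \<Rightarrow> real^'n^'n"
  assumes "\<And>i j. real_polynomial_function (\<lambda>x. F x $ i $ j)"
  shows "real_polynomial_function (\<lambda>x. det (F x))"
  unfolding det_def
  using assms by (intro real_polynomial_function_sum real_polynomial_function_prod real_polynomial_function.intros(2,4)) (auto simp: finite_permutations)

lemma real_polynomial_function_matrix_discriminant:
  fixes F :: "'a::real_normed_vector \<Rightarrow> real^'n^'n"
  assumes F: "\<And>i j. real_polynomial_function (\<lambda>x. F x $ i $ j)"
  shows "real_polynomial_function (\<lambda>x. matrix_discriminant (F x))"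
proof -
  have pow: "real_polynomial_function (\<lambda>x. matpow (F x) r $ i $ j)" for r i j
  proof (induction r arbitrary: i j)
    case 0 then show ?case by (auto simp: mat_def)
  next
    case (Suc r) then show ?case by (simp add: real_polynomial_function_matrix_mult[OF F])
  qed
  have "real_polynomial_function (\<lambda>x. (\<Sum>r\<le>CARD('n). coeff (pderiv (charpoly (F x))) r *\<^sub>R matpow (F x) r) $ i $ j)" for i j
    unfolding sum_component vector_scaleR_component coeff_pderiv real_scaleR_def
    by (intro real_polynomial_function_sum real_polynomial_function.intros(2,4) pow real_polynomial_function_coeff_charpoly F finite_atMost)
  then show ?thesis unfolding matrix_discriminant_def by (rule real_polynomial_function_det)
qed

lemma matrix_discriminant_diagm:
  fixes d :: "'n::finite \<Rightarrow> real"
  assumes d: "inj d"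
  shows "matrix_discriminant (diagm d) \<noteq> 0"
proof -
  have cp: "charpoly (diagm d) = (\<Prod>i\<in>UNIV. [:- d i, 1:])"
    unfolding charpoly_def by (subst det_diagonal) auto
  have pow: "matpow (diagm d) r = diagm (\<lambda>i. d i ^ r)" for r
    by (induction r) (auto simp: diagm_mult_diagm)
  have dg: "degree (pderiv (charpoly (diagm d))) \<le> CARD('n)"
    using charpoly_degree(2)[of "diagm d"] by (simp add: degree_pderiv)
  have "(\<Sum>r\<le>CARD('n). coeff (pderiv (charpoly (diagm d))) r *\<^sub>R matpow (diagm d) r)
      = diagm (\<lambda>i. poly (pderiv (charpoly (diagm d))) (d i))"
  proof -
    have "poly (pderiv (charpoly (diagm d))) x = (\<Sum>r\<le>CARD('n). coeff (pderiv (charpoly (diagm d))) r * x ^ r)" for x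
    proof -
      have "(\<Sum>r\<le>degree (pderiv (charpoly (diagm d))). coeff (pderiv (charpoly (diagm d))) r * x ^ r)
          = (\<Sum>r\<le>CARD('n). coeff (pderiv (charpoly (diagm d))) r * x ^ r)"
        using dg by (intro sum.mono_neutral_left) (auto intro: coeff_eq_0)
      then show ?thesis by (simp add: poly_altdef)
    qed
    then show ?thesis by (simp add: vec_eq_iff pow sum_component if_distrib cong: if_cong)
  qed
  then have "matrix_discriminant (diagm d) = (\<Prod>i\<in>UNIV. poly (pderiv (charpoly (diagm d))) (d i))"
    by (simp add: matrix_discriminant_def)
  moreover have "poly (pderiv (charpoly (diagm d))) (d i) \<noteq> 0" for i
  proof -
    have "poly (pderiv (charpoly (diagm d))) (d i) = (\<Sum>a\<in>UNIV. (\<Prod>j\<in>UNIV - {a}. d i - d j))"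
      unfolding cp pderiv_prod by (simp add: poly_sum poly_prod pderiv_pCons)
    also have "\<dots> = (\<Sum>a\<in>UNIV. if a = i then (\<Prod>j\<in>UNIV - {i}. d i - d j) else 0)"
      by (intro sum.cong) (auto simp: prod_zero_iff)
    also have "\<dots> = (\<Prod>j\<in>UNIV - {i}. d i - d j)" by simp
    also have "\<dots> \<noteq> 0" using d by (auto simp: prod_zero_iff inj_def)
    finally show ?thesis .
  qed
  ultimately show ?thesis by (simp add: prod_zero_iff)
qed

definition complexify :: "real^'n^'m \<Rightarrow> complex^'n^'m" where
  "complexify A = (\<chi> i j. complex_of_real (A $ i $ j))"

definition adjoint_matrix :: "complex^'n^'m \<Rightarrow> complex^'m^'n" where
  "adjoint_matrix A = (\<chi> i j. cnj (A $ j $ i))"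

lemma complexify_mult: "complexify (A ** B) = complexify A ** complexify B"
  by (simp add: complexify_def vec_eq_iff matrix_matrix_mult_def)

lemma complexify_one: "complexify (mat 1) = mat 1"
  by (simp add: complexify_def vec_eq_iff mat_def)

lemma complexify_inject: "complexify A = complexify B \<longleftrightarrow> A = B"
  by (simp add: complexify_def vec_eq_iff)

lemma adjoint_complexify: "adjoint_matrix (complexify A) = complexify (transpose A)"
  by (simp add: complexify_def adjoint_matrix_def transpose_def vec_eq_iff)

lemma adjoint_mult: "adjoint_matrix (A ** B) = adjoint_matrix B ** adjoint_matrix A"
  by (simp add: adjoint_matrix_def vec_eq_iff matrix_matrix_mult_def mult.commute)

lemma adjoint_adjoint: "adjoint_matrix (adjoint_matrix A) = A"
  by (simp add: adjoint_matrix_def vec_eq_iff)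

lemma det_complexify: "det (complexify A) = complex_of_real (det A)"
  using det_hom[of complex_of_real A] by (simp add: complexify_def)

lemma charpoly_complexify: "charpoly (complexify A) = map_poly complex_of_real (charpoly A)"
proof -
  have "map_poly complex_of_real (p + q) = map_poly complex_of_real p + map_poly complex_of_real q"
    "map_poly complex_of_real (p * q) = map_poly complex_of_real p * map_poly complex_of_real q" for p q
    by (simp_all add: poly_eq_iff coeff_map_poly coeff_mult)
  then have "map_poly complex_of_real (charpoly A)
      = det (\<chi> i j. map_poly complex_of_real ((\<chi> i j. [:- (A $ i $ j), if i = j then 1 else 0:]) $ i $ j))"
    unfolding charpoly_def by (intro det_hom[of "map_poly complex_of_real"]) auto
  also have "\<dots> = charpoly (complexify A)"
    unfolding charpoly_def by (rule arg_cong[of _ _ det]) (simp add: vec_eq_iff complexify_def map_poly_pCons)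
  finally show ?thesis ..
qed

lemma singular_kernel:
  fixes A :: "'a::field^'n^'n"
  shows "det A = 0 \<longleftrightarrow> (\<exists>x. x \<noteq> 0 \<and> A *v x = 0)"
  using invertible_det_nz[of A] matrix_left_invertible_ker[of A] invertible_left_inverse[of A] by blast

lemma charpoly_root_eigenvector:
  fixes A :: "'a::field^'n^'n"
  shows "poly (charpoly A) l = 0 \<longleftrightarrow> (\<exists>x. x \<noteq> 0 \<and> A *v x = l *s x)"
proof -
  have "((mat l - A) *v x = 0) = (A *v x = l *s x)" for x :: "'a^'n"
  proof -
    have "(mat l - A) *v x = l *s x - A *v x"
    proof -
      have "mat l *v x = l *s x"
        by (simp add: vec_eq_iff matrix_vector_mult_def mat_def if_distrib if_distribR sum.delta cong: if_cong)
      then show ?thesis by (simp add: matrix_vector_mult_diff_rdistrib)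
    qed
    then show ?thesis by auto
  qed
  then show ?thesis unfolding poly_charpoly singular_kernel by simp
qed

text \<open>An eigenvector for a multiple root would be annihilated by the matrix whose determinant is the
  discriminant.\<close>

lemma discriminant_simple_roots:
  fixes A :: "real^'n^'n"
  assumes D: "matrix_discriminant A \<noteq> 0"
  shows "card {l. poly (charpoly (complexify A)) l = 0} = CARD('n)"
proof -
  define f where "f = charpoly (complexify A)"
  have f0: "f \<noteq> 0" using charpoly_degree(1)[of "complexify A"] by (auto simp: f_def)
  have f_map: "coeff f i = complex_of_real (coeff (charpoly A) i)" for i
    by (simp add: f_def charpoly_complexify coeff_map_poly)
  have "\<not> (poly f l = 0 \<and> poly (pderiv f) l = 0)" for l
  proof
    assume l: "poly f l = 0 \<and> poly (pderiv f) l = 0"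
    then obtain x where x: "x \<noteq> 0" "complexify A *v x = l *s x"
      using charpoly_root_eigenvector unfolding f_def by blast
    have pow: "complexify (matpow A r) *v x = l ^ r *s x" for r
    proof (induction r)
      case 0 then show ?case by (simp add: complexify_one)
    next
      case (Suc r)
      have "complexify (matpow A (Suc r)) *v x = complexify A *v (complexify (matpow A r) *v x)"
        by (simp add: complexify_mult matrix_vector_mul_assoc)
      also have "\<dots> = l ^ r *s (complexify A *v x)" by (simp add: Suc vector_scalar_commute)
      finally show ?case by (simp add: x(2) mult.commute)
    qed
    define M where "M = (\<Sum>i\<le>CARD('n). coeff (pderiv (charpoly A)) i *\<^sub>R matpow A i)"
    have "(complexify M *v x) $ i = poly (pderiv f) l * x $ i" for i
    proof -
      have dg: "degree (pderiv f) \<le> CARD('n)"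
        using charpoly_degree(2)[of "complexify A"] by (simp add: degree_pderiv f_def)
      have "(complexify M *v x) $ i = (\<Sum>j\<in>UNIV. (\<Sum>r\<le>CARD('n). coeff (pderiv f) r * complex_of_real (matpow A r $ i $ j)) * x $ j)"
        by (simp add: complexify_def M_def matrix_vector_mult_def sum_component coeff_pderiv f_map)
      also have "\<dots> = (\<Sum>r\<le>CARD('n). coeff (pderiv f) r * (complexify (matpow A r) *v x) $ i)"
        unfolding sum_distrib_right by (subst sum.swap) (simp add: complexify_def matrix_vector_mult_def sum_distrib_left mult.assoc)
      also have "\<dots> = (\<Sum>r\<le>CARD('n). coeff (pderiv f) r * l ^ r) * x $ i"
        by (simp add: pow sum_distrib_right mult.assoc)
      also have "(\<Sum>r\<le>CARD('n). coeff (pderiv f) r * l ^ r) = (\<Sum>r\<le>degree (pderiv f). coeff (pderiv f) r * l ^ r)"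
        using dg by (intro sum.mono_neutral_right) (auto intro: coeff_eq_0)
      finally show ?thesis by (simp add: poly_altdef)
    qed
    then have "complexify M *v x = 0" using l by (simp add: vec_eq_iff)
    then have "det (complexify M) = 0" using x(1) singular_kernel by blast
    then show False using D by (simp add: det_complexify matrix_discriminant_def M_def)
  qed
  then have "rsquarefree f" by (simp add: rsquarefree_roots)
  then have "f = smult (lead_coeff f) (\<Prod>z|poly f z = 0. [:-z, 1:])"
    using complex_poly_decompose_rsquarefree by metis
  then have "degree f = degree (\<Prod>z|poly f z = 0. [:-z, 1:])" using f0 by (metis degree_smult_eq leading_coeff_0_iff)
  also have "\<dots> = card {z. poly f z = 0}" by (subst degree_prod_eq_sum_degree) auto
  finally show ?thesis using charpoly_degree(2)[of "complexify A"] by (simp add: f_def)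
qed

lemma real_eigenvector:
  fixes A :: "real^'n^'n"
  assumes "poly (charpoly (complexify A)) (complex_of_real l) = 0"
  obtains x where "x \<noteq> 0" "complexify A *v x = complex_of_real l *s x" "\<And>i. cnj (x $ i) = x $ i"
proof -
  have "mat (complex_of_real l) - complexify A = complexify (mat l - A)"
    by (simp add: vec_eq_iff complexify_def mat_def)
  then have "det (mat l - A) = 0" using assms by (simp add: poly_charpoly det_complexify)
  then have "poly (charpoly A) l = 0" by (simp add: poly_charpoly)
  then obtain y where y: "y \<noteq> 0" "A *v y = l *s y" using charpoly_root_eigenvector by blast
  define x :: "complex^'n" where "x = (\<chi> i. complex_of_real (y $ i))"
  have "(complexify A *v x) $ i = complex_of_real ((A *v y) $ i)" for i
    by (simp add: complexify_def x_def matrix_vector_mult_def)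
  then have "complexify A *v x = complex_of_real l *s x" by (simp add: vec_eq_iff y(2) x_def)
  moreover have "x \<noteq> 0" using y(1) by (simp add: vec_eq_iff x_def)
  moreover have "cnj (x $ i) = x $ i" for i by (simp add: x_def)
  ultimately show ?thesis by (intro that[of x])
qed

text \<open>From a nontrivial linear relation of minimal length between the eigenvectors, \<open>A - l\<^sub>j\<close> produces a shorter one.\<close>

lemma distinct_eigenvectors_invertible:
  fixes A Z :: "'a::field^'n^'n"
  assumes AZ: "A ** Z = Z ** diagm l" and l: "inj l" and nz: "\<And>j. column j Z \<noteq> 0"
  shows "invertible Z"
proof -
  have ker: "c = 0" if "Z *v c = 0" for c
    using that
  proof (induction "card {j. c $ j \<noteq> 0}" arbitrary: c rule: less_induct)
    case less
    show ?case
    proof (rule ccontr)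
      assume "c \<noteq> 0"
      then obtain j0 where j0: "c $ j0 \<noteq> 0" by (auto simp: vec_eq_iff)
      define c' where "c' = (\<chi> j. (l j - l j0) * c $ j)"
      have "c' = diagm l *v c - l j0 *s c" by (simp add: c'_def vec_eq_iff left_diff_distrib)
      then have "Z *v c' = Z *v (diagm l *v c) - l j0 *s (Z *v c)"
        by (simp add: matrix_vector_mult_diff_distrib vector_scalar_commute)
      also have "Z *v (diagm l *v c) = A *v (Z *v c)" by (simp add: matrix_vector_mul_assoc AZ)
      finally have Zc': "Z *v c' = 0" using less.prems by simp
      have "{j. c' $ j \<noteq> 0} \<subset> {j. c $ j \<noteq> 0}" using j0 by (auto simp: c'_def)
      then have "card {j. c' $ j \<noteq> 0} < card {j. c $ j \<noteq> 0}" by (intro psubset_card_mono) auto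
      then have "c' = 0" using less.hyps Zc' by blast
      then have "c $ j = 0" if "j \<noteq> j0" for j
        using that l by (auto simp: c'_def vec_eq_iff inj_def)
      then have c: "c = c $ j0 *s axis j0 1" by (auto simp: vec_eq_iff axis_def)
      have "Z *v c = Z *v (c $ j0 *s axis j0 1)" by (rule arg_cong[OF c])
      also have "\<dots> = c $ j0 *s column j0 Z"
      proof -
        have "Z *v axis j0 1 = column j0 Z"
          by (simp add: vec_eq_iff matrix_vector_mult_def axis_def column_def if_distrib cong: if_cong)
        then show ?thesis by (simp add: vector_scalar_commute)
      qed
      finally have "Z *v c = c $ j0 *s column j0 Z" .
      then have "column j0 Z = 0" using less.prems j0 by (simp add: vec_eq_iff)
      then show False using nz by blast
    qed
  qed
  then show ?thesis using matrix_left_invertible_ker[of Z] invertible_left_inverse[of Z] by blast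
qed

text \<open>Eigenvectors can be chosen compatibly with complex conjugation. If \<open>Z\<close> has these columns, then
  \<open>Z Z\<^sup>*\<close> is real and of the form \<open>L L\<^sup>T\<close>, so that \<open>U = L\<^sup>-\<^sup>1 Z\<close> is unitary and diagonalises \<open>L\<^sup>-\<^sup>1 A L\<close>.\<close>

lemma discriminant_similar_to_normal:
  fixes A :: "real^'n^'n"
  assumes D: "matrix_discriminant A \<noteq> 0"
  obtains L L' :: "real^'n^'n" where "L ** L' = mat 1" "L' ** L = mat 1"
    "(L' ** A ** L) ** transpose (L' ** A ** L) = transpose (L' ** A ** L) ** (L' ** A ** L)"
proof -
  define \<Lambda> where "\<Lambda> = {l. poly (charpoly (complexify A)) l = 0}"
  have card\<Lambda>: "card \<Lambda> = CARD('n)" unfolding \<Lambda>_def by (rule discriminant_simple_roots[OF D])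
  then have fin\<Lambda>: "finite \<Lambda>" by (metis card.infinite zero_less_card_finite less_numeral_extra(3))
  obtain b where b: "bij_betw b (UNIV::'n set) \<Lambda>"
    using finite_same_card_bij[of "UNIV::'n set" \<Lambda>] card\<Lambda> fin\<Lambda> by auto
  define cj where "cj = (\<lambda>x::complex^'n. \<chi> i. cnj (x $ i))"
  have cj_eig: "complexify A *v cj x = cnj l *s cj x" if "complexify A *v x = l *s x" for x l
  proof -
    have "(complexify A *v cj x) $ i = cnj ((complexify A *v x) $ i)" for i
      by (simp add: complexify_def cj_def matrix_vector_mult_def)
    then show ?thesis by (simp add: vec_eq_iff that cj_def)
  qed
  have cj_nz: "cj x \<noteq> 0" if "x \<noteq> 0" for x using that by (simp add: cj_def vec_eq_iff)
  have cjcj: "cj (cj x) = x" for x by (simp add: cj_def vec_eq_iff)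
  have "\<exists>x. x \<noteq> 0 \<and> complexify A *v x = l *s x \<and> (Im l = 0 \<longrightarrow> cj x = x)" if l: "l \<in> \<Lambda>" for l
  proof (cases "Im l = 0")
    case True
    then have "l = complex_of_real (Re l)" by (simp add: complex_eq_iff)
    then show ?thesis using real_eigenvector[of A "Re l"] l unfolding \<Lambda>_def mem_Collect_eq cj_def
      by (metis (no_types, lifting) vec_eq_iff vec_lambda_beta)
  next
    case False then show ?thesis using l charpoly_root_eigenvector unfolding \<Lambda>_def by blast
  qed
  then obtain v where v: "\<And>l. l \<in> \<Lambda> \<Longrightarrow> v l \<noteq> 0" "\<And>l. l \<in> \<Lambda> \<Longrightarrow> complexify A *v v l = l *s v l"
    "\<And>l. l \<in> \<Lambda> \<Longrightarrow> Im l = 0 \<Longrightarrow> cj (v l) = v l" by metis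
  have cnj\<Lambda>: "cnj l \<in> \<Lambda>" if "l \<in> \<Lambda>" for l
    using cj_eig[OF v(2)[OF that]] cj_nz[OF v(1)[OF that]] charpoly_root_eigenvector unfolding \<Lambda>_def by blast
  \<comment> \<open>From each pair of conjugate eigenvalues the one in the upper half-plane determines both eigenvectors.\<close>
  define z where "z = (\<lambda>l. if Im l < 0 then cj (v (cnj l)) else v l)"
  have z_nz: "z l \<noteq> 0" if "l \<in> \<Lambda>" for l using v(1) cnj\<Lambda> cj_nz that by (auto simp: z_def)
  have z_eig: "complexify A *v z l = l *s z l" if "l \<in> \<Lambda>" for l
    using v(2)[OF that] cj_eig[OF v(2)[OF cnj\<Lambda>[OF that]]] by (auto simp: z_def)
  have z_cnj: "z (cnj l) = cj (z l)" if "l \<in> \<Lambda>" for l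
    using v(3)[OF that] by (cases "Im l" "0::real" rule: linorder_cases) (auto simp: z_def cjcj complex_cnj_cancel_iff complex_eq_iff, metis complex_cnj complex_surj minus_zero)
  define Z :: "complex^'n^'n" where "Z = (\<chi> i j. z (b j) $ i)"
  have bj: "b j \<in> \<Lambda>" for j using b by (auto simp: bij_betw_def)
  have AZ: "complexify A ** Z = Z ** diagm b"
  proof -
    have "(complexify A ** Z) $ i $ j = (complexify A *v z (b j)) $ i" for i j
      by (simp add: Z_def matrix_matrix_mult_def matrix_vector_mult_def)
    then show ?thesis by (simp add: vec_eq_iff z_eig[OF bj] Z_def)
  qed
  have "column j Z = z (b j)" for j by (simp add: column_def Z_def vec_eq_iff)
  then have invZ: "invertible Z" using z_nz[OF bj] b
    by (intro distinct_eigenvectors_invertible[OF AZ]) (auto simp: bij_betw_def)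
  \<comment> \<open>The entries are sums over all eigenvalues, which conjugation permutes.\<close>
  have real: "cnj ((Z ** adjoint_matrix Z) $ i $ k) = (Z ** adjoint_matrix Z) $ i $ k" for i k
  proof -
    have ZZ: "(Z ** adjoint_matrix Z) $ i $ k = (\<Sum>l\<in>\<Lambda>. z l $ i * cnj (z l $ k))"
      using sum.reindex_bij_betw[OF b, of "\<lambda>l. z l $ i * cnj (z l $ k)"]
      by (simp add: matrix_matrix_mult_def adjoint_matrix_def Z_def)
    have bc: "bij_betw cnj \<Lambda> \<Lambda>" using cnj\<Lambda> by (intro bij_betw_byWitness[of _ cnj]) auto
    have "cnj (\<Sum>l\<in>\<Lambda>. z l $ i * cnj (z l $ k)) = (\<Sum>l\<in>\<Lambda>. z (cnj l) $ i * cnj (z (cnj l) $ k))"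
      by (simp add: z_cnj cj_def)
    also have "\<dots> = (\<Sum>l\<in>\<Lambda>. z l $ i * cnj (z l $ k))" by (rule sum.reindex_bij_betw[OF bc])
    finally show ?thesis unfolding ZZ .
  qed
  define P :: "real^'n^'n" where "P = (\<chi> i k. Re ((Z ** adjoint_matrix Z) $ i $ k))"
  have ZP: "Z ** adjoint_matrix Z = complexify P"
    using real by (simp add: vec_eq_iff complexify_def P_def complex_eq_iff)
  have "P \<in> PD" unfolding PD_def
  proof (intro CollectI conjI allI impI)
    have "complexify (transpose P) = adjoint_matrix (Z ** adjoint_matrix Z)" by (simp add: ZP adjoint_complexify)
    also have "\<dots> = Z ** adjoint_matrix Z" by (simp only: adjoint_mult adjoint_adjoint)
    also have "\<dots> = complexify P" by (rule ZP)
    finally show "transpose P = P" by (simp add: complexify_inject)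
    fix x :: "real^'n" assume x: "x \<noteq> 0"
    define c where "c = (\<lambda>j. \<Sum>i\<in>UNIV. complex_of_real (x $ i) * Z $ i $ j)"
    have "complex_of_real (x \<bullet> (P *v x)) = (\<Sum>i\<in>UNIV. \<Sum>k\<in>UNIV. complex_of_real (x $ i) * complexify P $ i $ k * complex_of_real (x $ k))"
      by (simp add: inner_vec_def matrix_vector_mult_def complexify_def sum_distrib_left mult.assoc)
    also have "\<dots> = (\<Sum>i\<in>UNIV. \<Sum>k\<in>UNIV. \<Sum>j\<in>UNIV. (complex_of_real (x $ i) * Z $ i $ j) * cnj (complex_of_real (x $ k) * Z $ k $ j))"
      unfolding ZP[symmetric] by (simp add: matrix_matrix_mult_def adjoint_matrix_def sum_distrib_left sum_distrib_right mult_ac)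
    also have "\<dots> = (\<Sum>i\<in>UNIV. \<Sum>j\<in>UNIV. \<Sum>k\<in>UNIV. (complex_of_real (x $ i) * Z $ i $ j) * cnj (complex_of_real (x $ k) * Z $ k $ j))"
      by (intro sum.cong[OF refl] sum.swap)
    also have "\<dots> = (\<Sum>j\<in>UNIV. \<Sum>i\<in>UNIV. \<Sum>k\<in>UNIV. (complex_of_real (x $ i) * Z $ i $ j) * cnj (complex_of_real (x $ k) * Z $ k $ j))"
      by (rule sum.swap)
    also have "\<dots> = (\<Sum>j\<in>UNIV. c j * cnj (c j))"
      by (simp only: c_def sum_product cnj_sum)
    also have "\<dots> = complex_of_real (\<Sum>j\<in>UNIV. (cmod (c j))\<^sup>2)" by (simp only: of_real_sum complex_norm_square)
    finally have q: "x \<bullet> (P *v x) = (\<Sum>j\<in>UNIV. (cmod (c j))\<^sup>2)" using of_real_eq_iff by blast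
    have "\<exists>j. c j \<noteq> 0"
    proof (rule ccontr)
      assume "\<not> ?thesis"
      then have "transpose Z *v (\<chi> i. complex_of_real (x $ i)) = 0"
        by (simp add: vec_eq_iff matrix_vector_mult_def transpose_def c_def mult.commute)
      moreover have "(\<chi> i. complex_of_real (x $ i)) \<noteq> 0" using x by (simp add: vec_eq_iff)
      ultimately have "det (transpose Z) = 0" using singular_kernel by blast
      then show False using invZ by (simp add: invertible_det_nz)
    qed
    then obtain j where "c j \<noteq> 0" by blast
    then have "0 < (cmod (c j))\<^sup>2" by simp
    also have "\<dots> \<le> (\<Sum>j\<in>UNIV. (cmod (c j))\<^sup>2)" by (intro member_le_sum) auto
    finally show "0 < x \<bullet> (P *v x)" by (simp add: q)
  qed
  then obtain C :: "real^'n^'n" where C: "invertible C" "P = transpose C ** C" using PD_factorization by metis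
  define L where "L = transpose C"
  have "invertible L" unfolding L_def using C(1) by (rule invertible_transpose)
  then obtain L' where L': "L ** L' = mat 1" "L' ** L = mat 1" unfolding invertible_def by blast
  have PL: "P = L ** transpose L" by (simp add: L_def C(2))
  have TL: "transpose L ** transpose L' = mat 1" by (rule transpose_inverse[OF L'(2)])
  define U where "U = complexify L' ** Z"
  have "U ** adjoint_matrix U = complexify L' ** (Z ** adjoint_matrix Z) ** complexify (transpose L')"
    by (simp add: U_def adjoint_mult adjoint_complexify matrix_mul_assoc)
  also have "\<dots> = complexify ((L' ** L) ** (transpose L ** transpose L'))"
    unfolding ZP PL by (simp only: complexify_mult matrix_mul_assoc)
  finally have U1: "U ** adjoint_matrix U = mat 1" by (simp only: L' TL matrix_mul_lid complexify_one)
  then have U2: "adjoint_matrix U ** U = mat 1" by (simp add: matrix_left_right_inverse)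
  define N where "N = L' ** A ** L"
  have "complexify N ** U = complexify L' ** complexify A ** complexify (L ** L') ** Z"
    unfolding N_def U_def by (simp only: complexify_mult matrix_mul_assoc)
  also have "\<dots> = complexify L' ** (complexify A ** Z)" by (simp only: L' complexify_one matrix_mul_rid matrix_mul_assoc)
  also have "\<dots> = U ** diagm b" by (simp only: AZ U_def matrix_mul_assoc)
  finally have NU: "complexify N ** U = U ** diagm b" .
  have "complexify N = complexify N ** (U ** adjoint_matrix U)" by (simp only: U1 matrix_mul_rid)
  then have N: "complexify N = U ** diagm b ** adjoint_matrix U" using NU by (simp add: matrix_mul_assoc)
  have adj_diag: "adjoint_matrix (diagm b) = diagm (\<lambda>j. cnj (b j))" by (simp add: adjoint_matrix_def vec_eq_iff)
  have Na: "complexify (transpose N) = U ** diagm (\<lambda>j. cnj (b j)) ** adjoint_matrix U"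
    unfolding adjoint_complexify[symmetric] N adjoint_mult adjoint_adjoint adj_diag by (simp add: matrix_mul_assoc)
  have "complexify (N ** transpose N) = U ** diagm b ** (adjoint_matrix U ** U) ** diagm (\<lambda>j. cnj (b j)) ** adjoint_matrix U"
    unfolding complexify_mult Na N by (simp only: matrix_mul_assoc)
  also have "\<dots> = U ** (diagm b ** diagm (\<lambda>j. cnj (b j))) ** adjoint_matrix U"
    by (simp only: U2 matrix_mul_rid matrix_mul_assoc)
  also have "\<dots> = U ** (diagm (\<lambda>j. cnj (b j)) ** diagm b) ** adjoint_matrix U"
    by (simp add: diagm_mult_diagm mult.commute)
  also have "\<dots> = U ** diagm (\<lambda>j. cnj (b j)) ** (adjoint_matrix U ** U) ** diagm b ** adjoint_matrix U"
    by (simp only: U2 matrix_mul_rid matrix_mul_assoc)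
  also have "\<dots> = complexify (transpose N ** N)"
    unfolding complexify_mult Na N by (simp only: matrix_mul_assoc)
  finally have "N ** transpose N = transpose N ** N" by (simp add: complexify_inject)
  then show ?thesis using that[OF L'] by (simp add: N_def)
qed

section \<open>Samples of square matrices\<close>

text \<open>If the two index types have the same size, a permutation matrix \<open>E\<close> identifies them, and \<open>Y\<^sub>i E\<close> is a square
  matrix for which determinants and eigenvalues make sense.\<close>

lemma square_identification:
  assumes "CARD('m1::finite) = CARD('m2::finite)"
  obtains E :: "real^'m1^'m2" where "transpose E ** E = mat 1" "E ** transpose E = mat 1"
proof -
  obtain h where h: "bij_betw h (UNIV::'m2 set) (UNIV::'m1 set)"
    using finite_same_card_bij[of "UNIV::'m2 set" "UNIV::'m1 set"] assms by auto
  define E :: "real^'m1^'m2" where "E = (\<chi> b a. if a = h b then 1 else 0)"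
  have inj: "(h b = h c) = (b = c)" for b c using h by (auto simp: bij_betw_def inj_def)
  have "(E ** transpose E) $ b $ c = mat 1 $ b $ c" for b c
  proof -
    have "(E ** transpose E) $ b $ c = (\<Sum>a\<in>UNIV. if a = h b then (if h b = h c then 1 else 0) else 0)"
      unfolding matrix_matrix_mult_def transpose_def vec_lambda_beta E_def by (intro sum.cong) auto
    then show ?thesis by (simp add: mat_def inj)
  qed
  moreover have "(transpose E ** E) $ a $ c = mat 1 $ a $ c" for a c
  proof -
    obtain b where b: "a = h b" using h by (auto simp: bij_betw_def)
    have "(transpose E ** E) $ a $ c = (\<Sum>b'\<in>UNIV. if b' = b then (if c = h b then 1 else 0) else 0)"
      unfolding matrix_matrix_mult_def transpose_def vec_lambda_beta E_def
      by (intro sum.cong) (auto simp: b inj)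
    then show ?thesis by (auto simp: mat_def b)
  qed
  ultimately show ?thesis by (intro that[of E]) (simp_all add: vec_eq_iff)
qed

lemma square_balanced_mle_exists:
  fixes Y :: "nat \<Rightarrow> real^'m2^'m1" and E :: "real^'m1^'m2" and A C :: "real^'m1^'m1"
  assumes E: "transpose E ** E = mat 1" "E ** transpose E = mat 1" and card: "CARD('m1) = CARD('m2)"
    and n: "n > 0" and A: "invertible A" and C: "invertible C"
  defines "G \<equiv> \<lambda>i. A ** (Y i ** E) ** transpose C"
  assumes row: "(\<Sum>i<n. G i ** transpose (G i)) = mat 1" and col: "(\<Sum>i<n. transpose (G i) ** G i) = mat 1"
  shows "mle_exists n Y"
proof -
  define t where "t = sqrt (real n * real CARD('m2))"
  have t: "t \<noteq> 0" "t * t = real n * real CARD('m2)" using n by (simp_all add: t_def)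
  define B where "B = E ** C ** transpose E"
  have tA: "invertible (t *\<^sub>R A)" using A t by (simp add: invertible_det_nz det_scaleR_matrix)
  have B: "invertible B"
  proof -
    obtain C' where C': "C ** C' = mat 1" "C' ** C = mat 1" using C invertible_def by blast
    have "(E ** C' ** transpose E) ** B = E ** C' ** (transpose E ** E) ** C ** transpose E"
      by (simp only: B_def matrix_mul_assoc)
    also have "\<dots> = E ** (C' ** C) ** transpose E" by (simp only: E matrix_mul_rid matrix_mul_assoc)
    also have "\<dots> = mat 1" by (simp only: C' E matrix_mul_rid)
    finally show ?thesis using invertible_left_inverse by blast
  qed
  have H: "t *\<^sub>R A ** Y i ** transpose B = t *\<^sub>R (G i ** transpose E)" for i
    by (simp add: G_def B_def matrix_transpose_mul scaleR_matrix_mult matrix_mul_assoc)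
  have scal: "mat (t * t) = (t * t) *\<^sub>R (mat 1 :: real^'k^'k)" by (simp add: vec_eq_iff mat_def)
  have HHT: "(t *\<^sub>R (G i ** transpose E)) ** transpose (t *\<^sub>R (G i ** transpose E)) = (t * t) *\<^sub>R (G i ** transpose (G i))" for i
  proof -
    have "(G i ** transpose E) ** transpose (G i ** transpose E) = G i ** (transpose E ** E) ** transpose (G i)"
      by (simp add: matrix_transpose_mul matrix_mul_assoc)
    then show ?thesis
      by (simp add: E transpose_scaleR scaleR_matrix_mult matrix_mult_scaleR)
  qed
  have HTH: "transpose (t *\<^sub>R (G i ** transpose E)) ** (t *\<^sub>R (G i ** transpose E)) = (t * t) *\<^sub>R (E ** (transpose (G i) ** G i) ** transpose E)" for i
    by (simp add: transpose_scaleR scaleR_matrix_mult matrix_mult_scaleR matrix_transpose_mul matrix_mul_assoc)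
  have "mle_exists n (\<lambda>i. t *\<^sub>R A ** Y i ** transpose B)"
    unfolding H
  proof (rule balanced_mle_exists)
    show "(\<Sum>i<n. (t *\<^sub>R (G i ** transpose E)) ** transpose (t *\<^sub>R (G i ** transpose E))) = mat (real n * real CARD('m2))"
      unfolding HHT scaleR_sum_right[symmetric] row t(2)[symmetric] by (simp add: vec_eq_iff mat_def)
    have "(\<Sum>i<n. E ** (transpose (G i) ** G i) ** transpose E) = E ** (\<Sum>i<n. transpose (G i) ** G i) ** transpose E"
      by (simp add: matrix_mult_sum_right matrix_mult_sum_left)
    also have "\<dots> = mat 1" by (simp only: col E matrix_mul_rid)
    finally show "(\<Sum>i<n. transpose (t *\<^sub>R (G i ** transpose E)) ** (t *\<^sub>R (G i ** transpose E))) = mat (real n * real CARD('m1))"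
      unfolding HTH scaleR_sum_right[symmetric] card t(2)[symmetric] by (simp add: vec_eq_iff mat_def)
  qed
  then show ?thesis by (rule mle_exists_congruence[OF tA B])
qed

lemma square_not_unique:
  fixes Y :: "nat \<Rightarrow> real^'m2^'m1" and E :: "real^'m1^'m2" and X X1 :: "real^'m1^'m1"
  assumes E: "transpose E ** E = mat 1" "E ** transpose E = mat 1" and X: "invertible X1" "invertible X"
    and comm: "\<And>i. i < n \<Longrightarrow> X1 ** (Y i ** E) = (Y i ** E) ** X"
    and e: "transpose X *v e = l *\<^sub>R e" "e \<noteq> 0" and f: "transpose X *v f = k *\<^sub>R f" "f \<noteq> 0" and lk: "l\<^sup>2 \<noteq> k\<^sup>2"
  shows "\<not> mle_exists_uniquely n Y"
proof -
  define X2 where "X2 = E ** X ** transpose E"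
  obtain X' where X': "X ** X' = mat 1" "X' ** X = mat 1" using X(2) invertible_def by blast
  have "(E ** X' ** transpose E) ** X2 = E ** X' ** (transpose E ** E) ** X ** transpose E"
    by (simp only: X2_def matrix_mul_assoc)
  also have "\<dots> = E ** (X' ** X) ** transpose E" by (simp only: E matrix_mul_rid matrix_mul_assoc)
  also have "\<dots> = mat 1" by (simp only: X' E matrix_mul_rid)
  finally have inv: "invertible X2" using invertible_left_inverse by blast
  have c: "X1 ** Y i = Y i ** X2" if "i < n" for i
  proof -
    have "X1 ** Y i = X1 ** (Y i ** (E ** transpose E))" by (simp only: E matrix_mul_rid)
    also have "\<dots> = (X1 ** (Y i ** E)) ** transpose E" by (simp only: matrix_mul_assoc)
    also have "\<dots> = Y i ** X2" unfolding comm[OF that] X2_def by (simp only: matrix_mul_assoc)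
    finally show ?thesis .
  qed
  have eig: "transpose X2 *v (E *v x) = r *\<^sub>R (E *v x)" "E *v x \<noteq> 0" if x: "transpose X *v x = r *\<^sub>R x" "x \<noteq> 0" for x r
  proof -
    have ee: "transpose E *v (E *v x) = x" by (simp only: matrix_vector_mul_assoc E matrix_vector_mul_lid)
    have "transpose X2 *v (E *v x) = E *v (transpose X *v (transpose E *v (E *v x)))"
      by (simp only: X2_def matrix_transpose_mul transpose_transpose matrix_vector_mul_assoc matrix_mul_assoc)
    then show "transpose X2 *v (E *v x) = r *\<^sub>R (E *v x)" unfolding ee x(1) by (simp only: matrix_vector_mult_scaleR)
    show "E *v x \<noteq> 0" using ee x(2) by force
  qed
  show ?thesis
    by (rule not_unique_if_symmetry[OF X(1) inv c eig[OF e] eig[OF f] lk])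
qed

lemma one_square_sample_mle_exists:
  fixes Y :: "nat \<Rightarrow> real^'m2^'m1" and E :: "real^'m1^'m2"
  assumes E: "transpose E ** E = mat 1" "E ** transpose E = mat 1" and card: "CARD('m1) = CARD('m2)"
    and det: "det (Y 0 ** E) \<noteq> 0"
  shows "mle_exists 1 Y"
proof -
  obtain A where A: "(Y 0 ** E) ** A = mat 1" "A ** (Y 0 ** E) = mat 1" using det invertible_det_nz invertible_def by metis
  have "invertible A" using A invertible_def by blast
  moreover have "A ** (Y 0 ** E) ** transpose (mat 1) = mat 1" by (simp only: A transpose_mat matrix_mul_rid)
  moreover have "invertible (mat 1 :: real^'m1^'m1)" by (simp add: invertible_det_nz)
  ultimately show ?thesis
    by (intro square_balanced_mle_exists[OF E card, of 1 A "mat 1"]) (simp_all del: matrix_mul_rid)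
qed

lemma one_square_sample_not_unique:
  fixes Y :: "nat \<Rightarrow> real^'m2^'m1" and E :: "real^'m1^'m2"
  assumes E: "transpose E ** E = mat 1" "E ** transpose E = mat 1" and card: "CARD('m1) \<ge> 2"
    and det: "det (Y 0 ** E) \<noteq> 0"
  shows "\<not> mle_exists_uniquely 1 Y"
proof -
  obtain S' where S': "(Y 0 ** E) ** S' = mat 1" "S' ** (Y 0 ** E) = mat 1" using det invertible_det_nz invertible_def by metis
  obtain a0 a1 :: 'm1 where a: "a0 \<noteq> a1" using card by (metis card_2_iff' card_le_Suc0_iff_eq finite iso_tuple_UNIV_I not_less_eq_eq numeral_2_eq_2)
  define X :: "real^'m1^'m1" where "X = diagm (\<lambda>a. if a = a0 then 2 else 1)"
  have X: "invertible X" by (simp add: X_def invertible_det_nz)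
  define X1 where "X1 = (Y 0 ** E) ** X ** S'"
  have "invertible (Y 0 ** E)" "invertible S'" using S' invertible_def by blast+
  then have X1: "invertible X1" unfolding X1_def using X invertible_mult by metis
  have "X1 ** (Y 0 ** E) = (Y 0 ** E) ** X ** (S' ** (Y 0 ** E))" by (simp only: X1_def matrix_mul_assoc)
  then have comm: "X1 ** (Y 0 ** E) = (Y 0 ** E) ** X" by (simp only: S' matrix_mul_rid)
  have eig: "transpose X *v axis a 1 = (if a = a0 then 2 else 1) *\<^sub>R axis a 1" for a
    by (simp add: X_def vec_eq_iff axis_def del: transpose_matrix_vector)
  have nz: "axis a (1::real) \<noteq> 0" for a :: 'm1 by simp
  show ?thesis
    by (rule square_not_unique[OF E X1 X _ eig[of a0] nz eig[of a1] nz]) (use comm a in auto)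
qed

text \<open>The columns given by Cramer's rule. Multiplication by this matrix replaces that by the inverse, but depends
  polynomially on the entries.\<close>

definition adjugate :: "real^'n^'n \<Rightarrow> real^'n^'n" where
  "adjugate A = (\<chi> k l. det (\<chi> i j. if j = k then axis l 1 $ i else A $ i $ j))"

lemma adjugate_mult:
  fixes A :: "real^'n^'n"
  assumes A: "det A \<noteq> 0"
  shows "adjugate A ** A = mat (det A)"
proof -
  have "A *v (\<chi> k. adjugate A $ k $ l / det A) = axis l 1" for l
    unfolding cramer[OF A] by (simp add: adjugate_def)
  then have "(A ** (\<chi> k l. adjugate A $ k $ l / det A)) $ i $ l = mat 1 $ i $ l" for i l
    by (simp add: vec_eq_iff matrix_matrix_mult_def matrix_vector_mult_def mat_def axis_def)
  then have "A ** (\<chi> k l. adjugate A $ k $ l / det A) = mat 1" by (simp add: vec_eq_iff)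
  then have "(\<chi> k l. adjugate A $ k $ l / det A) ** A = mat 1" by (simp add: matrix_left_right_inverse)
  then have "((\<chi> k l. adjugate A $ k $ l / det A) ** A) $ i $ j = mat 1 $ i $ j" for i j by simp
  moreover have "((\<chi> k l. adjugate A $ k $ l / det A) ** A) $ i $ j = (adjugate A ** A) $ i $ j / det A" for i j
    by (simp add: matrix_matrix_mult_def sum_divide_distrib)
  ultimately have "(adjugate A ** A) $ i $ j = det A * mat 1 $ i $ j" for i j using A by (simp add: field_simps)
  then show ?thesis by (simp add: vec_eq_iff mat_def)
qed

lemma adjugate_invertible:
  fixes A :: "real^'n^'n"
  assumes A: "det A \<noteq> 0"
  shows "invertible (adjugate A)"
proof -
  have "det (adjugate A) * det A = det (mat (det A) :: real^'n^'n)" by (metis adjugate_mult[OF A] det_mul)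
  also have "mat (det A) = diagm (\<lambda>_. det A)" by (simp add: vec_eq_iff mat_def)
  finally have "det (adjugate A) * det A \<noteq> 0" using A by simp
  then show ?thesis by (auto simp: invertible_det_nz)
qed

text \<open>After a change of coordinates the pair is \<open>(\<delta>, N)\<close> with \<open>N\<close> normal. Then \<open>\<delta>\<^sup>2 + N N\<^sup>T\<close> commutes with \<open>N\<close>, and
  weighting the columns by its inverse balances the pair.\<close>

lemma two_square_samples_mle_exists:
  fixes Y :: "nat \<Rightarrow> real^'m2^'m1" and E :: "real^'m1^'m2"
  assumes E: "transpose E ** E = mat 1" "E ** transpose E = mat 1" and card: "CARD('m1) = CARD('m2)"
    and det: "det (Y 0 ** E) \<noteq> 0" and disc: "matrix_discriminant (adjugate (Y 0 ** E) ** (Y 1 ** E)) \<noteq> 0"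
  shows "mle_exists 2 Y"
proof -
  define S0 where "S0 = Y 0 ** E"
  define S1 where "S1 = Y 1 ** E"
  define \<delta> where "\<delta> = det S0"
  have \<delta>: "\<delta> \<noteq> 0" using det by (simp add: \<delta>_def S0_def)
  have adj: "adjugate S0 ** S0 = mat \<delta>" unfolding \<delta>_def by (rule adjugate_mult) (use det in \<open>simp add: S0_def\<close>)
  obtain L L' :: "real^'m1^'m1" where L: "L ** L' = mat 1" "L' ** L = mat 1"
    and normal: "(L' ** (adjugate S0 ** S1) ** L) ** transpose (L' ** (adjugate S0 ** S1) ** L)
      = transpose (L' ** (adjugate S0 ** S1) ** L) ** (L' ** (adjugate S0 ** S1) ** L)"
    using discriminant_similar_to_normal[OF disc] unfolding S0_def S1_def by blast
  define N where "N = L' ** (adjugate S0 ** S1) ** L"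
  have NN: "N ** transpose N = transpose N ** N" using normal by (simp add: N_def)
  define H where "H = mat (\<delta> * \<delta>) + N ** transpose N"
  have HN: "H ** N = N ** H"
  proof -
    have "N ** (N ** transpose N) = N ** (transpose N ** N)" by (simp only: NN)
    then have "N ** transpose N ** N = N ** (N ** transpose N)" by (simp only: matrix_mul_assoc)
    moreover have "mat (\<delta> * \<delta>) ** N = N ** mat (\<delta> * \<delta>)" by (rule mat_mult_commute)
    ultimately show ?thesis by (simp only: H_def matrix_add_rdistrib matrix_add_ldistrib)
  qed
  have HPD: "H \<in> PD" unfolding PD_def
  proof (intro CollectI conjI allI impI)
    have "transpose (mat (\<delta> * \<delta>) + N ** transpose N) = transpose (mat (\<delta> * \<delta>)) + transpose (N ** transpose N)"
      by (simp add: transpose_def vec_eq_iff)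
    then show "transpose H = H" by (simp add: H_def matrix_transpose_mul)
    fix x :: "real^'m1" assume x: "x \<noteq> 0"
    have "x \<bullet> ((N ** transpose N) *v x) = (transpose N *v x) \<bullet> (transpose N *v x)"
      using dot_matrix_vector_transpose[of x N "transpose N *v x"] by (simp only: matrix_vector_mul_assoc)
    then have "x \<bullet> (H *v x) = (\<delta> * \<delta>) * (x \<bullet> x) + (transpose N *v x) \<bullet> (transpose N *v x)"
      by (simp add: H_def matrix_vector_mult_add_rdistrib mat_mult_vector inner_add_right del: transpose_matrix_vector)
    moreover have "(\<delta> * \<delta>) * (x \<bullet> x) > 0" using x \<delta> by (simp add: zero_less_mult_iff linorder_neq_iff disj_commute)
    ultimately show "0 < x \<bullet> (H *v x)" using inner_ge_zero[of "transpose N *v x"] by linarith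
  qed
  obtain F :: "real^'m1^'m1" where F: "invertible F" "H = transpose F ** F" using PD_factorization[OF HPD] by metis
  obtain F' where F': "F ** F' = mat 1" "F' ** F = mat 1" using F(1) invertible_def by blast
  have TF: "transpose F ** transpose F' = mat 1" "transpose F' ** transpose F = mat 1"
    by (rule transpose_inverse[OF F'(2)] transpose_inverse[OF F'(1)])+
  \<comment> \<open>\<open>F' (F')\<^sup>T\<close> is the inverse of \<open>H\<close>.\<close>
  define K where "K = F' ** transpose F'"
  have HK: "H ** K = mat 1" "K ** H = mat 1"
  proof -
    have "H ** K = transpose F ** (F ** F') ** transpose F'" by (simp only: F(2) K_def matrix_mul_assoc)
    then show "H ** K = mat 1" by (simp only: F' TF matrix_mul_rid)
    then show "K ** H = mat 1" by (simp add: matrix_left_right_inverse)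
  qed
  have KN: "N ** K = K ** N"
  proof -
    have "N ** K = (K ** H) ** N ** K" by (simp only: HK matrix_mul_lid)
    also have "\<dots> = K ** (H ** N) ** K" by (simp only: matrix_mul_assoc)
    also have "\<dots> = K ** N ** (H ** K)" unfolding HN by (simp only: matrix_mul_assoc)
    finally show ?thesis by (simp only: HK matrix_mul_rid)
  qed
  define A where "A = L' ** adjugate S0"
  define C where "C = transpose (L ** F')"
  have invs: "invertible L" "invertible L'" "invertible F'" using L F' invertible_def by blast+
  have A: "invertible A" unfolding A_def
    using invs(2) adjugate_invertible[of S0] \<delta> by (intro invertible_mult) (auto simp: \<delta>_def)
  have C: "invertible C" unfolding C_def using invs by (intro invertible_transpose invertible_mult)
  define G where "G = (\<lambda>i. A ** (Y i ** E) ** transpose C)"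
  have G0: "G 0 = mat \<delta> ** F'"
  proof -
    have "G 0 = L' ** (adjugate S0 ** S0) ** L ** F'" by (simp add: G_def A_def C_def S0_def matrix_mul_assoc)
    also have "\<dots> = mat \<delta> ** (L' ** L) ** F'" unfolding adj by (simp add: mat_mult_commute matrix_mul_assoc)
    finally show ?thesis by (simp only: L matrix_mul_rid)
  qed
  have G1: "G 1 = N ** F'" by (simp add: G_def A_def C_def S1_def N_def matrix_mul_assoc)
  have mm: "mat \<delta> ** mat \<delta> = (mat (\<delta> * \<delta>) :: real^'m1^'m1)"
    by (simp add: mat_eq_diagm diagm_mult_diagm)
  have two: "(\<Sum>i<2. h i) = h 0 + h 1" for h :: "nat \<Rightarrow> real^'m1^'m1" by (simp add: numeral_2_eq_2)
  have "(\<Sum>i<2. G i ** transpose (G i)) = mat \<delta> ** K ** mat \<delta> + N ** K ** transpose N"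
    unfolding two G0 G1 K_def by (simp add: matrix_transpose_mul matrix_mul_assoc)
  also have "mat \<delta> ** K ** mat \<delta> = K ** mat (\<delta> * \<delta>)"
    unfolding mat_mult_commute[of \<delta> K] mm[symmetric] by (simp only: matrix_mul_assoc)
  also have "K ** mat (\<delta> * \<delta>) + N ** K ** transpose N = K ** H"
    unfolding KN H_def by (simp add: matrix_add_ldistrib matrix_mul_assoc)
  finally have row: "(\<Sum>i<2. G i ** transpose (G i)) = mat 1" by (simp only: HK)
  have "(\<Sum>i<2. transpose (G i) ** G i) = transpose F' ** (mat \<delta> ** mat \<delta>) ** F' + transpose F' ** (transpose N ** N) ** F'"
    unfolding two G0 G1 by (simp add: matrix_transpose_mul matrix_mul_assoc)
  also have "\<dots> = transpose F' ** H ** F'"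
    unfolding mm H_def NN by (simp add: matrix_add_ldistrib matrix_add_rdistrib)
  also have "\<dots> = (transpose F' ** transpose F) ** (F ** F')" by (simp only: F(2) matrix_mul_assoc)
  finally have col: "(\<Sum>i<2. transpose (G i) ** G i) = mat 1" by (simp only: F' TF matrix_mul_rid)
  show ?thesis
    by (rule square_balanced_mle_exists[OF E card _ A C]) (use row col in \<open>simp_all add: G_def\<close>)
qed

text \<open>The sign changes of \<open>det (S\<^sub>1 - s S\<^sub>0)\<close> at \<open>s = -1, 1, 3\<close> give two real eigenvalues \<open>s\<^sub>1 < s\<^sub>2\<close> of \<open>S\<^sub>0\<^sup>-\<^sup>1 S\<^sub>1\<close>. The
  symmetry \<open>S\<^sub>0\<^sup>-\<^sup>1 S\<^sub>1 + 1\<close> is invertible, and its eigenvalues \<open>s\<^sub>1 + 1\<close> and \<open>s\<^sub>2 + 1\<close> are positive and distinct.\<close>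

lemma two_square_samples_not_unique:
  fixes Y :: "nat \<Rightarrow> real^'m2^'m1" and E :: "real^'m1^'m2"
  assumes E: "transpose E ** E = mat 1" "E ** transpose E = mat 1"
    and signs: "det (Y 0 ** E) \<noteq> 0" "det (Y 1 ** E + Y 0 ** E) > 0" "det (Y 1 ** E - Y 0 ** E) < 0"
      "det (Y 1 ** E - 3 *\<^sub>R (Y 0 ** E)) > 0"
  shows "\<not> mle_exists_uniquely 2 Y"
proof -
  define S0 where "S0 = Y 0 ** E"
  define S1 where "S1 = Y 1 ** E"
  define g where "g = (\<lambda>s::real. det (S1 - s *\<^sub>R S0))"
  have g: "g (- 1) > 0" "g 1 < 0" "g 3 > 0" using signs by (simp_all add: g_def S0_def S1_def)
  have cont: "continuous_on T g" for T unfolding g_def by (intro continuous_intros)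
  obtain s1 where s1: "-1 \<le> s1" "s1 \<le> 1" "g s1 = 0"
    using IVT2'[of g 1 0 "-1"] g cont by auto
  obtain s2 where s2: "1 \<le> s2" "s2 \<le> 3" "g s2 = 0"
    using IVT'[of g 1 0 3] g cont by auto
  have s: "-1 < s1" "s1 < 1" "1 < s2" using s1 s2 g by (auto simp: less_le)
  obtain S' where S': "S0 ** S' = mat 1" "S' ** S0 = mat 1"
    using signs(1) invertible_det_nz invertible_def unfolding S0_def by metis
  have detS': "det S' \<noteq> 0" using S' by (metis invertible_def invertible_det_nz)
  define X where "X = S' ** (S1 + S0)"
  define X1 where "X1 = (S1 + S0) ** S'"
  have d: "det (S1 + S0) \<noteq> 0" using signs(2) by (simp add: S0_def S1_def)
  have inv: "invertible X1" "invertible X" using d detS' by (simp_all add: X_def X1_def invertible_det_nz det_mul)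
  have Xe: "X = S' ** S1 + mat 1" "X1 = S1 ** S' + mat 1"
    by (simp_all add: X_def X1_def matrix_add_ldistrib matrix_add_rdistrib S')
  have c0: "X1 ** S0 = S0 ** X"
  proof -
    have "X1 ** S0 = (S1 + S0) ** (S' ** S0)" "S0 ** X = (S0 ** S') ** (S1 + S0)" by (simp_all only: X_def X1_def matrix_mul_assoc)
    then show ?thesis by (simp only: S' matrix_mul_rid matrix_mul_lid)
  qed
  have c1: "X1 ** S1 = S1 ** X"
    unfolding Xe by (simp add: matrix_add_ldistrib matrix_add_rdistrib matrix_mul_assoc)
  have comm: "X1 ** (Y i ** E) = (Y i ** E) ** X" if "i < 2" for i
    using that c0 c1 by (auto simp: S0_def S1_def less_2_cases_iff)
  have ex: "\<exists>e. e \<noteq> 0 \<and> transpose X *v e = (r + 1) *\<^sub>R e" if "g r = 0" for r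
  proof -
    have "X - mat (r + 1) = S' ** (S1 - r *\<^sub>R S0)"
      by (simp add: Xe matrix_diff_ldistrib matrix_mult_scaleR S') (simp add: vec_eq_iff mat_def)
    then have "det (X - mat (r + 1)) = 0" using that by (simp add: det_mul g_def)
    moreover have "transpose (X - mat (r + 1)) = transpose X - mat (r + 1)"
      by (simp add: vec_eq_iff transpose_def mat_def)
    ultimately have "det (transpose X - mat (r + 1)) = 0" by (metis det_transpose)
    then obtain e where e: "e \<noteq> 0" "(transpose X - mat (r + 1)) *v e = 0" using singular_kernel by blast
    have "transpose X *v e = (r + 1) *\<^sub>R e" using e(2)
      by (simp add: matrix_vector_mult_diff_rdistrib mat_mult_vector del: transpose_matrix_vector)
    with e(1) show ?thesis by blast
  qed
  obtain e where e: "e \<noteq> 0" "transpose X *v e = (s1 + 1) *\<^sub>R e" using ex[OF s1(3)] by blast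
  obtain f where f: "f \<noteq> 0" "transpose X *v f = (s2 + 1) *\<^sub>R f" using ex[OF s2(3)] by blast
  have "(s1 + 1)\<^sup>2 \<noteq> (s2 + 1)\<^sup>2" using s by (simp add: power2_eq_iff)
  then show ?thesis by (intro square_not_unique[OF E inv comm e(2,1) f(2,1)])
qed

section \<open>Almost sure properties of random samples\<close>

lemma AE_sample_property:
  fixes S1 :: "real^'m1^'m1" and S2 :: "real^'m2^'m2" and f :: "'n::finite \<Rightarrow> nat"
  assumes D: "is_matrix_normal S1 S2 D" and S: "S1 \<in> PD" "S2 \<in> PD"
    and f: "inj f" "range f \<subseteq> {..<n}" and neg: "negligible (N :: (real^'m2^'m1^'n) set)"
    and good: "\<And>Y. (\<chi> i. Y (f i)) \<notin> N \<Longrightarrow> \<Phi> Y"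
  shows "AE Y in PiM {..<n} (\<lambda>_. D). \<Phi> Y"
  using AE_sample_if_negligible[OF D S f neg] by eventually_elim (rule good)

lemma not_AE_if_impossible:
  assumes D: "is_matrix_normal S1 S2 D" and S: "S1 \<in> PD" "S2 \<in> PD"
    and ae: "AE Y in PiM {..<n} (\<lambda>_. D). \<Psi> Y" and imp: "\<And>Y. \<Psi> Y \<Longrightarrow> \<not> \<Phi> Y"
  shows "\<not> (AE Y in PiM {..<n} (\<lambda>_. D). \<Phi> Y)"
proof
  assume "AE Y in PiM {..<n} (\<lambda>_. D). \<Phi> Y"
  with ae have "AE Y in PiM {..<n} (\<lambda>_. D). False" by eventually_elim (use imp in blast)
  moreover have "prob_space (PiM {..<n} (\<lambda>_. D))"
    using matrix_normal_null_sets(1)[OF D S] by (intro prob_space_PiM) auto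
  ultimately show False by (simp add: prob_space.AE_False)
qed

text \<open>If every pair of dimensions that could violate stability has positive expected codimension, only
  finitely many negligible sets have to be avoided.\<close>

lemma AE_stable_sample:
  fixes S1 :: "real^'m1^'m1" and S2 :: "real^'m2^'m2" and f :: "'n::finite \<Rightarrow> nat"
  assumes D: "is_matrix_normal S1 S2 D" and S: "S1 \<in> PD" "S2 \<in> PD"
    and f: "inj f" "range f \<subseteq> {..<n}"
    and count: "\<And>u w. 1 \<le> u \<Longrightarrow> u \<le> CARD('m2) \<Longrightarrow> w < CARD('m1) \<Longrightarrow> w * CARD('m2) \<le> u * CARD('m1)
      \<Longrightarrow> w * (CARD('m1) - w) + u * (CARD('m2) - u) < CARD('n) * (CARD('m1) - w) * u"
  shows "AE Y in PiM {..<n} (\<lambda>_. D). stable_sample n (Y :: nat \<Rightarrow> real^'m2^'m1)"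
proof -
  define pairs where "pairs = {(u, w). 1 \<le> u \<and> u \<le> CARD('m2) \<and> w < CARD('m1) \<and> w * CARD('m2) \<le> u * CARD('m1)}"
  define bad where "bad = (\<lambda>(u, w). {y :: real^'m2^'m1^'n. \<exists>U W. subspace U \<and> subspace W \<and> dim U = u \<and> dim W = w \<and>
      (\<forall>i. \<forall>x\<in>U. y $ i *v x \<in> W)})"
  have "pairs \<subseteq> {..CARD('m2)} \<times> {..CARD('m1)}" by (auto simp: pairs_def)
  then have "finite pairs" by (rule finite_subset) auto
  moreover have "negligible (bad p)" if p: "p \<in> pairs" for p
  proof -
    obtain u w where uw: "p = (u, w)" "1 \<le> u" "u \<le> CARD('m2)" "w < CARD('m1)" "w * CARD('m2) \<le> u * CARD('m1)"
      using p unfolding pairs_def by blast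
    show ?thesis unfolding bad_def uw(1) prod.case
      by (rule negligible_invariant_subspaces[OF count[OF uw(2-)]])
  qed
  ultimately have neg: "negligible (\<Union>p\<in>pairs. bad p)" by (intro negligible_Union) auto
  show ?thesis
  proof (rule AE_sample_property[OF D S f neg])
    fix Y :: "nat \<Rightarrow> real^'m2^'m1"
    assume Y: "(\<chi> i. Y (f i)) \<notin> (\<Union>p\<in>pairs. bad p)"
    show "stable_sample n Y" unfolding stable_sample_def
    proof (intro allI impI, rule ccontr)
      fix U :: "(real^'m2) set" and W :: "(real^'m1) set"
      assume U: "subspace U" "U \<noteq> {0}" and W: "subspace W" and inv: "\<forall>i<n. \<forall>u\<in>U. Y i *v u \<in> W"
        and proper: "\<not> (U = UNIV \<and> W = UNIV)" and "\<not> dim U * CARD('m1) < dim W * CARD('m2)"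
      then have le: "dim W * CARD('m2) \<le> dim U * CARD('m1)" by simp
      have u1: "1 \<le> dim U" using U subspace_0[OF U(1)] by (simp add: Suc_le_eq) (auto simp: dim_eq_0 zero_less_iff_neq_zero)
      have u2: "dim U \<le> CARD('m2)" using dim_subset_UNIV[of U] by simp
      have w: "dim W < CARD('m1)"
      proof (rule ccontr)
        assume "\<not> ?thesis"
        then have dW: "dim W = CARD('m1)" using dim_subset_UNIV[of W] by simp
        then have "W = UNIV" using W by (intro subspace_dim_equal) auto
        have "CARD('m2) \<le> dim U" using le dW by (simp add: mult.commute)
        then have "U = UNIV" using U(1) u2 by (intro subspace_dim_equal) auto
        then show False using proper \<open>W = UNIV\<close> by blast
      qed
      have "\<forall>i. \<forall>x\<in>U. (\<chi> i. Y (f i)) $ i *v x \<in> W" using inv f(2) by (auto simp: image_subset_iff)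
      then have "(\<chi> i. Y (f i)) \<in> bad (dim U, dim W)" unfolding bad_def prod.case using U W
        by (intro CollectI exI[of _ U] exI[of _ W]) auto
      moreover have "(dim U, dim W) \<in> pairs" using u1 u2 w le by (simp add: pairs_def)
      ultimately show False using Y by blast
    qed
  qed
qed

lemma AE_exists_uniquely_if_stable:
  fixes S1 :: "real^'m1^'m1" and S2 :: "real^'m2^'m2"
  assumes "AE Y in PiM {..<n} (\<lambda>_. D). stable_sample n (Y :: nat \<Rightarrow> real^'m2^'m1)" and n: "n > 0"
  shows "AE Y in PiM {..<n} (\<lambda>_. D). mle_exists_uniquely n Y"
  using assms(1) by eventually_elim (rule stable_exists_unique[OF _ stable_mle_exists[OF _ n]])

lemma index_injection:
  assumes "CARD('n::finite) \<le> n"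
  shows "\<exists>f :: 'n \<Rightarrow> nat. inj f \<and> range f \<subseteq> {..<n} \<and> {..<CARD('n)} \<subseteq> range f"
proof -
  obtain f :: "'n \<Rightarrow> nat" where f: "bij_betw f UNIV {..<CARD('n)}"
    using finite_same_card_bij[of "UNIV::'n set" "{..<CARD('n)}"] by auto
  then show ?thesis using assms by (intro exI[of _ f]) (auto simp: bij_betw_def)
qed

text \<open>With \<open>r = m1 - w\<close> and \<open>t = m2 - u\<close> the claim is \<open>u t < (3 u - w) r\<close>. The hypotheses give \<open>w \<le> 2 u\<close> and \<open>t \<le> r\<close>, and both are
  equalities only if \<open>r = t = 0\<close>.\<close>

lemma three_sample_count:
  fixes m1 m2 u w :: nat
  assumes m: "m2 \<le> m1" "m1 \<le> 2 * m2" and u: "1 \<le> u" "u \<le> m2" and w: "w < m1" "w * m2 \<le> u * m1"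
  shows "w * (m1 - w) + u * (m2 - u) < 3 * (m1 - w) * u"
proof -
  define r where "r = m1 - w"
  have r: "r > 0" "m1 = w + r" using w(1) by (auto simp: r_def)
  define t where "t = m2 - u"
  have t: "m2 = u + t" using u(2) by (simp add: t_def)
  have m2: "m2 > 0" using u by simp
  have "u * m1 \<le> u * (2 * m2)" using m(2) by (rule mult_le_mono2)
  then have "w * m2 \<le> (2 * u) * m2" using w(2) by (simp only: mult_ac)
  then have w2: "w \<le> 2 * u" using m2 by (metis mult_le_cancel2)
  have "m1 * t \<le> m2 * r"
  proof -
    have "m1 * m2 = w * m2 + m2 * r" by (simp add: r(2) algebra_simps)
    moreover have "m1 * m2 = u * m1 + m1 * t" by (simp add: t algebra_simps)
    ultimately show ?thesis using w(2) by linarith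
  qed
  moreover have "m2 * t \<le> m1 * t" using m(1) by simp
  ultimately have "m2 * t \<le> m2 * r" by linarith
  then have tr: "t \<le> r" using m2 by simp
  have "u * t < (3 * u - w) * r"
  proof (cases "w = 2 * u")
    case True
    then have "2 * u * m2 \<le> u * m1" using w(2) by simp
    then have "2 * m2 \<le> m1" using u(1) by (simp add: mult.left_commute mult.assoc)
    then have "m1 = 2 * m2" using m(2) by simp
    then have "r = 2 * t" using True r(2) t by simp
    then show ?thesis using True r(1) u(1) by simp
  next
    case False
    then have "u + 1 \<le> 3 * u - w" using w2 by linarith
    then have "(u + 1) * r \<le> (3 * u - w) * r" by (rule mult_le_mono1)
    moreover have "u * t \<le> u * r" using tr by simp
    moreover have "(u + 1) * r = u * r + r" by simp
    ultimately show ?thesis using r(1) by linarith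
  qed
  moreover have "w * r + (3 * u - w) * r = 3 * r * u"
  proof -
    have "w + (3 * u - w) = 3 * u" using w2 u by linarith
    then have "(w + (3 * u - w)) * r = 3 * u * r" by (simp only:)
    then have "w * r + (3 * u - w) * r = 3 * u * r" by (simp only: distrib_right)
    then show ?thesis by (simp only: mult_ac)
  qed
  ultimately show ?thesis unfolding r_def[symmetric] t_def[symmetric] by linarith
qed

text \<open>For \<open>m1 = m2 + 1\<close> integrality sharpens \<open>w m2 \<le> u m1\<close> to \<open>w \<le> u\<close>.\<close>

lemma two_sample_count:
  fixes m2 u w :: nat
  assumes u: "1 \<le> u" "u \<le> m2" and w: "w < m2 + 1" "w * m2 \<le> u * (m2 + 1)"
  shows "w * (m2 + 1 - w) + u * (m2 - u) < 2 * (m2 + 1 - w) * u"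
proof -
  define r where "r = m2 + 1 - w"
  have r: "r > 0" "m2 + 1 = w + r" using w(1) by (auto simp: r_def)
  define t where "t = m2 - u"
  have t: "m2 = u + t" using u(2) by (simp add: t_def)
  have wu: "w \<le> u"
  proof (rule ccontr)
    assume "\<not> w \<le> u"
    then have "u + 1 \<le> w" by simp
    then have "(u + 1) * m2 \<le> u * (m2 + 1)" using w(2) mult_le_mono1[of "u + 1" w m2] by linarith
    then have "m2 \<le> u" by simp
    then show False using u(2) w(1) \<open>u + 1 \<le> w\<close> by linarith
  qed
  have rt: "t + 1 \<le> r" using r(2) t wu by linarith
  have "u * t < u * r" using rt u(1) by simp
  also have "\<dots> \<le> (2 * u - w) * r" using wu by (intro mult_le_mono1) linarith
  finally have "u * t < (2 * u - w) * r" .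
  moreover have "w * r + (2 * u - w) * r = 2 * r * u"
  proof -
    have "w + (2 * u - w) = 2 * u" using wu by linarith
    then have "(w + (2 * u - w)) * r = 2 * u * r" by (simp only:)
    then have "w * r + (2 * u - w) * r = 2 * u * r" by (simp only: distrib_right)
    then show ?thesis by (simp only: mult_ac)
  qed
  ultimately show ?thesis unfolding r_def[symmetric] t_def[symmetric] by linarith
qed

text \<open>The positive codimension of a short closed chain, stated for the orthogonal complements of \<open>V\<close>, of dimension
  \<open>v < w\<close>, and of \<open>W\<close>, of dimension \<open>w \<le> d\<close>.\<close>

lemma short_chain_count:
  fixes d k v w :: nat
  assumes v: "v < w" and w: "w \<le> d" and k: "k > 0"
  shows "((d + 1) * k - w) * w + (d * k - v) * v < 2 * w * (d * k - v)"
proof -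
  define s where "s = d * k - v"
  have dk: "d \<le> d * k" using k by simp
  have s: "d * k = v + s" using v w dk unfolding s_def by linarith
  have wk: "w * k \<le> d * k" using w by simp
  obtain e where e: "w = v + 1 + e" using v by (metis Suc_eq_plus1 add_Suc_right add.commute less_iff_Suc_add)
  \<comment> \<open>The worst case is \<open>v = w - 1\<close>, where the two sides differ by \<open>d k + 1 - w k\<close>.\<close>
  have "((d + 1) * k - w) * w < (2 * w - v) * s"
  proof -
    have "w \<le> (d + 1) * k" using w dk unfolding distrib_right by linarith
    then have "((d + 1) * k - w) * w + w * w = (d + 1) * k * w" by (simp add: diff_mult_distrib)
    also have "\<dots> = d * k * w + w * k" by (simp add: algebra_simps)
    also have "\<dots> \<le> d * k * w + d * k" using wk by simp
    also have "\<dots> = (v + s) * (w + 1)" by (simp add: s)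
    finally have "((d + 1) * k - w) * w + w * w \<le> (v + s) * (w + 1)" .
    also have "\<dots> < (2 * w - v) * s + w * w"
    proof -
      have "2 * w - v = w + 1 + e" using e by simp
      moreover have "v * (w + 1) < w * w + e * s"
      proof -
        have "v * (w + 1) \<le> (w - 1) * (w + 1)" using v by (intro mult_le_mono1) simp
        also have "\<dots> < w * w" using v by (cases w) simp_all
        finally show ?thesis by simp
      qed
      ultimately show ?thesis by (simp add: algebra_simps)
    qed
    finally show ?thesis by simp
  qed
  moreover have "(2 * w - v) * s + s * v = 2 * w * s"
  proof -
    have "(2 * w - v) + v = 2 * w" using v by simp
    then have "((2 * w - v) + v) * s = 2 * w * s" by (simp only:)
    then have "(2 * w - v) * s + v * s = 2 * w * s" by (simp only: distrib_right)
    then show ?thesis by (simp only: mult_ac)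
  qed
  ultimately show ?thesis by (simp add: s_def[symmetric])
qed

text \<open>All \<open>Y\<^sub>i\<^sup>T\<close> map \<open>W\<close> into \<open>V\<close> if and only if all \<open>Y\<^sub>i\<close> map the orthogonal complement of \<open>V\<close> into that of \<open>W\<close>.\<close>

lemma AE_no_short_chains:
  fixes S1 :: "real^'m1^'m1" and S2 :: "real^'m2^'m2"
  assumes D: "is_matrix_normal S1 S2 D" and S: "S1 \<in> PD" "S2 \<in> PD"
    and m1: "CARD('m1) = (d + 1) * k" and m2: "CARD('m2) = d * k"
  shows "AE Y in PiM {..<2} (\<lambda>_. D). \<forall>W V. subspace W \<longrightarrow> subspace V \<longrightarrow> dim W \<le> d \<longrightarrow> dim V < dim W
      \<longrightarrow> (\<exists>i<2. \<exists>w\<in>W. transpose ((Y :: nat \<Rightarrow> real^'m2^'m1) i) *v w \<notin> V)"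
proof -
  have "CARD(2) \<le> 2" by simp
  then obtain f :: "2 \<Rightarrow> nat" where f: "inj f" "range f \<subseteq> {..<2}"
    using index_injection by blast
  have k: "k > 0" using m1 by (cases k) auto
  define pairs where "pairs = {(v, w). v < w \<and> w \<le> d}"
  define bad where "bad = (\<lambda>(v, w). {y :: real^'m2^'m1^2. \<exists>U W. subspace U \<and> subspace W \<and> dim U = CARD('m2) - v \<and> dim W = CARD('m1) - w \<and>
      (\<forall>i. \<forall>x\<in>U. y $ i *v x \<in> W)})"
  have "pairs \<subseteq> {..d} \<times> {..d}" by (auto simp: pairs_def)
  then have "finite pairs" by (rule finite_subset) auto
  moreover have "negligible (bad p)" if p: "p \<in> pairs" for p
  proof -
    obtain v w where vw: "p = (v, w)" "v < w" "w \<le> d" using p by (auto simp: pairs_def)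
    have "d \<le> d * k" using k by simp
    then have "w \<le> CARD('m1)" "v \<le> CARD('m2)" using vw unfolding m1 m2 distrib_right by linarith+
    then have "CARD('m1) - (CARD('m1) - w) = w" "CARD('m2) - (CARD('m2) - v) = v" by auto
    then show ?thesis unfolding bad_def vw(1) prod.case
      using short_chain_count[OF vw(2,3) k]
      by (intro negligible_invariant_subspaces) (simp add: m1 m2)
  qed
  ultimately have neg: "negligible (\<Union>p\<in>pairs. bad p)" by (intro negligible_Union) auto
  show ?thesis
  proof (rule AE_sample_property[OF D S f neg], intro allI impI, rule ccontr)
    fix Y :: "nat \<Rightarrow> real^'m2^'m1" and W :: "(real^'m1) set" and V :: "(real^'m2) set"
    assume Y: "(\<chi> i. Y (f i)) \<notin> (\<Union>p\<in>pairs. bad p)" and W: "subspace W" and V: "subspace V"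
      and le: "dim W \<le> d" and lt: "dim V < dim W" and "\<not> (\<exists>i<2. \<exists>w\<in>W. transpose (Y i) *v w \<notin> V)"
    then have inv: "\<And>i w. i < 2 \<Longrightarrow> w \<in> W \<Longrightarrow> transpose (Y i) *v w \<in> V" by blast
    define W' where "W' = {y. \<forall>x\<in>W. orthogonal x y}"
    define V' where "V' = {y. \<forall>x\<in>V. orthogonal x y}"
    have "subspace W'" "subspace V'" unfolding W'_def V'_def by (rule subspace_orthogonal_to_vectors)+
    moreover have "dim W' = CARD('m1) - dim W" "dim V' = CARD('m2) - dim V"
      using dim_subspace_orthogonal_to_vectors[OF W subspace_UNIV] dim_subspace_orthogonal_to_vectors[OF V subspace_UNIV]
      by (simp_all add: W'_def V'_def)
    moreover have "\<forall>i. \<forall>x\<in>V'. (\<chi> i. Y (f i)) $ i *v x \<in> W'"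
    proof (intro allI ballI)
      fix i and x assume x: "x \<in> V'"
      have "orthogonal w (Y (f i) *v x)" if w: "w \<in> W" for w
      proof -
        have "f i < 2" using f(2) by auto
        then have "transpose (Y (f i)) *v w \<in> V" using inv w by blast
        then have "(transpose (Y (f i)) *v w) \<bullet> x = 0" using x by (auto simp: V'_def orthogonal_def)
        then show ?thesis unfolding orthogonal_def by (simp only: dot_matrix_vector_transpose)
      qed
      then show "(\<chi> i. Y (f i)) $ i *v x \<in> W'" by (simp add: W'_def)
    qed
    ultimately have "(\<chi> i. Y (f i)) \<in> bad (dim V, dim W)" unfolding bad_def prod.case
      by (intro CollectI exI[of _ V'] exI[of _ W']) auto
    moreover have "(dim V, dim W) \<in> pairs" using le lt by (simp add: pairs_def)
    ultimately show False using Y by blast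
  qed
qed

lemma AE_two_samples_divisible:
  fixes S1 :: "real^'m1^'m1" and S2 :: "real^'m2^'m2"
  assumes D: "is_matrix_normal S1 S2 D" and S: "S1 \<in> PD" "S2 \<in> PD"
    and lt: "CARD('m2) < CARD('m1)" and dvd: "(CARD('m1) - CARD('m2)) dvd CARD('m2)"
  shows "AE Y in PiM {..<2} (\<lambda>_. D). mle_exists 2 (Y :: nat \<Rightarrow> real^'m2^'m1) \<and>
      (CARD('m1) \<noteq> CARD('m2) + 1 \<longrightarrow> \<not> mle_exists_uniquely 2 Y)"
proof -
  define k where "k = CARD('m1) - CARD('m2)"
  obtain d where m2: "CARD('m2) = d * k" using dvd by (metis dvdE k_def mult.commute)
  have m1: "CARD('m1) = (d + 1) * k" using m2 lt by (simp add: k_def)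
  have d: "d \<ge> 1" using m2 by (cases d) auto
  show ?thesis
    using AE_no_short_chains[OF D S m1 m2]
  proof eventually_elim
    fix Y :: "nat \<Rightarrow> real^'m2^'m1"
    assume "\<forall>W V. subspace W \<longrightarrow> subspace V \<longrightarrow> dim W \<le> d \<longrightarrow> dim V < dim W
      \<longrightarrow> (\<exists>i<2. \<exists>w\<in>W. transpose (Y i) *v w \<notin> V)"
    then obtain A :: "real^'m1^'m1" and B :: "real^'m2^'m2" and \<sigma> \<tau> where AB: "invertible A" "invertible B"
      and \<sigma>: "bij_betw \<sigma> UNIV ({..d} \<times> {..<k})" and \<tau>: "bij_betw \<tau> UNIV ({1..d} \<times> {..<k})"
      and Y: "\<And>i. i < 2 \<Longrightarrow> A ** Y i ** transpose B = kronecker_block_sum d k \<sigma> \<tau> i"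
      using two_samples_normal_form[OF m1 m2, of Y] by metis
    have "mle_exists 2 (\<lambda>i. A ** Y i ** transpose B)"
      using kronecker_block_sum_balanced[OF \<sigma> \<tau>] Y by (intro balanced_mle_exists) simp_all
    then have "mle_exists 2 Y" by (rule mle_exists_congruence[OF AB])
    moreover have "\<not> mle_exists_uniquely 2 Y" if "CARD('m1) \<noteq> CARD('m2) + 1"
      using that lt by (intro kronecker_block_sum_not_unique[OF \<tau> _ d AB Y]) (auto simp: k_def)
    ultimately show "mle_exists 2 Y \<and> (CARD('m1) \<noteq> CARD('m2) + 1 \<longrightarrow> \<not> mle_exists_uniquely 2 Y)" by blast
  qed
qed

lemma real_polynomial_function_sample_entry:
  "real_polynomial_function (\<lambda>y::real^'m2^'m1^'n. y $ i $ a $ b)"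
  by (intro real_polynomial_function.intros(1) bounded_linear_compose[OF bounded_linear_vec_nth] bounded_linear_vec_nth)

lemma AE_one_square_sample:
  fixes S1 :: "real^'m1^'m1" and S2 :: "real^'m2^'m2"
  assumes D: "is_matrix_normal S1 S2 D" and S: "S1 \<in> PD" "S2 \<in> PD"
    and card: "CARD('m1) = CARD('m2)" "CARD('m1) \<ge> 2"
  shows "AE Y in PiM {..<1} (\<lambda>_. D). mle_exists 1 (Y :: nat \<Rightarrow> real^'m2^'m1) \<and> \<not> mle_exists_uniquely 1 Y"
proof -
  obtain E :: "real^'m1^'m2" where E: "transpose E ** E = mat 1" "E ** transpose E = mat 1"
    using square_identification[OF card(1)] by metis
  have "CARD(1) \<le> 1" by simp
  then obtain f :: "1 \<Rightarrow> nat" where f: "inj f" "range f \<subseteq> {..<1}"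
    using index_injection by blast
  define g where "g = (\<lambda>y :: real^'m2^'m1^1. det (y $ 1 ** E))"
  have "real_polynomial_function g" unfolding g_def
    by (intro real_polynomial_function_det real_polynomial_function_matrix_mult real_polynomial_function_sample_entry real_polynomial_function.intros(2))
  moreover have "g (\<chi> i. transpose E) \<noteq> 0" by (simp add: g_def E)
  ultimately have neg: "negligible {y. g y = 0}" by (rule negligible_zeros_real_polynomial)
  show ?thesis
  proof (rule AE_sample_property[OF D S f neg])
    fix Y :: "nat \<Rightarrow> real^'m2^'m1"
    assume "(\<chi> i. Y (f i)) \<notin> {y. g y = 0}"
    moreover have "f 1 = 0" using f(2) by auto
    ultimately have "det (Y 0 ** E) \<noteq> 0" by (simp add: g_def)
    then show "mle_exists 1 Y \<and> \<not> mle_exists_uniquely 1 Y"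
      using one_square_sample_mle_exists[OF E card(1)] one_square_sample_not_unique[OF E card(2)] by blast
  qed
qed

lemma AE_two_square_samples_exist:
  fixes S1 :: "real^'m1^'m1" and S2 :: "real^'m2^'m2"
  assumes D: "is_matrix_normal S1 S2 D" and S: "S1 \<in> PD" "S2 \<in> PD" and card: "CARD('m1) = CARD('m2)"
  shows "AE Y in PiM {..<2} (\<lambda>_. D). mle_exists 2 (Y :: nat \<Rightarrow> real^'m2^'m1)"
proof -
  obtain E :: "real^'m1^'m2" where E: "transpose E ** E = mat 1" "E ** transpose E = mat 1"
    using square_identification[OF card] by metis
  have "CARD(2) \<le> 2" by simp
  then obtain f :: "2 \<Rightarrow> nat" where f: "inj f" "range f \<subseteq> {..<2}" "{..<CARD(2)} \<subseteq> range f"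
    using index_injection by blast
  have "0 \<in> range f" "1 \<in> range f" using f(3) by auto
  then obtain j0 j1 where j: "f j0 = 0" "f j1 = 1" by (metis imageE)
  then have "j0 \<noteq> j1" by force
  define g where "g = (\<lambda>y :: real^'m2^'m1^2. det (y $ j0 ** E) * matrix_discriminant (adjugate (y $ j0 ** E) ** (y $ j1 ** E)))"
  have SE: "real_polynomial_function (\<lambda>y :: real^'m2^'m1^2. (y $ j ** E) $ a $ b)" for j a b
    by (intro real_polynomial_function_matrix_mult real_polynomial_function_sample_entry real_polynomial_function.intros(2))
  have adj: "real_polynomial_function (\<lambda>y :: real^'m2^'m1^2. adjugate (y $ j0 ** E) $ a $ b)" for a b
  proof -
    have "real_polynomial_function (\<lambda>y. (\<chi> i j. if j = a then axis b 1 $ i else (y $ j0 ** E) $ i $ j) $ i $ j)" for i j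
      by (cases "j = a") (auto intro: SE)
    then show ?thesis unfolding adjugate_def vec_lambda_beta
      by (intro real_polynomial_function_det) simp
  qed
  have "real_polynomial_function g" unfolding g_def
    by (intro real_polynomial_function.intros(4) real_polynomial_function_det real_polynomial_function_matrix_discriminant
      real_polynomial_function_matrix_mult SE adj real_polynomial_function_sample_entry real_polynomial_function.intros(2))
  then have neg_if: "g y0 \<noteq> 0 \<Longrightarrow> negligible {y. g y = 0}" for y0 by (rule negligible_zeros_real_polynomial)
  obtain x :: "'m1 \<Rightarrow> real" where x: "inj x"
  proof -
    obtain h :: "'m1 \<Rightarrow> nat" where "inj h" using index_injection[of "CARD('m1)", OF order_refl] by blast
    then have "inj (\<lambda>a. real (h a))" by (auto simp: inj_def)
    then show ?thesis by (rule that)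
  qed
  define y0 :: "real^'m2^'m1^2" where "y0 = (\<chi> j. if j = j0 then transpose E else diagm x ** transpose E)"
  have "y0 $ j0 ** E = mat 1" by (simp add: y0_def E)
  moreover have "y0 $ j1 ** E = diagm x ** (transpose E ** E)" using \<open>j0 \<noteq> j1\<close> by (simp add: y0_def matrix_mul_assoc)
  then have "y0 $ j1 ** E = diagm x" by (simp only: E matrix_mul_rid)
  moreover have "adjugate (mat 1 :: real^'m1^'m1) = mat 1"
    using adjugate_mult[of "mat 1 :: real^'m1^'m1"] by simp
  ultimately have "g y0 \<noteq> 0" using matrix_discriminant_diagm[OF x] by (simp add: g_def)
  then have neg: "negligible {y. g y = 0}" by (rule neg_if)
  show ?thesis
  proof (rule AE_sample_property[OF D S f(1,2) neg])
    fix Y :: "nat \<Rightarrow> real^'m2^'m1"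
    assume "(\<chi> i. Y (f i)) \<notin> {y. g y = 0}"
    then show "mle_exists 2 Y"
      by (intro two_square_samples_mle_exists[OF E card]) (auto simp: g_def j)
  qed
qed

text \<open>Uniqueness fails on a nonempty open set, which has positive probability.\<close>

lemma two_square_samples_not_AE_unique:
  fixes S1 :: "real^'m1^'m1" and S2 :: "real^'m2^'m2"
  assumes D: "is_matrix_normal S1 S2 D" and S: "S1 \<in> PD" "S2 \<in> PD"
    and card: "CARD('m1) = CARD('m2)" "CARD('m1) \<ge> 2"
  shows "\<not> (AE Y in PiM {..<2} (\<lambda>_. D). mle_exists_uniquely 2 (Y :: nat \<Rightarrow> real^'m2^'m1))"
proof
  assume uniq: "AE Y in PiM {..<2} (\<lambda>_. D). mle_exists_uniquely 2 (Y :: nat \<Rightarrow> real^'m2^'m1)"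
  obtain E :: "real^'m1^'m2" where E: "transpose E ** E = mat 1" "E ** transpose E = mat 1"
    using square_identification[OF card(1)] by metis
  have "CARD(2) \<le> 2" by simp
  then obtain f :: "2 \<Rightarrow> nat" where f: "inj f" "range f \<subseteq> {..<2}" "{..<CARD(2)} \<subseteq> range f"
    using index_injection by blast
  have "0 \<in> range f" "1 \<in> range f" using f(3) by auto
  then obtain j0 j1 where j: "f j0 = 0" "f j1 = 1" by (metis imageE)
  then have "j0 \<noteq> j1" by force
  define O' where "O' = {y :: real^'m2^'m1^2. 0 < det (y $ j0 ** E) \<and> 0 < det (y $ j1 ** E + y $ j0 ** E) \<and>
      det (y $ j1 ** E - y $ j0 ** E) < 0 \<and> 0 < det (y $ j1 ** E - 3 *\<^sub>R (y $ j0 ** E))}"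
  have op: "open O'" unfolding O'_def by (intro open_Collect_conj open_Collect_less continuous_intros)
  have "O' \<noteq> {}"
  proof -
    obtain a0 a1 :: 'm1 where a: "a0 \<noteq> a1" using card(2) by (metis card_2_iff' card_le_Suc0_iff_eq finite iso_tuple_UNIV_I not_less_eq_eq numeral_2_eq_2)
    \<comment> \<open>The eigenvalues \<open>0\<close> and \<open>2\<close> produce the sign changes at \<open>-1\<close>, \<open>1\<close>, \<open>3\<close>. All the others lie to the right of \<open>3\<close>.\<close>
    define x :: "'m1 \<Rightarrow> real" where "x = (\<lambda>a. if a = a0 then 0 else if a = a1 then 2 else 10)"
    define y0 :: "real^'m2^'m1^2" where "y0 = (\<chi> j. if j = j0 then transpose E else diagm x ** transpose E)"
    have e0: "y0 $ j0 ** E = mat 1" by (simp add: y0_def E)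
    have "y0 $ j1 ** E = diagm x ** (transpose E ** E)" using \<open>j0 \<noteq> j1\<close> by (simp add: y0_def matrix_mul_assoc)
    then have e1: "y0 $ j1 ** E = diagm x" by (simp only: E matrix_mul_rid)
    have dt: "det (diagm x - s *\<^sub>R mat 1) = (0 - s) * ((2 - s) * (10 - s) ^ card (UNIV - {a0, a1}))" for s
    proof -
      have "diagm x - s *\<^sub>R mat 1 = diagm (\<lambda>a. x a - s)" by (simp add: vec_eq_iff mat_def)
      then have "det (diagm x - s *\<^sub>R mat 1) = (\<Prod>a\<in>UNIV. x a - s)" by simp
      also have "\<dots> = (x a0 - s) * (\<Prod>a\<in>UNIV - {a0}. x a - s)" by (rule prod.remove) auto
      also have "(\<Prod>a\<in>UNIV - {a0}. x a - s) = (x a1 - s) * (\<Prod>a\<in>UNIV - {a0} - {a1}. x a - s)"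
        using a by (intro prod.remove) auto
      also have "(\<Prod>a\<in>UNIV - {a0} - {a1}. x a - s) = (\<Prod>a\<in>UNIV - {a0, a1}. 10 - s)"
        by (intro prod.cong) (auto simp: x_def)
      finally show ?thesis using a by (simp add: x_def)
    qed
    have "0 < det (diagm x + mat 1)" using dt[of "-1"] by simp
    moreover have "det (diagm x - mat 1) < 0" using dt[of 1] by simp
    moreover have "0 < det (diagm x - 3 *\<^sub>R mat 1)" using dt[of 3] by simp
    ultimately have "y0 \<in> O'" by (simp add: O'_def e0 e1)
    then show ?thesis by blast
  qed
  have "AE Y in PiM {..<2} (\<lambda>_. D). (\<chi> i. Y (f i)) \<notin> O'"
    using uniq
  proof eventually_elim
    fix Y :: "nat \<Rightarrow> real^'m2^'m1"
    assume u: "mle_exists_uniquely 2 Y"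
    show "(\<chi> i. Y (f i)) \<notin> O'"
    proof
      assume "(\<chi> i. Y (f i)) \<in> O'"
      then have "\<not> mle_exists_uniquely 2 Y"
        by (intro two_square_samples_not_unique[OF E]) (auto simp: O'_def j)
      then show False using u by blast
    qed
  qed
  then have "negligible O'" using AE_matrix_normal_sample[OF D S f(1,2)] op by (simp add: borel_open)
  then show False using open_not_negligible[OF op \<open>O' \<noteq> {}\<close>] by blast
qed

section \<open>The thresholds\<close>

lemma is_thresholdI:
  assumes "N > 0" and "\<And>S1 S2 D n. S1 \<in> PD \<Longrightarrow> S2 \<in> PD \<Longrightarrow> is_matrix_normal S1 S2 D \<Longrightarrow> n > 0 \<Longrightarrow>
    (AE Y in PiM {..<n} (\<lambda>_. D). \<Phi> n Y) \<longleftrightarrow> N \<le> n"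
  shows "is_threshold \<Phi> N"
  unfolding is_threshold_def using assms by blast

lemma AE_bounded_if_exists:
  assumes "AE Y in M. mle_exists n Y"
  shows "AE Y in M. loglik_bounded n Y"
  using assms by eventually_elim (rule mle_exists_bounded)

lemma AE_exists_if_unique:
  assumes "AE Y in M. mle_exists_uniquely n Y"
  shows "AE Y in M. mle_exists n Y"
  using assms by eventually_elim (simp add: mle_exists_uniquely_def)

theorem theorem1p6:
  fixes m1 m2 :: nat
  assumes "m1 = CARD('m1::finite)" and "m2 = CARD('m2::finite)"
    and "m1 \<ge> 2" and "m2 \<ge> 2"
    and "2 * m2 \<ge> m1" and "m1 \<ge> m2"
  shows "is_uniqueness_threshold TYPE('m1) TYPE('m2)
           (if m1 = m2 then 3 else if m1 = m2 + 1 then 2 else 3) \<and>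
         is_existence_threshold TYPE('m1) TYPE('m2)
           (if m1 = m2 then 1 else if m1 > m2 \<and> (m1 - m2) dvd m2 then 2 else 3) \<and>
         is_boundedness_threshold TYPE('m1) TYPE('m2)
           (if m1 = m2 then 1 else if m1 > m2 \<and> (m1 - m2) dvd m2 then 2 else 3)"
proof -
  note m = assms(1,2)
  define Nu where "Nu = (if m1 = m2 then 3 else if m1 = m2 + 1 then 2 else 3 :: nat)"
  define Ne where "Ne = (if m1 = m2 then 1 else if m1 > m2 \<and> (m1 - m2) dvd m2 then 2 else 3 :: nat)"
  have thresholds: "((AE Y in PiM {..<n} (\<lambda>_. D). mle_exists_uniquely n Y) \<longleftrightarrow> Nu \<le> n) \<and>
      ((AE Y in PiM {..<n} (\<lambda>_. D). mle_exists n Y) \<longleftrightarrow> Ne \<le> n) \<and>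
      ((AE Y in PiM {..<n} (\<lambda>_. D). loglik_bounded n Y) \<longleftrightarrow> Ne \<le> n)"
    if S: "S1 \<in> PD" "S2 \<in> PD" and D: "is_matrix_normal S1 S2 D" and n: "n > 0"
    for S1 :: "real^'m1^'m1" and S2 :: "real^'m2^'m2" and D :: "(real^'m2^'m1) measure" and n
  proof -
    define u where "u \<longleftrightarrow> (AE Y in PiM {..<n} (\<lambda>_. D). mle_exists_uniquely n (Y :: nat \<Rightarrow> real^'m2^'m1))"
    define e where "e \<longleftrightarrow> (AE Y in PiM {..<n} (\<lambda>_. D). mle_exists n (Y :: nat \<Rightarrow> real^'m2^'m1))"
    define b where "b \<longleftrightarrow> (AE Y in PiM {..<n} (\<lambda>_. D). loglik_bounded n (Y :: nat \<Rightarrow> real^'m2^'m1))"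
    have ue: "u \<Longrightarrow> e" unfolding u_def e_def by (rule AE_exists_if_unique)
    have eb: "e \<Longrightarrow> b" unfolding e_def b_def by (rule AE_bounded_if_exists)
    have not_b: "\<not> b" if "\<And>Y :: nat \<Rightarrow> real^'m2^'m1. \<not> loglik_bounded n Y"
      unfolding b_def by (rule not_AE_if_impossible[OF D S, where \<Psi> = "\<lambda>_. True"]) (use that in auto)
    have not_u: "\<not> u" if "AE Y in PiM {..<n} (\<lambda>_. D). \<not> mle_exists_uniquely n (Y :: nat \<Rightarrow> real^'m2^'m1)"
      unfolding u_def by (rule not_AE_if_impossible[OF D S that])
    have u_stable: "u" if "AE Y in PiM {..<n} (\<lambda>_. D). stable_sample n (Y :: nat \<Rightarrow> real^'m2^'m1)"
      unfolding u_def by (rule AE_exists_uniquely_if_stable[OF that n])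
    consider (one) "n = 1" | (two) "n = 2" | (three) "n \<ge> 3" using n by linarith
    then have "(u \<longleftrightarrow> Nu \<le> n) \<and> (e \<longleftrightarrow> Ne \<le> n) \<and> (b \<longleftrightarrow> Ne \<le> n)"
    proof cases
      case one
      show ?thesis
      proof (cases "m1 = m2")
        case True
        have ae: "AE Y in PiM {..<n} (\<lambda>_. D). mle_exists n (Y :: nat \<Rightarrow> real^'m2^'m1) \<and> \<not> mle_exists_uniquely n Y"
          unfolding one by (rule AE_one_square_sample[OF D S]) (use True assms in auto)
        have e unfolding e_def using ae by eventually_elim blast
        moreover have "\<not> u" by (rule not_u) (use ae in eventually_elim, blast)
        ultimately show ?thesis using eb one True by (simp add: Nu_def Ne_def)
      next
        case False
        then have "\<not> b" unfolding one using assms by (intro not_b[unfolded one] one_sample_unbounded) auto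
        then show ?thesis using eb ue one False by (auto simp: Nu_def Ne_def)
      qed
    next
      case two
      show ?thesis
      proof (cases "m1 = m2")
        case True
        have e unfolding e_def two by (rule AE_two_square_samples_exist[OF D S]) (use True m in auto)
        moreover have "\<not> u" unfolding u_def two
          by (rule two_square_samples_not_AE_unique[OF D S]) (use True assms in auto)
        ultimately show ?thesis using eb two True by (simp add: Nu_def Ne_def)
      next
        case False
        then have lt: "CARD('m2) < CARD('m1)" using assms by simp
        show ?thesis
        proof (cases "(m1 - m2) dvd m2")
          case dvd: True
          have ae: "AE Y in PiM {..<n} (\<lambda>_. D). mle_exists n (Y :: nat \<Rightarrow> real^'m2^'m1) \<and>
              (m1 \<noteq> m2 + 1 \<longrightarrow> \<not> mle_exists_uniquely n Y)"
            unfolding two m by (rule AE_two_samples_divisible[OF D S lt]) (use dvd m in simp)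
          have e unfolding e_def using ae by eventually_elim blast
          moreover have "u" if m12: "m1 = m2 + 1"
          proof -
            have "CARD(2) \<le> n" using two by simp
            then obtain f :: "2 \<Rightarrow> nat" where f: "inj f" "range f \<subseteq> {..<n}"
              using index_injection by blast
            have m12': "CARD('m1) = CARD('m2) + 1" using m12 m by simp
            show ?thesis
              by (rule u_stable, rule AE_stable_sample[OF D S f])
                 (use two_sample_count[where ?m2.0 = "CARD('m2)"] in \<open>simp add: m12'\<close>)
          qed
          moreover have "\<not> u" if "m1 \<noteq> m2 + 1"
            by (rule not_u) (use ae that in \<open>auto elim: eventually_mono\<close>)
          ultimately show ?thesis using eb two False dvd assms by (auto simp: Nu_def Ne_def)
        next
          case ndvd: False
          have "\<not> b" unfolding two using lt ndvd m by (intro not_b[unfolded two] two_samples_unbounded) auto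
          moreover have "m1 \<noteq> m2 + 1" using ndvd by auto
          ultimately show ?thesis using eb ue two False ndvd by (auto simp: Nu_def Ne_def)
        qed
      qed
    next
      case three
      have "CARD(3) \<le> n" using three by simp
      then obtain f :: "3 \<Rightarrow> nat" where f: "inj f" "range f \<subseteq> {..<n}"
        using index_injection by blast
      have u
        by (rule u_stable, rule AE_stable_sample[OF D S f])
           (use three_sample_count[where ?m1.0 = "CARD('m1)" and ?m2.0 = "CARD('m2)"] assms in simp)
      then show ?thesis using ue eb three by (auto simp: Nu_def Ne_def)
    qed
    then show ?thesis unfolding u_def e_def b_def .
  qed
  have "is_threshold (mle_exists_uniquely :: nat \<Rightarrow> (nat \<Rightarrow> real^'m2^'m1) \<Rightarrow> bool) Nu"
    by (rule is_thresholdI) (use thresholds in \<open>auto simp: Nu_def\<close>)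
  moreover have "is_threshold (mle_exists :: nat \<Rightarrow> (nat \<Rightarrow> real^'m2^'m1) \<Rightarrow> bool) Ne"
    by (rule is_thresholdI) (use thresholds in \<open>auto simp: Ne_def\<close>)
  moreover have "is_threshold (loglik_bounded :: nat \<Rightarrow> (nat \<Rightarrow> real^'m2^'m1) \<Rightarrow> bool) Ne"
    by (rule is_thresholdI) (use thresholds in \<open>auto simp: Ne_def\<close>)
  ultimately show ?thesis unfolding Nu_def Ne_def by blast
qed

end
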